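(* Let $R$ be a hyperbolic Bessel process of index $\alpha=0$ starting from $x=0$. Then for every $t>0$ the density of $\cosh R_t$ on $[1,\infty)$ is given by $$\mathbb{P}(\cosh R_t\in dz)=\mathbb{E}\Bigl[\frac{1}{4A_{t/4}^{(1)}}\exp\Bigl(-\frac{z-1}{4A_{t/4}^{(1)}}\Bigr)\Bigr]\,dz,$$ where $A_t^{(1)}=\int_0^te^{2(B_u+u)}\,du$ with $B$ a standard Brownian motion.
   Context: A hyperbolic Bessel process of index $0$ starting from $0$ is the nonnegative diffusion $R$ satisfying $R_t=B_t+\frac12\int_0^t\coth R_u\,du$, where $B$ is a standard Brownian motion. *)

theory Defs
  imports "HOL-Probability.Probability"
begin

text \<open>
  Processes are indexed by \<^typ>\<open>real\<close>, but only the times \<open>t \<ge> 0\<close> matter.  All paths of a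
  Brownian motion (not just almost all) are required to be continuous and to start from \<open>0\<close>:
  no completeness of \<open>M\<close> is assumed, and path integrals such as \<open>exp_functional\<close> below
  are then measurable.
\<close>

locale brownian_motion = prob_space M for M :: "'a measure" +
  fixes B :: "real \<Rightarrow> 'a \<Rightarrow> real"
  assumes measurable_B: "\<And>t. 0 \<le> t \<Longrightarrow> random_variable borel (B t)"
    and start_zero: "\<And>\<omega>. \<omega> \<in> space M \<Longrightarrow> B 0 \<omega> = 0"
    and continuous_paths: "\<And>\<omega>. \<omega> \<in> space M \<Longrightarrow> continuous_on {0..} (\<lambda>t. B t \<omega>)"
    and gaussian_increments: "\<And>s t. 0 \<le> s \<Longrightarrow> s < t \<Longrightarrow>
      distributed M lborel (\<lambda>\<omega>. B t \<omega> - B s \<omega>) (normal_density 0 (sqrt (t - s)))"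
    and independent_increments: "\<And>(\<tau> :: nat \<Rightarrow> real) n.
      0 \<le> \<tau> 0 \<Longrightarrow> (\<And>i. i < n \<Longrightarrow> \<tau> i \<le> \<tau> (Suc i)) \<Longrightarrow>
      indep_vars (\<lambda>_. borel) (\<lambda>i \<omega>. B (\<tau> (Suc i)) \<omega> - B (\<tau> i) \<omega>) {..<n}"

locale brownian_motion_wrt = brownian_motion M B + filtration "space M" F
  for M :: "'a measure" and F :: "real \<Rightarrow> 'a measure" and B :: "real \<Rightarrow> 'a \<Rightarrow> real" +
  assumes subalgebra_F: "\<And>t. 0 \<le> t \<Longrightarrow> subalgebra M (F t)"
    and adapted_B: "\<And>t. 0 \<le> t \<Longrightarrow> B t \<in> borel_measurable (F t)"
    and increment_indep_past: "\<And>s t. 0 \<le> s \<Longrightarrow> s < t \<Longrightarrow>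
      indep_set (sets (F s)) (sets (vimage_algebra (space M) (\<lambda>\<omega>. B t \<omega> - B s \<omega>) borel))"

definition coth :: "real \<Rightarrow> real" where
  "coth x = cosh x / sinh x"

text \<open>
  A hyperbolic Bessel process of index \<open>0\<close> starting from \<open>0\<close>, as a weak solution of
  \[ R_t = B_t + \frac12 \int_0^t \coth R_u \, du . \]
  Since the noise is additive, the equation is meaningful path by path.
  For \<open>R \<ge> 0\<close> the value of \<open>coth\<close> at \<open>0\<close> is to be read as \<open>+\<infinity>\<close>, so that
  finiteness of the integral forces \<open>R_u > 0\<close> for almost every \<open>u\<close>.  As division by zero gives
  \<open>coth 0 = 0\<close> here, this consequence is stated explicitly, along with integrability.
\<close>

definition hyperbolic_bessel_0 :: "'a measure \<Rightarrow> (real \<Rightarrow> 'a \<Rightarrow> real) \<Rightarrow> bool" where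
  "hyperbolic_bessel_0 M R \<longleftrightarrow>
    (\<exists>F B. brownian_motion_wrt M F B \<and>
      (\<forall>t\<ge>0. R t \<in> borel_measurable (F t)) \<and>
      (AE \<omega> in M.
        continuous_on {0..} (\<lambda>t. R t \<omega>) \<and>
        (\<forall>t\<ge>0. R t \<omega> \<ge> 0) \<and>
        (AE u in lborel. u \<ge> 0 \<longrightarrow> R u \<omega> > 0) \<and>
        (\<forall>t\<ge>0. set_integrable lborel {0..t} (\<lambda>u. coth (R u \<omega>)) \<and>
          R t \<omega> = B t \<omega> + 1 / 2 * (LINT u:{0..t}|lborel. coth (R u \<omega>)))))"

definition exp_functional :: "real \<Rightarrow> (real \<Rightarrow> 'a \<Rightarrow> real) \<Rightarrow> real \<Rightarrow> 'a \<Rightarrow> real" where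
  "exp_functional \<mu> B t \<omega> = (LINT u:{0..t}|lborel. exp (2 * (B u \<omega> + \<mu> * u)))"

end

theory Submission
  imports Defs "HOL-Real_Asymp.Real_Asymp"
begin

text \<open>
  Put \<open>Y = cosh R - 1\<close>.  By Ito's formula \<open>Y\<close> has the generator
  \<open>L g = 1/2 (y^2 + 2 y) g'' + (1 + y) g'\<close>, whose coefficients are smooth although the drift of
  \<open>R\<close> is singular at \<open>0\<close>.  On exponentials the variables \<open>y\<close> and \<open>l\<close> can be exchanged:
  \[ L e^{-l y} = \bigl(\tfrac12 l^2 \partial_l^2 + (l - l^2) \partial_l - l\bigr) e^{-l y}. \]
  The operator on the right generates the logistic diffusion
  \<open>d\<Lambda> = \<Lambda> db + (\<Lambda> - \<Lambda>^2) du\<close>, killed at rate \<open>\<Lambda>\<close>.  Hence \<open>Y\<close> and the killed logistic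
  diffusion are dual to each other: as \<open>Y\<close> starts from \<open>0\<close>, the Laplace transform
  \<open>E (exp (- l Y_t))\<close> is the probability that \<open>\<Lambda>\<close>, started from \<open>l\<close>, survives up to time \<open>t\<close>.
  The logistic equation is solved explicitly by
  \[ \Lambda_u = \frac{l e^{b_u + u/2}}{1 + l \int_0^u e^{b_v + v/2} dv}, \qquad
     \exp\Bigl(-\int_0^t \Lambda_u du\Bigr) = \frac{1}{1 + l \int_0^t e^{b_v + v/2} dv}, \]
  and for \<open>b_v = 2 B_{v/4}\<close> the integral over \<open>[0, t]\<close> is \<open>4 A_{t/4}\<close>.  Finally \<open>1 / (1 + l c)\<close> is
  the Laplace transform of the exponential law of mean \<open>c\<close>, so that \<open>Y_t\<close> is a mixture of
  exponential laws with random mean \<open>4 A_{t/4}\<close>.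

  The argument below is discrete on both sides.  On the side of \<open>R\<close> it uses Dynkin's formula for the
  functions \<open>p(y) e^{-l y}\<close> with a polynomial \<open>p\<close> (\<open>bessel_dynkin\<close>): a sum over a fine partition
  is split into Brownian increments, which are independent of the past, and drift increments, which
  are nonnegative and converge path by path (\<open>pathwise_ito_limit\<close>).  The logistic diffusion is
  replaced by a discrete chain (\<open>logistic_step\<close>) that preserves the explicit solution: its
  survival probability after \<open>n\<close> steps is \<open>1 / (1 + l S)\<close> with a Riemann sum \<open>S\<close> of the
  exponential functional.  One step of the chain agrees with the evolution of the Laplace transform
  of \<open>Y\<close> over a time \<open>h\<close> up to an error of order \<open>h^(3/2)\<close> (\<open>bessel_laplace_one_step\<close>), so the
  errors of all steps add up to something that vanishes with \<open>h\<close> (\<open>bessel_laplace_eq\<close>).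
\<close>

section \<open>Riemann sums\<close>

lemma set_integral_singleton:
  fixes d :: "real \<Rightarrow> real"
  shows "(LINT u:{a}|lborel. d u) = 0"
proof -
  have "AE u in lborel. u \<noteq> a"
    by (rule AE_lborel_singleton)
  then show ?thesis
    unfolding set_lebesgue_integral_def by (intro integral_eq_zero_AE) (auto elim!: eventually_mono)
qed

lemma set_integral_grid:
  fixes d :: "real \<Rightarrow> real"
  assumes h: "0 \<le> h" and d: "set_integrable lborel {0..real n * h} d"
  shows "(LINT u:{0..real n * h}|lborel. d u)
    = (\<Sum>i<n. LINT u:{real i * h<..real (Suc i) * h}|lborel. d u)"
  using d
proof (induction n)
  case 0
  show ?case
    by (simp add: set_integral_singleton)
next
  case (Suc n)
  have split: "{0..real (Suc n) * h} = {0..real n * h} \<union> {real n * h<..real (Suc n) * h}"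
    using h by (auto simp: field_simps) (smt (verit) mult_nonneg_nonneg of_nat_0_le_iff)
  have int: "set_integrable lborel {0..real n * h} d"
    "set_integrable lborel {real n * h<..real (Suc n) * h} d"
    using Suc.prems unfolding split by (auto intro: set_integrable_subset)
  show ?case
    unfolding split using int by (subst set_integral_Un) (auto simp: Suc.IH)
qed

lemma set_integrable_continuous_mult:
  fixes d \<phi> :: "real \<Rightarrow> real"
  assumes \<phi>: "continuous_on {0..t} \<phi>" and d: "set_integrable lborel {0..t} d"
  shows "set_integrable lborel {0..t} (\<lambda>u. \<phi> u * d u)"
proof -
  obtain C where C: "\<And>u. u \<in> {0..t} \<Longrightarrow> norm (\<phi> u) \<le> C"
    using compact_imp_bounded[OF compact_continuous_image[OF \<phi> compact_Icc]]
    unfolding bounded_iff by (metis imageI)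
  have "(\<lambda>u. indicator {0..t} u *\<^sub>R \<phi> u) \<in> borel_measurable borel"
    using borel_measurable_continuous_on_indicator[OF _ \<phi>] by simp
  moreover have "(\<lambda>u. indicator {0..t} u *\<^sub>R d u) \<in> borel_measurable borel"
    using d by (auto simp: set_integrable_def dest: borel_measurable_integrable)
  ultimately have "(\<lambda>u. (indicator {0..t} u *\<^sub>R \<phi> u) * (indicator {0..t} u *\<^sub>R d u)) \<in> borel_measurable borel"
    by (rule borel_measurable_times)
  also have "(\<lambda>u. (indicator {0..t} u *\<^sub>R \<phi> u) * (indicator {0..t} u *\<^sub>R d u))
      = (\<lambda>u. indicator {0..t} u *\<^sub>R (\<phi> u * d u))"
    by (auto simp: indicator_def)
  finally have meas: "(\<lambda>u. indicator {0..t} u *\<^sub>R (\<phi> u * d u)) \<in> borel_measurable borel" .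
  have "integrable lborel (\<lambda>u. C * (indicator {0..t} u *\<^sub>R d u))"
    using d unfolding set_integrable_def by (rule integrable_mult_right)
  then show ?thesis
    unfolding set_integrable_def
  proof (rule Bochner_Integration.integrable_bound)
    show "AE u in lborel. norm (indicator {0..t} u *\<^sub>R (\<phi> u * d u))
        \<le> norm (C * (indicator {0..t} u *\<^sub>R d u))"
    proof (intro AE_I2)
      fix u
      show "norm (indicator {0..t} u *\<^sub>R (\<phi> u * d u)) \<le> norm (C * (indicator {0..t} u *\<^sub>R d u))"
      proof (cases "u \<in> {0..t}")
        case True
        then have "\<bar>\<phi> u\<bar> \<le> \<bar>C\<bar>"
          using C[OF True] by auto
        with True show ?thesis
          by (simp add: abs_mult mult_right_mono)
      qed simp
    qed
  qed (use meas in simp)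
qed

definition grid :: "real \<Rightarrow> nat \<Rightarrow> nat \<Rightarrow> real" where
  "grid t n i = real i * (t / real n)"

lemma grid_0 [simp]: "grid t n 0 = 0"
  by (simp add: grid_def)

lemma grid_last [simp]: "0 < n \<Longrightarrow> grid t n n = t"
  by (simp add: grid_def)

lemma grid_nonneg: "0 \<le> t \<Longrightarrow> 0 \<le> grid t n i"
  by (simp add: grid_def)

lemma grid_mono: "0 \<le> t \<Longrightarrow> i \<le> j \<Longrightarrow> grid t n i \<le> grid t n j"
  unfolding grid_def by (intro mult_right_mono) auto

lemma grid_Suc: "grid t n (Suc i) = grid t n i + t / real n"
  by (simp add: grid_def algebra_simps add_divide_distrib)

lemma grid_le: "0 \<le> t \<Longrightarrow> 0 < n \<Longrightarrow> i \<le> n \<Longrightarrow> grid t n i \<le> t"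
  using grid_mono[of t i n n] by simp

text \<open>
  The weight is merely integrable: it will be the drift density of \<open>R\<close>, which explodes at the
  zeros of \<open>R\<close>.  Uniform continuity of \<open>\<phi>\<close> bounds the error by a small multiple of the
  \<open>L^1\<close> norm of the weight.
\<close>

lemma weighted_riemann_sums_tendsto:
  fixes d \<phi> :: "real \<Rightarrow> real"
  assumes t: "0 < t" and \<phi>: "continuous_on {0..t} \<phi>" and d: "set_integrable lborel {0..t} d"
  shows "(\<lambda>n. \<Sum>i<n. \<phi> (grid t n i) *
      (LINT u:{grid t n i<..grid t n (Suc i)}|lborel. d u))
    \<longlonglongrightarrow> (LINT u:{0..t}|lborel. \<phi> u * d u)"
unfolding grid_def
proof (rule LIMSEQ_I)
  fix e :: real assume e: "0 < e"
  define V where "V = (LINT u:{0..t}|lborel. \<bar>d u\<bar>)"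
  have V: "0 \<le> V"
    unfolding V_def set_lebesgue_integral_def by (intro integral_nonneg_AE) auto
  define e' where "e' = e / (V + 1)"
  have e': "0 < e'" "e' * V < e"
    using e V by (auto simp: e'_def field_simps)
  obtain \<delta> where \<delta>: "0 < \<delta>"
    "\<And>u v. u \<in> {0..t} \<Longrightarrow> v \<in> {0..t} \<Longrightarrow> dist v u < \<delta> \<Longrightarrow> dist (\<phi> v) (\<phi> u) < e'"
    using compact_uniformly_continuous[OF \<phi>] e'(1)
    by (auto simp: uniformly_continuous_on_def)
  have \<phi>d: "set_integrable lborel {0..t} (\<lambda>u. \<phi> u * d u)"
    using \<phi> d by (rule set_integrable_continuous_mult)
  have "\<forall>\<^sub>F n in sequentially. t / \<delta> < real n"
    using filterlim_real_sequentially by (auto simp: filterlim_at_top_dense)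
  then obtain n0 where n0: "\<And>n. n0 \<le> n \<Longrightarrow> t / \<delta> < real n"
    by (auto simp: eventually_sequentially)
  have "norm ((\<Sum>i<n. \<phi> (real i * (t / real n)) *
      (LINT u:{real i * (t / real n)<..real (Suc i) * (t / real n)}|lborel. d u))
      - (LINT u:{0..t}|lborel. \<phi> u * d u)) < e" if n: "n0 \<le> n" for n
  proof -
    define h where "h = t / real n"
    have npos: "0 < real n"
      using n0[OF n] t \<delta>(1) by (smt (verit) divide_pos_pos)
    have h: "0 \<le> h" "h < \<delta>" "real n * h = t"
      using n0[OF n] t \<delta>(1) npos by (auto simp: h_def field_simps)
    define I where "I i = {real i * h<..real (Suc i) * h}" for i
    have sub: "I i \<subseteq> {0..t}" if "i < n" for i
    proof -
      have "real (Suc i) * h \<le> real n * h"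
        using that h by (intro mult_right_mono) auto
      then show ?thesis
        using h unfolding I_def by (auto simp: h(3)) (smt (verit) mult_nonneg_nonneg of_nat_0_le_iff)
    qed
    have si: "real i * h \<in> {0..t}" if "i < n" for i
    proof -
      have "real i * h \<le> real n * h"
        using that h by (intro mult_right_mono) auto
      then show ?thesis using h by auto
    qed
    have id: "set_integrable lborel (I i) d" "set_integrable lborel (I i) (\<lambda>u. \<bar>d u\<bar>)"
        "set_integrable lborel (I i) (\<lambda>u. \<phi> u * d u)"
      if "i < n" for i
      using set_integrable_subset[OF d _ sub[OF that]] set_integrable_subset[OF \<phi>d _ sub[OF that]]
      by (auto simp: I_def intro: set_integrable_abs)
    have absd: "set_integrable lborel {0..t} (\<lambda>u. \<bar>d u\<bar>)"
      using d by (rule set_integrable_abs)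
    have "norm ((\<Sum>i<n. \<phi> (real i * h) * (LINT u:I i|lborel. d u)) - (LINT u:{0..t}|lborel. \<phi> u * d u))
        = norm (\<Sum>i<n. (LINT u:I i|lborel. \<phi> (real i * h) * d u - \<phi> u * d u))"
      using set_integral_grid[OF h(1), of n "\<lambda>u. \<phi> u * d u"] \<phi>d h(3) id
      by (simp add: I_def sum_subtractf[symmetric])
    also have "\<dots> \<le> (\<Sum>i<n. e' * (LINT u:I i|lborel. \<bar>d u\<bar>))"
    proof (rule sum_norm_le)
      fix i assume "i \<in> {..<n}"
      then have i: "i < n" by simp
      have "norm (LINT u:I i|lborel. \<phi> (real i * h) * d u - \<phi> u * d u)
          \<le> (LINT u:I i|lborel. norm (\<phi> (real i * h) * d u - \<phi> u * d u))"
        using id[OF i] by (intro set_integral_norm_bound set_integral_diff) auto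
      also have "\<dots> \<le> (LINT u:I i|lborel. e' * \<bar>d u\<bar>)"
      proof (rule set_integral_mono)
        show "set_integrable lborel (I i) (\<lambda>u. norm (\<phi> (real i * h) * d u - \<phi> u * d u))"
          using id[OF i] by (intro set_integrable_norm set_integral_diff) auto
        show "set_integrable lborel (I i) (\<lambda>u. e' * \<bar>d u\<bar>)"
          using id[OF i] by auto
        fix u assume u: "u \<in> I i"
        have "dist (real i * h) u < \<delta>"
          using u h by (auto simp: I_def dist_real_def algebra_simps)
        then have "\<bar>\<phi> (real i * h) - \<phi> u\<bar> < e'"
          using \<delta>(2)[of u "real i * h"] si[OF i] sub[OF i] u by (auto simp: dist_real_def)
        then show "norm (\<phi> (real i * h) * d u - \<phi> u * d u) \<le> e' * \<bar>d u\<bar>"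
          by (simp add: left_diff_distrib[symmetric] abs_mult mult_right_mono)
      qed
      finally show "norm (LINT u:I i|lborel. \<phi> (real i * h) * d u - \<phi> u * d u)
          \<le> e' * (LINT u:I i|lborel. \<bar>d u\<bar>)"
        by simp
    qed
    also have "\<dots> = e' * V"
      using set_integral_grid[OF h(1), of n "\<lambda>u. \<bar>d u\<bar>"] absd h(3)
      by (simp add: V_def I_def sum_distrib_left)
    finally show ?thesis
      using e'(2) by (simp add: I_def h_def)
  qed
  then show "\<exists>no. \<forall>n\<ge>no. norm ((\<Sum>i<n. \<phi> (real i * (t / real n)) *
      (LINT u:{real i * (t / real n)<..real (Suc i) * (t / real n)}|lborel. d u))
      - (LINT u:{0..t}|lborel. \<phi> u * d u)) < e"
    by blast
qed

lemma riemann_sums_tendsto: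
  fixes \<phi> :: "real \<Rightarrow> real"
  assumes t: "0 < t" and \<phi>: "continuous_on {0..t} \<phi>"
  shows "(\<lambda>n. \<Sum>i<n. t / real n * \<phi> (grid t n i)) \<longlonglongrightarrow> (LINT u:{0..t}|lborel. \<phi> u)"
proof -
  have "set_integrable lborel {0..t} (\<lambda>u. 1::real)"
    using integrable_real_indicator[of "{0..t}" lborel] by (simp add: set_integrable_def emeasure_lborel_Icc_eq)
  from weighted_riemann_sums_tendsto[OF t \<phi> this]
  have "(\<lambda>n. \<Sum>i<n. \<phi> (grid t n i) *
      (LINT u:{grid t n i<..grid t n (Suc i)}|lborel. (1::real)))
    \<longlonglongrightarrow> (LINT u:{0..t}|lborel. \<phi> u)"
    by simp
  moreover have "\<phi> (grid t n i) *
      (LINT u:{grid t n i<..grid t n (Suc i)}|lborel. (1::real))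
      = t / real n * \<phi> (grid t n i)" for i n
  proof -
    have "grid t n i \<le> grid t n (Suc i)"
      using t by (intro grid_mono) auto
    then have "measure lborel {grid t n i<..grid t n (Suc i)} = t / real n"
      by (simp add: measure_lborel_Ioc grid_def algebra_simps add_divide_distrib)
    then show ?thesis
      by (simp add: set_lebesgue_integral_def)
  qed
  ultimately show ?thesis
    by simp
qed

section \<open>Gaussian averages\<close>

text \<open>
  In Taylor's formula of order two the first two moments of the Gaussian law give the stated
  terms, and the cubic remainder costs the third absolute moment, which is of order \<open>h^(3/2)\<close>.
  With a rate faster than \<open>h\<close>, the errors made in \<open>1 / h\<close> steps still vanish in total.
\<close>

lemma gaussian_second_order_expansion:
  fixes F F1 F2 F3 :: "real \<Rightarrow> real"
  assumes "\<And>x. (F has_real_derivative F1 x) (at x)" "\<And>x. (F1 has_real_derivative F2 x) (at x)"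
    "\<And>x. (F2 has_real_derivative F3 x) (at x)"
    and C: "\<And>x. \<bar>F3 x\<bar> \<le> C" and bounded: "\<And>x. \<bar>F x\<bar> \<le> c" and h: "0 < h"
  shows "\<bar>(\<integral>x. normal_density 0 (sqrt h) x * F (r + x) \<partial>lborel) - F r - h / 2 * F2 r\<bar> \<le> C * (h * sqrt h)"
proof -
  let ?N = "normal_density 0 (sqrt h)"
  have s: "0 < sqrt h" using h by simp
  have C0: "0 \<le> C" using C[of 0] by linarith
  have taylor: "\<bar>F (r + x) - F r - F1 r * x - F2 r / 2 * x\<^sup>2\<bar> \<le> C / 6 * \<bar>x\<bar> ^ 3" for x
  proof (cases "x = 0")
    case False
    define D where "D = (\<lambda>n::nat. if n = 0 then F else if n = 1 then F1 else if n = 2 then F2 else F3)"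
    have "\<exists>t. (if r + x < r then r + x < t \<and> t < r else r < t \<and> t < r + x) \<and>
        F (r + x) = (\<Sum>m<3. D m r / fact m * (r + x - r) ^ m) + D 3 t / fact 3 * (r + x - r) ^ 3"
      by (rule Taylor[of 3 D F "min r (r + x)" "max r (r + x)" r "r + x"])
        (use False assms in \<open>auto simp: D_def less_Suc_eq numeral_3_eq_3\<close>)
    then obtain t where "F (r + x) = (\<Sum>m<3. D m r / fact m * x ^ m) + D 3 t / fact 3 * x ^ 3"
      by auto
    then have "F (r + x) - F r - F1 r * x - F2 r / 2 * x\<^sup>2 = F3 t / 6 * x ^ 3"
      by (simp add: D_def numeral_3_eq_3 fact_numeral power2_eq_square)
    moreover have "\<bar>F3 t / 6 * x ^ 3\<bar> \<le> C / 6 * \<bar>x\<bar> ^ 3"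
      unfolding abs_mult power_abs by (intro mult_right_mono) (use C[of t] in auto)
    ultimately show ?thesis
      by (simp only:)
  qed simp
  have tN: "\<bar>?N x * (F (r + x) - F r - F1 r * x - F2 r / 2 * x\<^sup>2)\<bar> \<le> C / 6 * (?N x * \<bar>x\<bar> ^ 3)" for x
  proof -
    have "\<bar>?N x * (F (r + x) - F r - F1 r * x - F2 r / 2 * x\<^sup>2)\<bar>
        = ?N x * \<bar>F (r + x) - F r - F1 r * x - F2 r / 2 * x\<^sup>2\<bar>"
      by (simp only: abs_mult abs_of_nonneg[OF normal_density_nonneg])
    also have "\<dots> \<le> ?N x * (C / 6 * \<bar>x\<bar> ^ 3)"
      by (intro mult_left_mono taylor) simp
    also have "\<dots> = C / 6 * (?N x * \<bar>x\<bar> ^ 3)"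
      by (rule mult.left_commute)
    finally show ?thesis .
  qed
  have Fc: "continuous_on UNIV F"
    using assms(1) by (auto intro!: DERIV_continuous_on)
  have Fm[measurable]: "F \<in> borel_measurable borel"
    using borel_measurable_continuous_onI[OF Fc] .
  have iF: "integrable lborel (\<lambda>x. ?N x * F (r + x))"
  proof (rule Bochner_Integration.integrable_bound)
    show "integrable lborel (\<lambda>x. c * ?N x)"
      using s by simp
    show "AE x in lborel. norm (?N x * F (r + x)) \<le> norm (c * ?N x)"
    proof (intro AE_I2)
      fix x
      have "\<bar>F (r + x)\<bar> \<le> \<bar>c\<bar>" using bounded[of "r + x"] by linarith
      then have "?N x * \<bar>F (r + x)\<bar> \<le> ?N x * \<bar>c\<bar>"
        by (intro mult_left_mono) auto
      then show "norm (?N x * F (r + x)) \<le> norm (c * ?N x)"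
        by (simp add: abs_mult mult.commute)
    qed
  qed simp
  have m0: "has_bochner_integral lborel ?N 1"
    using normal_moment_even[OF s, of 0 0] by simp
  have m1: "has_bochner_integral lborel (\<lambda>x. ?N x * x) 0"
    using normal_moment_odd[OF s, of 0 0] by simp
  have m2: "has_bochner_integral lborel (\<lambda>x. ?N x * x\<^sup>2) h"
    using normal_moment_even[OF s, of 0 1] h by (simp add: fact_2)
  have m3: "has_bochner_integral lborel (\<lambda>x. ?N x * \<bar>x\<bar> ^ 3) (2 * (h * sqrt h) * sqrt (2 / pi))"
    using normal_moment_abs_odd[OF s, of 0 1] h by (simp add: power3_eq_cube mult.assoc)
  have poly: "has_bochner_integral lborel (\<lambda>x. F r * ?N x + F1 r * (?N x * x) + F2 r / 2 * (?N x * x\<^sup>2))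
      (F r * 1 + F1 r * 0 + F2 r / 2 * h)"
    by (intro has_bochner_integral_add has_bochner_integral_mult_right m0 m1 m2)
  have "(\<integral>x. ?N x * F (r + x) \<partial>lborel) - F r - h / 2 * F2 r
      = (\<integral>x. ?N x * F (r + x) - (F r * ?N x + F1 r * (?N x * x) + F2 r / 2 * (?N x * x\<^sup>2)) \<partial>lborel)"
    using has_bochner_integral_integral_eq[OF poly] has_bochner_integral_integrable poly iF
    by (subst Bochner_Integration.integral_diff) (auto simp: has_bochner_integral_iff)
  also have "(\<lambda>x. ?N x * F (r + x) - (F r * ?N x + F1 r * (?N x * x) + F2 r / 2 * (?N x * x\<^sup>2)))
      = (\<lambda>x. ?N x * (F (r + x) - F r - F1 r * x - F2 r / 2 * x\<^sup>2))"
    by (auto simp: algebra_simps)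
  finally have error: "(\<integral>x. ?N x * F (r + x) \<partial>lborel) - F r - h / 2 * F2 r
      = (\<integral>x. ?N x * (F (r + x) - F r - F1 r * x - F2 r / 2 * x\<^sup>2) \<partial>lborel)" .
  have "\<bar>\<integral>x. ?N x * (F (r + x) - F r - F1 r * x - F2 r / 2 * x\<^sup>2) \<partial>lborel\<bar>
      \<le> (\<integral>x. C / 6 * (?N x * \<bar>x\<bar> ^ 3) \<partial>lborel)"
  proof (rule integral_abs_bound_integral)
    show "integrable lborel (\<lambda>x. C / 6 * (?N x * \<bar>x\<bar> ^ 3))"
      using m3 by (auto simp: has_bochner_integral_iff)
    show i2: "integrable lborel (\<lambda>x. ?N x * (F (r + x) - F r - F1 r * x - F2 r / 2 * x\<^sup>2))"
    proof (rule Bochner_Integration.integrable_bound)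
      show "integrable lborel (\<lambda>x. C / 6 * (?N x * \<bar>x\<bar> ^ 3))"
        using m3 by (auto simp: has_bochner_integral_iff)
      show "AE x in lborel. norm (?N x * (F (r + x) - F r - F1 r * x - F2 r / 2 * x\<^sup>2))
          \<le> norm (C / 6 * (?N x * \<bar>x\<bar> ^ 3))"
        using tN order.trans[OF tN abs_ge_self] by (intro AE_I2) (simp only: real_norm_def)
    qed simp
    fix x
    show "\<bar>?N x * (F (r + x) - F r - F1 r * x - F2 r / 2 * x\<^sup>2)\<bar> \<le> C / 6 * (?N x * \<bar>x\<bar> ^ 3)"
      by (rule tN)
  qed
  also have "\<dots> = C / 6 * (2 * (h * sqrt h) * sqrt (2 / pi))"
    using has_bochner_integral_integral_eq[OF m3] by simp
  also have "\<dots> \<le> C * (h * sqrt h)"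
  proof -
    have "sqrt (2 / pi) \<le> 1"
      using pi_ge_two by simp
    then have "2 * (h * sqrt h) * sqrt (2 / pi) \<le> 2 * (h * sqrt h) * 1"
      using h by (intro mult_left_mono) auto
    then have "C / 6 * (2 * (h * sqrt h) * sqrt (2 / pi)) \<le> C / 6 * (2 * (h * sqrt h))"
      using C0 by (intro mult_left_mono) auto
    also have "\<dots> \<le> C * (h * sqrt h)"
      using C0 h by (simp add: field_simps)
    finally show ?thesis .
  qed
  finally show ?thesis
    unfolding error .
qed

section \<open>Laplace transforms of probability laws\<close>

text \<open>
  For a law on \<open>[-1, 1]\<close> the power series of \<open>exp (i t x)\<close> can be integrated term by term, so
  that the moments determine the characteristic function.
\<close>

lemma bounded_moments_determine:
  fixes \<mu> \<nu> :: "real measure"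
  assumes "real_distribution \<mu>" "real_distribution \<nu>"
    and b: "AE x in \<mu>. \<bar>x\<bar> \<le> 1" "AE x in \<nu>. \<bar>x\<bar> \<le> 1"
    and m: "\<And>n. (\<integral>x. x ^ n \<partial>\<mu>) = (\<integral>x. x ^ n \<partial>\<nu>)"
  shows "\<mu> = \<nu>"
proof (rule Levy_uniqueness)
  have char: "(\<lambda>k. complex_of_real (\<integral>x. x ^ k \<partial>\<rho>) * (\<i> * t) ^ k / fact k) sums char \<rho> t"
    if \<rho>: "real_distribution \<rho>" and b: "AE x in \<rho>. \<bar>x\<bar> \<le> 1" for \<rho> and t :: real
  proof -
    interpret \<rho>: real_distribution \<rho> by fact
    define S where "S n x = (\<Sum>k<n. (\<i> * t * x) ^ k / fact k)" for n and x :: real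
    have "(\<lambda>n. \<integral>x. S n x \<partial>\<rho>) \<longlonglongrightarrow> (\<integral>x. iexp (t * x) \<partial>\<rho>)"
    proof (rule integral_dominated_convergence[where w="\<lambda>_. exp \<bar>t\<bar>"])
      show "AE x in \<rho>. (\<lambda>n. S n x) \<longlonglongrightarrow> iexp (t * x)"
      proof (intro AE_I2)
        fix x :: real
        have "(\<lambda>k. (\<i> * t * x) ^ k /\<^sub>R fact k) sums exp (\<i> * t * x)"
          by (rule exp_converges)
        then show "(\<lambda>n. S n x) \<longlonglongrightarrow> iexp (t * x)"
          by (simp add: sums_def S_def scaleR_conv_of_real field_simps)
      qed
      show "AE x in \<rho>. norm (S n x) \<le> exp \<bar>t\<bar>" for n
        using b
      proof eventually_elim
        case (elim x)
        have "norm (S n x) \<le> (\<Sum>k<n. \<bar>t\<bar> ^ k /\<^sub>R fact k)"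
          unfolding S_def
        proof (rule sum_norm_le)
          fix k
          have "(\<bar>t\<bar> * \<bar>x\<bar>) ^ k \<le> (\<bar>t\<bar> * 1) ^ k"
            using elim by (intro power_mono mult_left_mono) auto
          then show "norm ((\<i> * t * x) ^ k / fact k) \<le> \<bar>t\<bar> ^ k /\<^sub>R fact k"
            by (simp add: norm_divide norm_power norm_mult divide_simps)
        qed
        also have "\<dots> \<le> exp \<bar>t\<bar>"
          unfolding exp_def by (intro sum_le_suminf) (auto simp: summable_exp)
        finally show ?case .
      qed
    qed (auto simp: S_def)
    moreover have "(\<integral>x. S n x \<partial>\<rho>) = (\<Sum>k<n. complex_of_real (\<integral>x. x ^ k \<partial>\<rho>) * (\<i> * t) ^ k / fact k)" for n
    proof -
      have i: "integrable \<rho> (\<lambda>x. x ^ k)" for k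
        by (rule \<rho>.integrable_const_bound[where B=1])
          (use b in \<open>auto elim!: eventually_mono simp: power_abs power_le_one\<close>)
      have e: "(\<i> * t * x) ^ k / fact k = complex_of_real (x ^ k) * ((\<i> * t) ^ k / fact k)" for x k
        by (simp add: power_mult_distrib)
      have "(\<integral>x. S n x \<partial>\<rho>) = (\<Sum>k<n. \<integral>x. complex_of_real (x ^ k) * ((\<i> * t) ^ k / fact k) \<partial>\<rho>)"
        unfolding S_def e
        by (intro Bochner_Integration.integral_sum integrable_mult_left integrable_of_real i)
      also have "\<dots> = (\<Sum>k<n. (\<integral>x. complex_of_real (x ^ k) \<partial>\<rho>) * ((\<i> * t) ^ k / fact k))"
        by (intro sum.cong refl Bochner_Integration.integral_mult_left_zero)
      also have "\<dots> = (\<Sum>k<n. complex_of_real (\<integral>x. x ^ k \<partial>\<rho>) * ((\<i> * t) ^ k / fact k))"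
        by (simp only: integral_complex_of_real)
      finally show ?thesis by simp
    qed
    ultimately show ?thesis
      by (simp add: sums_def char_def)
  qed
  show "char \<mu> = char \<nu>"
  proof
    fix t
    show "char \<mu> t = char \<nu> t"
      using char[OF assms(1) b(1), of t] char[OF assms(2) b(2), of t] m
      by (auto intro: sums_unique2)
  qed
qed fact+

text \<open>
  The injective map \<open>x \<mapsto> exp (- x)\<close> turns the values of the Laplace transform at the natural
  numbers into the moments of a law on \<open>[0, 1]\<close>.
\<close>

lemma laplace_transform_determines:
  fixes \<mu> \<nu> :: "real measure"
  assumes "real_distribution \<mu>" "real_distribution \<nu>"
    and b: "AE x in \<mu>. 0 \<le> x" "AE x in \<nu>. 0 \<le> x"
    and m: "\<And>n::nat. (\<integral>x. exp (- (real n * x)) \<partial>\<mu>) = (\<integral>x. exp (- (real n * x)) \<partial>\<nu>)"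
  shows "\<mu> = \<nu>"
proof -
  interpret \<mu>: real_distribution \<mu> by fact
  interpret \<nu>: real_distribution \<nu> by fact
  let ?e = "\<lambda>x::real. exp (- x)"
  let ?l = "\<lambda>x::real. - ln x"
  have "distr \<mu> borel ?e = distr \<nu> borel ?e"
  proof (rule bounded_moments_determine)
    show "real_distribution (distr \<mu> borel ?e)" "real_distribution (distr \<nu> borel ?e)"
      by (auto intro!: \<mu>.real_distribution_distr \<nu>.real_distribution_distr)
    show "AE x in distr \<mu> borel ?e. \<bar>x\<bar> \<le> 1" "AE x in distr \<nu> borel ?e. \<bar>x\<bar> \<le> 1"
      using b by (auto simp: AE_distr_iff)
    show "(\<integral>x. x ^ n \<partial>distr \<mu> borel ?e) = (\<integral>x. x ^ n \<partial>distr \<nu> borel ?e)" for n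
      using m[of n] by (simp add: integral_distr exp_of_nat_mult[symmetric])
  qed
  then have "distr (distr \<mu> borel ?e) borel ?l = distr (distr \<nu> borel ?e) borel ?l"
    by simp
  then show ?thesis
    by (simp add: distr_distr comp_def distr_id2)
qed

text \<open>
  Through this Laplace transform the survival probability \<open>1 / (1 + l c)\<close> of the dual process
  is recognised as an exponential law of mean \<open>c\<close>.
\<close>

lemma nn_integral_shifted_exponential:
  fixes c l :: real
  assumes c: "0 < c" and l: "0 \<le> l"
  shows "(\<integral>\<^sup>+z. ennreal (1 / c * exp (- ((z - 1) / c)) * exp (- (l * (z - 1)))) * indicator {1..} z \<partial>lborel)
    = ennreal (1 / (1 + l * c))"
proof -
  define a where "a = 1 / c + l"
  have a: "0 < a" using c l by (auto simp: a_def intro: add_pos_nonneg)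
  have e: "1 / c * exp (- ((z - 1) / c)) * exp (- (l * (z - 1))) = 1 / c * exp (- (a * (z - 1)))" for z
    by (simp add: a_def exp_add[symmetric] field_simps)
  have "(\<integral>\<^sup>+z. ennreal (1 / c * exp (- (a * (z - 1)))) * indicator {1..} z \<partial>lborel)
      = ennreal (0 - (- (1 / (a * c)) * exp (- (a * (1 - 1)))))"
  proof (rule nn_integral_FTC_atLeast[where F="\<lambda>z. - (1 / (a * c)) * exp (- (a * (z - 1)))"])
    show "((\<lambda>z. - (1 / (a * c)) * exp (- (a * (z - 1)))) has_real_derivative 1 / c * exp (- (a * (z - 1)))) (at z)" for z
      using a c by (auto intro!: derivative_eq_intros simp: field_simps)
    have "((\<lambda>z. - (1 / (a * c)) * exp (- (a * (z - 1)))) \<longlongrightarrow> - (1 / (a * c)) * 0) at_top"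
    proof (intro tendsto_intros filterlim_compose[OF exp_at_bot])
      show "LIM z at_top. - (a * (z - 1)) :> at_bot"
        using a by real_asymp
    qed
    then show "((\<lambda>z. - (1 / (a * c)) * exp (- (a * (z - 1)))) \<longlongrightarrow> 0) at_top" by simp
  qed (use c in auto)
  also have "0 - (- (1 / (a * c)) * exp (- (a * (1 - 1)))) = 1 / (1 + l * c)"
  proof -
    have "a * c = 1 + l * c"
      using c by (simp add: a_def field_simps)
    then show ?thesis
      by simp
  qed
  finally show ?thesis
    unfolding e .
qed

section \<open>The generator on polynomials times exponentials\<close>

text \<open>
  These functions of \<open>y = cosh r - 1\<close> contain the exponentials and are stable under
  differentiation and under the generator of \<open>cosh R - 1\<close>, and for \<open>l > 0\<close> they are bounded on
  \<open>y \<ge> 0\<close>.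
\<close>

definition poly_exp :: "real \<Rightarrow> real poly \<Rightarrow> real \<Rightarrow> real" where
  "poly_exp l p y = poly p y * exp (- (l * y))"

text \<open>
  The effect of differentiation on the polynomial factor.
\<close>

definition pe_deriv :: "real \<Rightarrow> real poly \<Rightarrow> real poly" where
  "pe_deriv l p = pderiv p - smult l p"

text \<open>
  The generator \<open>1/2 (y^2 + 2 y) D^2 + (1 + y) D\<close> of \<open>cosh R - 1\<close>, acting on the polynomial
  factor; here \<open>D\<close> is the derivative.
\<close>

definition pe_gen :: "real \<Rightarrow> real poly \<Rightarrow> real poly" where
  "pe_gen l p = smult (1 / 2) ([:0, 2, 1:] * pe_deriv l (pe_deriv l p)) + [:1, 1:] * pe_deriv l p"

lemma poly_exp_1 [simp]: "poly_exp l 1 y = exp (- (l * y))"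
  by (simp add: poly_exp_def)

lemma poly_exp_zero [simp]: "poly_exp l p 0 = poly p 0"
  by (simp add: poly_exp_def)

lemma has_real_derivative_poly_exp:
  "(poly_exp l p has_real_derivative poly_exp l (pe_deriv l p) y) (at y)"
  unfolding poly_exp_def[abs_def] pe_deriv_def
  by (auto intro!: derivative_eq_intros simp: algebra_simps)

lemma has_real_derivative_poly_exp_cosh:
  "((\<lambda>r. poly_exp l p (cosh r - 1)) has_real_derivative
    poly_exp l (pe_deriv l p) (cosh r - 1) * sinh r) (at r)"
  by (rule DERIV_chain2[OF has_real_derivative_poly_exp]) (auto intro!: derivative_eq_intros)

text \<open>
  The identity \<open>(sinh r)\<^sup>2 = y\<^sup>2 + 2 y\<close> with \<open>y = cosh r - 1\<close> brings even derivatives in \<open>r\<close>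
  back to functions of \<open>y\<close>.
\<close>

lemma has_real_derivative_poly_exp_cosh_sinh:
  "((\<lambda>r. poly_exp l p (cosh r - 1) * sinh r) has_real_derivative
    poly_exp l ([:0, 2, 1:] * pe_deriv l p + [:1, 1:] * p) (cosh r - 1)) (at r)"
proof -
  have "(sinh r)\<^sup>2 = (cosh r - 1)\<^sup>2 + 2 * (cosh r - 1)"
    using cosh_square_eq[of r] by (simp add: power2_eq_square algebra_simps)
  then have "poly_exp l (pe_deriv l p) (cosh r - 1) * sinh r * sinh r
      + poly_exp l p (cosh r - 1) * cosh r
      = poly_exp l ([:0, 2, 1:] * pe_deriv l p + [:1, 1:] * p) (cosh r - 1)"
    by (simp add: poly_exp_def power2_eq_square mult.assoc) (simp add: algebra_simps)
  moreover have "((\<lambda>r. poly_exp l p (cosh r - 1) * sinh r) has_real_derivative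
      poly_exp l (pe_deriv l p) (cosh r - 1) * sinh r * sinh r
      + poly_exp l p (cosh r - 1) * cosh r) (at r)"
  proof -
    have "(sinh has_real_derivative cosh r) (at r)"
      by (auto intro!: derivative_eq_intros)
    then show ?thesis
      using DERIV_mult[OF has_real_derivative_poly_exp_cosh[of l p r], of sinh "cosh r"]
      by (simp add: mult.commute)
  qed
  ultimately show ?thesis
    by simp
qed

text \<open>
  Induction on the polynomial: each factor \<open>y\<close> is paid for with half of the exponential decay.
\<close>

lemma poly_exp_bounded:
  assumes "0 < l"
  shows "\<exists>C. \<forall>y\<ge>0. \<bar>poly_exp l p y\<bar> \<le> C"
  using assms
proof (induction p arbitrary: l)
  case 0
  then show ?case by (auto simp: poly_exp_def)
next
  case (pCons a p)
  obtain C where C: "\<And>y. 0 \<le> y \<Longrightarrow> \<bar>poly_exp (l / 2) p y\<bar> \<le> C"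
    using pCons.IH[of "l / 2"] pCons.prems by auto
  show ?case
  proof (intro exI allI impI)
    fix y :: real assume y: "0 \<le> y"
    have e: "y * exp (- (l / 2 * y)) \<le> 2 / l"
    proof -
      have "l / 2 * y \<le> exp (l / 2 * y)"
        using exp_ge_add_one_self[of "l / 2 * y"] by linarith
      then have "y * exp (- (l / 2 * y)) * (l / 2) \<le> 1"
        by (simp add: exp_minus field_simps)
      then show ?thesis
        using pCons.prems by (simp add: field_simps)
    qed
    have "poly_exp l (pCons a p) y
        = a * exp (- (l * y)) + (y * exp (- (l / 2 * y))) * poly_exp (l / 2) p y"
      using exp_add[of "- (l / 2 * y)" "- (l / 2 * y)"]
      by (simp add: poly_exp_def algebra_simps)
    also have "\<bar>\<dots>\<bar> \<le> \<bar>a\<bar> * exp (- (l * y)) + (y * exp (- (l / 2 * y))) * \<bar>poly_exp (l / 2) p y\<bar>"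
      using y by (intro order_trans[OF abs_triangle_ineq]) (simp add: abs_mult)
    also have "\<dots> \<le> \<bar>a\<bar> * 1 + 2 / l * C"
      using y e C[OF y] pCons.prems by (intro add_mono mult_left_mono mult_mono) auto
    finally show "\<bar>poly_exp l (pCons a p) y\<bar> \<le> \<bar>a\<bar> * 1 + 2 / l * C" .
  qed
qed

lemma cosh_minus_one_nonneg: "0 \<le> cosh (r::real) - 1"
  using cosh_real_ge_1[of r] by simp

lemma abs_sinh_le_cosh: "\<bar>sinh (r::real)\<bar> \<le> cosh r"
  by (rule power2_le_imp_le) (auto simp: cosh_square_eq)

lemma poly_exp_cosh_bounded:
  assumes "0 < l"
  shows "\<exists>C. \<forall>r. \<bar>poly_exp l p (cosh r - 1)\<bar> \<le> C"
  using poly_exp_bounded[OF assms, of p] cosh_minus_one_nonneg by blast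

lemma poly_exp_cosh_sinh_bounded:
  assumes "0 < l"
  shows "\<exists>C. \<forall>r. \<bar>poly_exp l p (cosh r - 1) * sinh r\<bar> \<le> C"
proof -
  obtain C where C: "\<And>r. \<bar>poly_exp l ([:1, 1:] * p) (cosh r - 1)\<bar> \<le> C"
    using poly_exp_cosh_bounded[OF assms] by blast
  have "\<bar>poly_exp l p (cosh r - 1) * sinh r\<bar> \<le> C" for r
  proof -
    have "\<bar>poly_exp l p (cosh r - 1) * sinh r\<bar> \<le> \<bar>poly_exp l p (cosh r - 1)\<bar> * cosh r"
      unfolding abs_mult by (intro mult_left_mono abs_sinh_le_cosh) auto
    also have "\<dots> = \<bar>poly_exp l ([:1, 1:] * p) (cosh r - 1)\<bar>"
    proof -
      have "poly ([:1, 1:] * p) (cosh r - 1) = cosh r * poly p (cosh r - 1)"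
        by (simp add: algebra_simps)
      then show ?thesis
        by (simp add: poly_exp_def abs_mult)
    qed
    finally show ?thesis
      using C[of r] by linarith
  qed
  then show ?thesis by blast
qed

lemma power_exp_minus_le_fact:
  fixes z :: real
  assumes z: "0 \<le> z"
  shows "z ^ k * exp (- z) \<le> fact k"
proof -
  have "(\<Sum>i\<in>{k}. z ^ i /\<^sub>R fact i) \<le> (\<Sum>i. z ^ i /\<^sub>R fact i)"
    using z by (intro sum_le_suminf summable_exp_generic) auto
  then have "z ^ k / fact k \<le> exp z"
    by (simp add: exp_def field_simps)
  then show ?thesis
    by (simp add: exp_minus field_simps)
qed

text \<open>
  The right-hand side is also the operator \<open>1/2 l^2 D^2 + (l - l^2) D - l\<close> in the variable \<open>l\<close>,
  applied to \<open>exp (- (l * y))\<close>.  This exchange of variables is the duality with the logistic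
  diffusion.
\<close>

lemma poly_exp_gen_1:
  "poly_exp l (pe_gen l 1) y = (1 / 2 * (l * y)\<^sup>2 + l * (l * y) - l - l * y) * exp (- (l * y))"
  by (simp add: poly_exp_def pe_gen_def pe_deriv_def one_pCons pderiv_pCons
      power2_eq_square field_simps)

lemma poly_exp_gen_gen_1:
  "poly_exp l (pe_gen l (pe_gen l 1)) y
    = ((l * y) ^ 4 / 4 + (l - 2) * (l * y) ^ 3 + (7 / 2 - 6 * l + l\<^sup>2) * (l * y) ^ 2
      + (7 * l - 4 * l\<^sup>2 - 1) * (l * y) + (2 * l\<^sup>2 - l)) * exp (- (l * y))"
  by (simp add: poly_exp_def pe_gen_def pe_deriv_def one_pCons pderiv_pCons
      power2_eq_square power3_eq_cube power4_eq_xxxx field_simps)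

text \<open>
  Every monomial of the iterated generator has at least as many factors \<open>l\<close> as factors \<open>y\<close>.  So
  it is a polynomial in \<open>z = l * y\<close> and \<open>l\<close>, and \<open>z ^ k * exp (- z) \<le> fact k\<close> removes \<open>y\<close>.
  The bound controls the second time derivative of the Laplace transform, uniformly in time and
  with explicit growth in \<open>l\<close>.
\<close>

lemma poly_exp_gen_gen_1_bound:
  assumes l: "0 \<le> l" and y: "0 \<le> y"
  shows "\<bar>poly_exp l (pe_gen l (pe_gen l 1)) y\<bar> \<le> 272 * (1 + l)\<^sup>2"
proof -
  define z where "z = l * y"
  define L where "L = (1 + l)\<^sup>2"
  define m where "m k = z ^ k * exp (- z)" for k
  have z: "0 \<le> z" using l y by (simp add: z_def)
  have m: "\<bar>m k\<bar> \<le> fact k" for k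
    using power_exp_minus_le_fact[OF z, of k] z by (simp add: m_def)
  obtain q where q: "l\<^sup>2 = q" "0 \<le> q"
    by simp
  have L: "L = 1 + 2 * l + q"
    by (simp add: L_def q(1)[symmetric] power2_eq_square algebra_simps)
  have L0: "0 \<le> L" by (simp add: L_def)
  have c: "\<bar>1 / 4\<bar> \<le> 8 * L" "\<bar>l - 2\<bar> \<le> 8 * L" "\<bar>7 / 2 - 6 * l + l\<^sup>2\<bar> \<le> 8 * L"
    "\<bar>7 * l - 4 * l\<^sup>2 - 1\<bar> \<le> 8 * L" "\<bar>2 * l\<^sup>2 - l\<bar> \<le> 8 * L"
    using l q(2) by (auto simp: abs_le_iff L q(1))
  have eq: "poly_exp l (pe_gen l (pe_gen l 1)) y
      = 1 / 4 * m 4 + (l - 2) * m 3 + (7 / 2 - 6 * l + l\<^sup>2) * m 2 + (7 * l - 4 * l\<^sup>2 - 1) * m 1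
        + (2 * l\<^sup>2 - l) * m 0"
    unfolding poly_exp_gen_gen_1 m_def z_def by (simp add: algebra_simps)
  have b: "\<bar>c * m k\<bar> \<le> 8 * L * fact k" if "\<bar>c\<bar> \<le> 8 * L" for c k
    unfolding abs_mult by (intro mult_mono that m) (use L0 in auto)
  have "\<bar>poly_exp l (pe_gen l (pe_gen l 1)) y\<bar>
      \<le> 8 * L * fact 4 + 8 * L * fact 3 + 8 * L * fact 2 + 8 * L * fact 1 + 8 * L * fact 0"
    unfolding eq by (intro order_trans[OF abs_triangle_ineq] add_mono b c)
  also have "\<dots> = 272 * L"
    by (simp add: fact_numeral)
  finally show ?thesis
    by (simp add: L_def)
qed

section \<open>One step of the logistic chain\<close>

text \<open>
  A splitting scheme for \<open>dl = l db + (l - l^2) du\<close>: the denominator solves \<open>dl = - l^2 du\<close>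
  exactly over a time \<open>h\<close>, the exponential solves \<open>dl = l db + l du\<close> for the Brownian increment
  \<open>x\<close>.
\<close>

definition logistic_step :: "real \<Rightarrow> real \<Rightarrow> real \<Rightarrow> real" where
  "logistic_step h l x = l * exp (x + h / 2) / (1 + l * h)"

text \<open>
  One killed step of the chain acts on the exponential like \<open>1 + h L\<close> with the generator \<open>L\<close> of
  \<open>cosh R - 1\<close>.  In logarithmic coordinates the exponential becomes
  \<open>F(x) = exp (- z * exp x)\<close> with \<open>z = l * y\<close>.  The derivatives of \<open>F\<close> are bounded uniformly in
  \<open>z \<ge> 0\<close>, which makes the Gaussian expansion uniform in \<open>y\<close>.
\<close>

lemma logistic_step_expansion:
  assumes h: "0 < h" "h \<le> 1" and l: "0 \<le> l" and y: "0 \<le> y"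
  shows "\<bar>1 / (1 + l * h) * (\<integral>x. normal_density 0 (sqrt h) x * exp (- (logistic_step h l x * y)) \<partial>lborel)
    - exp (- (l * y)) - h * poly_exp l (pe_gen l 1) y\<bar> \<le> 30 * (1 + l)\<^sup>2 * (h * sqrt h)"
proof -
  define z where "z = l * y"
  have z: "0 \<le> z" using l y by (simp add: z_def)
  define F where "F x = exp (- (z * exp x))" for x
  define F1 where "F1 x = - (z * exp x) * exp (- (z * exp x))" for x
  define F2 where "F2 x = ((z * exp x)\<^sup>2 - z * exp x) * exp (- (z * exp x))" for x
  define F3 where "F3 x = (- ((z * exp x) ^ 3) + 3 * (z * exp x)\<^sup>2 - z * exp x) * exp (- (z * exp x))" for x
  have D: "(F has_real_derivative F1 x) (at x)" "(F1 has_real_derivative F2 x) (at x)"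
    "(F2 has_real_derivative F3 x) (at x)" for x
    unfolding F_def[abs_def] F1_def[abs_def] F2_def[abs_def] F3_def
    by (auto intro!: derivative_eq_intros simp: power2_eq_square power3_eq_cube algebra_simps)
  have v: "0 \<le> z * exp x" for x using z by simp
  have F: "\<bar>F x\<bar> \<le> 1" for x
    using v[of x] by (simp add: F_def)
  define A where "A k x = (z * exp x) ^ k * exp (- (z * exp x))" for k x
  have A: "0 \<le> A k x" "A k x \<le> fact k" for k x
    unfolding A_def using power_exp_minus_le_fact[OF v] by (auto intro!: mult_nonneg_nonneg zero_le_power v)
  have F_A: "F1 x = - A 1 x" "F2 x = A 2 x - A 1 x" "F3 x = - A 3 x + 3 * A 2 x - A 1 x" for x
    by (simp_all add: F1_def F2_def F3_def A_def algebra_simps)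
  have F1: "\<bar>F1 x\<bar> \<le> 1" for x
    using A[of 1 x] by (simp add: F_A)
  have F2: "\<bar>F2 x\<bar> \<le> 3" for x
    using A[of 1 x] A[of 2 x] unfolding F_A by (simp add: abs_le_iff)
  have F3: "\<bar>F3 x\<bar> \<le> 13" for x
  proof -
    have "fact 2 = (2::real)" "fact 3 = (6::real)" "fact 1 = (1::real)"
      by (simp_all add: fact_numeral)
    then show ?thesis
      using A[of 1 x] A[of 2 x] A[of 3 x] unfolding F_A by linarith
  qed
  \<comment> \<open>The deterministic part of the step in logarithmic coordinates.\<close>
  define m where "m = h / 2 - ln (1 + l * h)"
  define a where "a = 1 / (1 + l * h)"
  define G where "G = (\<integral>x. normal_density 0 (sqrt h) x * F (m + x) \<partial>lborel)"
  have lh: "0 \<le> l * h" using l h by simp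
  have G_eq: "(\<integral>x. normal_density 0 (sqrt h) x * exp (- (logistic_step h l x * y)) \<partial>lborel) = G"
  proof -
    have "logistic_step h l x * y = z * exp (m + x)" for x
    proof -
      have "exp (m + x) = exp (x + h / 2 - ln (1 + l * h))"
        by (simp add: m_def algebra_simps)
      also have "\<dots> = exp (x + h / 2) / (1 + l * h)"
        using lh by (simp add: exp_diff)
      finally show ?thesis
        by (simp add: logistic_step_def z_def)
    qed
    then show ?thesis
      by (simp add: G_def F_def)
  qed
  have e1: "\<bar>G - F m - h / 2 * F2 m\<bar> \<le> 13 * (h * sqrt h)"
    unfolding G_def by (rule gaussian_second_order_expansion[OF D F3 F h(1)])
  have ln: "ln (1 + l * h) \<le> l * h" "l * h - ln (1 + l * h) \<le> (l * h)\<^sup>2"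
  proof -
    show "ln (1 + l * h) \<le> l * h"
      using lh by (rule ln_add_one_self_le_self)
    show "l * h - ln (1 + l * h) \<le> (l * h)\<^sup>2"
    proof (cases "l * h \<le> 1")
      case True
      then show ?thesis
        using abs_ln_one_plus_x_minus_x_bound_nonneg[OF lh] by (simp add: abs_le_iff)
    next
      case False
      then have "l * h * 1 \<le> l * h * (l * h)"
        using lh by (intro mult_left_mono) auto
      moreover have "0 \<le> ln (1 + l * h)"
        using lh by simp
      ultimately show ?thesis
        by (simp add: power2_eq_square)
    qed
  qed
  have ln0: "0 \<le> ln (1 + l * h)" using lh by simp
  have m: "\<bar>m\<bar> \<le> h * (1 + l)"
    using ln(1) ln0 h lh by (simp add: m_def abs_le_iff algebra_simps)
  have F1_diff: "\<bar>F1 x - F1 0\<bar> \<le> 3 * \<bar>m\<bar>" if "\<bar>x\<bar> \<le> \<bar>m\<bar>" for x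
  proof -
    have "norm (F1 x - F1 0) \<le> 3 * norm (x - 0)"
      by (rule field_differentiable_bound[where S=UNIV and f'=F2])
        (auto intro: has_field_derivative_at_within D F2)
    then show ?thesis using that by simp
  qed
  have e2: "\<bar>F m - F 0 - m * F1 0\<bar> \<le> 3 * m\<^sup>2"
  proof -
    have "norm ((F m - m * F1 0) - (F 0 - 0 * F1 0)) \<le> (3 * \<bar>m\<bar>) * norm (m - 0)"
    proof (rule field_differentiable_bound[where S="cball 0 \<bar>m\<bar>" and f'="\<lambda>x. F1 x - F1 0"])
      show "((\<lambda>x. F x - x * F1 0) has_field_derivative F1 x - F1 0) (at x within cball 0 \<bar>m\<bar>)" for x
        by (auto intro!: derivative_eq_intros has_field_derivative_at_within[OF D(1)])
      show "norm (F1 x - F1 0) \<le> 3 * \<bar>m\<bar>" if "x \<in> cball 0 \<bar>m\<bar>" for x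
        using F1_diff[of x] that by simp
    qed auto
    also have "(3 * \<bar>m\<bar>) * norm (m - 0) = 3 * m\<^sup>2"
      by (simp add: power2_eq_square)
    finally show ?thesis
      by (simp add: algebra_simps)
  qed
  have e3: "\<bar>F2 m - F2 0\<bar> \<le> 13 * \<bar>m\<bar>"
  proof -
    have "norm (F2 m - F2 0) \<le> 13 * norm (m - 0)"
      by (rule field_differentiable_bound[where S=UNIV and f'=F3])
        (auto intro: has_field_derivative_at_within D F3)
    then show ?thesis by simp
  qed
  have e5: "\<bar>a - (1 - l * h)\<bar> \<le> (l * h)\<^sup>2" "\<bar>a\<bar> \<le> 1" "\<bar>a - 1\<bar> \<le> l * h"
  proof -
    have "a - (1 - l * h) = (l * h)\<^sup>2 * a"
      using lh by (simp add: a_def power2_eq_square field_simps)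
    moreover have "0 \<le> a" "a \<le> 1"
      using lh by (auto simp: a_def)
    moreover have "a - 1 = - (l * h * a)"
      using lh by (simp add: a_def field_simps)
    ultimately show "\<bar>a - (1 - l * h)\<bar> \<le> (l * h)\<^sup>2" "\<bar>a\<bar> \<le> 1" "\<bar>a - 1\<bar> \<le> l * h"
      using lh mult_left_mono[of a 1 "l * h"] mult_left_mono[of a 1 "(l * h)\<^sup>2"]
      by (auto simp: abs_le_iff)
  qed
  define T where "T = h * ((1 / 2 - l) * F1 0 + 1 / 2 * F2 0)"
  \<comment> \<open>The unit in which all error terms are measured.\<close>
  define H where "H = (1 + l)\<^sup>2 * (h * sqrt h)"
  have h2: "h * h \<le> h * sqrt h"
    using h by (intro mult_left_mono) (auto intro!: real_le_rsqrt simp: power2_eq_square mult_le_one)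
  have l1: "1 \<le> (1 + l)\<^sup>2" "l\<^sup>2 \<le> (1 + l)\<^sup>2" "1 + l \<le> (1 + l)\<^sup>2" "l * (1 + l) \<le> (1 + l)\<^sup>2"
    using l by (auto simp: power2_eq_square algebra_simps)
  have H: "c * (h * h) \<le> H" "c * (h * sqrt h) \<le> H" if "0 \<le> c" "c \<le> (1 + l)\<^sup>2" for c
  proof -
    show "c * (h * sqrt h) \<le> H"
      unfolding H_def using that h by (intro mult_right_mono) auto
    then show "c * (h * h) \<le> H"
      using mult_left_mono[OF h2 that(1)] by linarith
  qed
  have b1: "13 * (h * sqrt h) \<le> 13 * H"
    using H(2)[of 1] l1 by simp
  have m2: "m\<^sup>2 \<le> H"
  proof -
    have "m\<^sup>2 \<le> (h * (1 + l))\<^sup>2"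
      using power_mono[OF m, of 2] by simp
    also have "\<dots> = (1 + l)\<^sup>2 * (h * h)"
      by (simp add: power2_eq_square)
    finally show ?thesis using H(1)[of "(1 + l)\<^sup>2"] by simp
  qed
  have hm: "h * \<bar>m\<bar> \<le> H"
  proof -
    have "h * \<bar>m\<bar> \<le> h * (h * (1 + l))"
      using m h by (intro mult_left_mono) auto
    also have "\<dots> = (1 + l) * (h * h)" by simp
    finally show ?thesis using H(1)[of "1 + l"] l1 l by simp
  qed
  have lh2: "(l * h)\<^sup>2 \<le> H"
    using H(1)[of "l\<^sup>2"] l1 by (simp add: power2_eq_square ac_simps)
  have e4: "\<bar>m * F1 0 - h * (1 / 2 - l) * F1 0\<bar> \<le> H"
  proof -
    have "\<bar>m * F1 0 - h * (1 / 2 - l) * F1 0\<bar> = \<bar>m - h * (1 / 2 - l)\<bar> * \<bar>F1 0\<bar>"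
      by (simp add: abs_mult[symmetric] algebra_simps)
    also have "\<dots> \<le> (l * h)\<^sup>2 * 1"
      using ln F1[of 0] by (intro mult_mono) (auto simp: m_def abs_le_iff algebra_simps)
    finally show ?thesis using lh2 by linarith
  qed
  have hF2: "\<bar>h / 2 * F2 m - h / 2 * F2 0\<bar> \<le> 13 / 2 * H"
  proof -
    have "\<bar>h / 2 * F2 m - h / 2 * F2 0\<bar> = h / 2 * \<bar>F2 m - F2 0\<bar>"
    proof -
      have "h / 2 * F2 m - h / 2 * F2 0 = h / 2 * (F2 m - F2 0)"
        by (rule right_diff_distrib[symmetric])
      then show ?thesis
        using h by (simp only: abs_mult abs_of_pos[OF half_gt_zero])
    qed
    also have "\<dots> \<le> h / 2 * (13 * \<bar>m\<bar>)"
      using e3 h by (intro mult_left_mono) auto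
    also have "\<dots> = 13 / 2 * (h * \<bar>m\<bar>)" by simp
    finally show ?thesis using hm by linarith
  qed
  have G: "\<bar>G - F 0 - T\<bar> \<le> (13 + 3 + 1 + 13 / 2) * H"
  proof -
    have eq: "G - F 0 - T = (G - F m - h / 2 * F2 m) + (F m - F 0 - m * F1 0)
        + (m * F1 0 - h * (1 / 2 - l) * F1 0) + (h / 2 * F2 m - h / 2 * F2 0)"
      by (simp add: T_def algebra_simps)
    have "\<bar>G - F 0 - T\<bar> \<le> 13 * H + 3 * H + H + 13 / 2 * H"
      unfolding eq
    proof (intro order_trans[OF abs_triangle_ineq] add_mono e4 hF2)
      show "\<bar>G - F m - h / 2 * F2 m\<bar> \<le> 13 * H"
        using e1 b1 by (rule order_trans)
      show "\<bar>F m - F 0 - m * F1 0\<bar> \<le> 3 * H"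
        using e2 m2 by (rule order_trans[OF _ mult_left_mono]) simp
    qed
    then show ?thesis
      by (simp add: algebra_simps)
  qed
  have aG: "\<bar>a * (G - F 0 - T)\<bar> \<le> (13 + 3 + 1 + 13 / 2) * H"
    using mult_mono[OF e5(2) G] by (simp add: abs_mult)
  have T: "\<bar>T\<bar> \<le> h * (2 * (1 + l))"
  proof -
    have "\<bar>(1 / 2 - l) * F1 0 + 1 / 2 * F2 0\<bar> \<le> \<bar>1 / 2 - l\<bar> * \<bar>F1 0\<bar> + 1 / 2 * \<bar>F2 0\<bar>"
      by (metis abs_triangle_ineq abs_mult abs_of_pos half_gt_zero zero_less_one)
    also have "\<dots> \<le> (1 / 2 + l) * 1 + 1 / 2 * 3"
      using F1[of 0] F2[of 0] l by (intro add_mono mult_mono) auto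
    also have "\<dots> \<le> 2 * (1 + l)"
      using l by simp
    finally show ?thesis
      using h unfolding T_def abs_mult by (intro mult_mono) auto
  qed
  have aT: "\<bar>(a - 1) * T\<bar> \<le> 2 * H"
  proof -
    have "\<bar>(a - 1) * T\<bar> \<le> l * h * (h * (2 * (1 + l)))"
      unfolding abs_mult using e5(3) T lh by (intro mult_mono) auto
    also have "\<dots> = 2 * ((l * (1 + l)) * (h * h))" by simp
    finally show ?thesis using H(1)[of "l * (1 + l)"] l1 l by simp
  qed
  have aF: "\<bar>(a - (1 - l * h)) * F 0\<bar> \<le> H"
    using mult_mono[OF e5(1) F[of 0]] lh2 by (simp add: abs_mult)
  have gen: "h * poly_exp l (pe_gen l 1) y = T - l * h * F 0"
    unfolding poly_exp_gen_1 T_def z_def[symmetric] F_def F1_def F2_def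
    by (simp add: power2_eq_square algebra_simps)
  have eq: "a * G - exp (- (l * y)) - h * poly_exp l (pe_gen l 1) y
      = a * (G - F 0 - T) + (a - 1) * T + (a - (1 - l * h)) * F 0"
    unfolding gen by (simp add: F_def z_def algebra_simps)
  have "\<bar>a * G - exp (- (l * y)) - h * poly_exp l (pe_gen l 1) y\<bar> \<le> (13 + 3 + 1 + 13 / 2) * H + 2 * H + H"
    unfolding eq by (intro order_trans[OF abs_triangle_ineq] add_mono aG aT aF)
  also have "\<dots> \<le> 30 * H"
    using H(1)[of 0] by simp
  finally have "\<bar>a * G - exp (- (l * y)) - h * poly_exp l (pe_gen l 1) y\<bar> \<le> 30 * H" .
  then show ?thesis
    unfolding G_eq a_def[symmetric] H_def by (simp add: mult.assoc)
qed

section \<open>The pathwise part of Ito's formula\<close>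

lemma set_integral_Icc_diff:
  fixes d :: "real \<Rightarrow> real"
  assumes ab: "0 \<le> a" "a \<le> b" and d: "set_integrable lborel {0..b} d"
  shows "(LINT u:{0..b}|lborel. d u) - (LINT u:{0..a}|lborel. d u) = (LINT u:{a<..b}|lborel. d u)"
proof -
  have split: "{0..b} = {0..a} \<union> {a<..b}"
    using ab by auto
  have "set_integrable lborel {0..a} d" "set_integrable lborel {a<..b} d"
    using d unfolding split by (auto intro: set_integrable_subset)
  then show ?thesis
    unfolding split by (subst set_integral_Un) auto
qed

text \<open>
  The nondecreasing function \<open>D\<close> is below \<open>K\<close> exactly before the first time \<open>\<sigma>\<close> at which it
  reaches \<open>K\<close>; truncation switches the density off from then on.
\<close>

lemma truncated_integral:
  fixes d D :: "real \<Rightarrow> real"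
  assumes D: "\<And>v. 0 \<le> v \<Longrightarrow> D v = (LINT u:{0..v}|lborel. d u)"
    and d: "\<And>v. 0 \<le> v \<Longrightarrow> set_integrable lborel {0..v} d"
    and nonneg: "\<And>u. 0 \<le> u \<Longrightarrow> 0 \<le> d u"
    and cont: "continuous_on {0..} D"
    and ab: "0 \<le> a" "a \<le> b"
  shows "min (D b) K - min (D a) K = (LINT u:{a<..b}|lborel. d u * indicator {u. D u < K} u)"
proof -
  have mono: "D u \<le> D v" if "0 \<le> u" "u \<le> v" for u v
  proof -
    have "D v - D u = (LINT w:{u<..v}|lborel. d w)"
      using that D d set_integral_Icc_diff[of u v d] by simp
    also have "0 \<le> \<dots>"
      unfolding set_lebesgue_integral_def
      using nonneg that by (intro integral_nonneg_AE AE_I2) (auto simp: indicator_def)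
    finally show ?thesis by simp
  qed
  have diff: "D v - D u = (LINT w:{u<..v}|lborel. d w)" if "0 \<le> u" "u \<le> v" for u v
    using that D d set_integral_Icc_diff[of u v d] by simp
  consider "D b < K" | "K \<le> D a" | "D a < K" "K \<le> D b"
    by linarith
  then show ?thesis
  proof cases
    case 1
    have "D u < K" if "u \<in> {a<..b}" for u
      using mono[of u b] that ab 1 by auto
    then have "(LINT u:{a<..b}|lborel. d u * indicator {u. D u < K} u) = (LINT u:{a<..b}|lborel. d u)"
      by (intro set_lebesgue_integral_cong) auto
    moreover have "D a < K"
      using mono[of a b] ab 1 by auto
    ultimately show ?thesis
      using 1 diff ab by simp
  next
    case 2
    have "\<not> D u < K" if "u \<in> {a<..b}" for u
      using mono[of a u] that ab 2 by auto
    then have "(LINT u:{a<..b}|lborel. d u * indicator {u. D u < K} u) = (LINT u:{a<..b}|lborel. 0)"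
      by (intro set_lebesgue_integral_cong) auto
    then show ?thesis
      using 2 mono[of a b] ab by (simp add: set_lebesgue_integral_def)
  next
    case 3
    define S where "S = {u \<in> {a..b}. K \<le> D u}"
    define \<sigma> where "\<sigma> = Inf S"
    have cont': "continuous_on {a..b} D"
      using cont ab by (auto intro: continuous_on_subset)
    have "closed S"
      unfolding S_def
      using continuous_closed_preimage[OF cont' closed_atLeastAtMost closed_atLeast[of K]]
      by (simp add: vimage_def Int_def)
    moreover have "b \<in> S" "bdd_below S"
      using 3 ab by (auto simp: S_def intro: bdd_belowI[of _ a])
    ultimately have \<sigma>S: "\<sigma> \<in> S"
      unfolding \<sigma>_def by (intro closed_contains_Inf) auto
    have less: "u < \<sigma>" if "a \<le> u" "D u < K" "u \<le> b" for u
    proof (rule ccontr)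
      assume "\<not> u < \<sigma>"
      then have "D \<sigma> \<le> D u"
        using \<sigma>S ab by (intro mono) (auto simp: S_def)
      with \<sigma>S that show False by (auto simp: S_def)
    qed
    have below: "D u < K" if "a \<le> u" "u < \<sigma>" for u
    proof (rule ccontr)
      assume "\<not> D u < K"
      then have "u \<in> S" using that \<sigma>S by (auto simp: S_def)
      then have "\<sigma> \<le> u" unfolding \<sigma>_def using \<open>bdd_below S\<close> by (rule cInf_lower)
      with that show False by simp
    qed
    obtain \<tau> where \<tau>: "a \<le> \<tau>" "\<tau> \<le> b" "D \<tau> = K"
      using IVT'[of D a K b] 3 ab cont' by auto
    then have "\<tau> \<in> S" by (auto simp: S_def)
    then have "\<sigma> \<le> \<tau>" unfolding \<sigma>_def using \<open>bdd_below S\<close> by (rule cInf_lower)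
    then have "D \<sigma> \<le> K"
      using mono[of \<sigma> \<tau>] \<sigma>S ab \<tau> by (auto simp: S_def)
    with \<sigma>S have D\<sigma>: "D \<sigma> = K" "a \<le> \<sigma>" "\<sigma> \<le> b" by (auto simp: S_def)
    have "(LINT u:{a<..b}|lborel. d u * indicator {u. D u < K} u) = (LINT u:{a<..<\<sigma>}|lborel. d u)"
    proof -
      have iff: "a < u \<and> u \<le> b \<and> D u < K \<longleftrightarrow> a < u \<and> u < \<sigma>" for u
        using less[of u] below[of u] D\<sigma> by fastforce
      then have "indicator {a<..b} u *\<^sub>R (d u * indicator {u. D u < K} u) = indicator {a<..<\<sigma>} u *\<^sub>R d u" for u
        using iff[of u] by (cases "a < u \<and> u < \<sigma>") (auto simp: indicator_def)
      then show ?thesis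
        unfolding set_lebesgue_integral_def by presburger
    qed
    also have "\<dots> = (LINT u:{a<..\<sigma>}|lborel. d u)"
    proof -
      have "AE u in lborel. u \<noteq> \<sigma>"
        by (rule AE_lborel_singleton)
      moreover have "set_integrable lborel {a<..<\<sigma>} d" "set_integrable lborel {a<..\<sigma>} d"
        using ab D\<sigma> by (auto intro!: set_integrable_subset[OF d[of \<sigma>]])
      then have "(\<lambda>u. indicator {a<..<\<sigma>} u *\<^sub>R d u) \<in> borel_measurable lborel"
        "(\<lambda>u. indicator {a<..\<sigma>} u *\<^sub>R d u) \<in> borel_measurable lborel"
        unfolding set_integrable_def by (auto dest: borel_measurable_integrable)
      ultimately show ?thesis
        unfolding set_lebesgue_integral_def
        by (intro integral_cong_AE) (auto elim!: eventually_mono simp: indicator_def)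
    qed
    also have "\<dots> = K - D a"
      using diff[of a \<sigma>] D\<sigma> ab by simp
    finally show ?thesis
      using 3 by simp
  qed
qed

lemma indicator_mult_set_integrable:
  fixes d :: "real \<Rightarrow> real"
  assumes d: "set_integrable lborel {0..t} d" and m: "S \<inter> {0..t} \<in> sets borel"
  shows "set_integrable lborel {0..t} (\<lambda>u. d u * indicator S u)"
proof -
  have "integrable lborel (\<lambda>u. indicator (S \<inter> {0..t}) u *\<^sub>R d u)"
    unfolding set_integrable_def[symmetric]
    by (rule set_integrable_subset[OF d]) (use m in auto)
  also have "(\<lambda>u. indicator (S \<inter> {0..t}) u *\<^sub>R d u) = (\<lambda>u. indicator {0..t} u *\<^sub>R (d u * indicator S u))"
    by (auto simp: indicator_def)
  finally show ?thesis
    unfolding set_integrable_def .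
qed

lemma coth_nonneg: "0 \<le> r \<Longrightarrow> 0 \<le> coth r"
  by (simp add: coth_def)

lemma grid_modulus_tendsto_0:
  fixes \<phi> :: "real \<Rightarrow> real"
  assumes t: "0 < t" and \<phi>: "continuous_on {0..t} \<phi>" and e: "0 < e"
  shows "\<forall>\<^sub>F n in sequentially. \<forall>i<n. \<bar>\<phi> (grid t n (Suc i)) - \<phi> (grid t n i)\<bar> < e"
proof -
  obtain \<delta> where \<delta>: "0 < \<delta>"
    "\<And>u v. u \<in> {0..t} \<Longrightarrow> v \<in> {0..t} \<Longrightarrow> dist v u < \<delta> \<Longrightarrow> dist (\<phi> v) (\<phi> u) < e"
    using compact_uniformly_continuous[OF \<phi>] e by (auto simp: uniformly_continuous_on_def)
  have "\<forall>\<^sub>F n in sequentially. t / \<delta> < real n"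
    using filterlim_real_sequentially by (auto simp: filterlim_at_top_dense)
  then show ?thesis
  proof eventually_elim
    case (elim n)
    define h where "h = t / real n"
    have n: "0 < real n"
      using elim t \<delta>(1) by (smt (verit) divide_pos_pos)
    have h: "0 \<le> h" "h < \<delta>" "real n * h = t"
      using elim n t \<delta>(1) by (auto simp: h_def field_simps)
    have si: "real i * h \<in> {0..t}" if "i \<le> n" for i
    proof -
      have "real i * h \<le> real n * h"
        using that h by (intro mult_right_mono) auto
      then show ?thesis using h by auto
    qed
    show ?case
      unfolding grid_def h_def[symmetric]
    proof (intro allI impI)
      fix i assume "i < n"
      then show "\<bar>\<phi> (real (Suc i) * h) - \<phi> (real i * h)\<bar> < e"
        using \<delta>(2)[OF si[of i] si[of "Suc i"]] h by (simp add: dist_real_def algebra_simps)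
    qed
  qed
qed

lemma set_integral_abs_bound:
  fixes g :: "real \<Rightarrow> real"
  assumes A: "A \<in> sets borel" "emeasure lborel A < \<infinity>" and g: "set_integrable lborel A g"
    and C: "\<And>u. u \<in> A \<Longrightarrow> \<bar>g u\<bar> \<le> C"
  shows "\<bar>LINT u:A|lborel. g u\<bar> \<le> C * measure lborel A"
proof -
  have "\<bar>LINT u:A|lborel. g u\<bar> \<le> (LINT u:A|lborel. \<bar>g u\<bar>)"
    using set_integral_norm_bound[OF g] by simp
  also have "\<dots> \<le> (LINT u:A|lborel. C)"
  proof (rule set_integral_mono)
    show "set_integrable lborel A (\<lambda>u. C)"
      using integrable_real_indicator[of A lborel] A by (simp add: set_integrable_def)
  qed (use C in \<open>auto intro!: set_integrable_abs g\<close>)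
  also have "\<dots> = C * measure lborel A"
    using A by (simp add: set_lebesgue_integral_def)
  finally show ?thesis .
qed

lemma set_integral_Icc_bound:
  fixes g :: "real \<Rightarrow> real"
  assumes t: "0 \<le> t" and g: "set_integrable lborel {0..t} g"
    and C: "\<And>u. 0 \<le> u \<Longrightarrow> u \<le> t \<Longrightarrow> \<bar>g u\<bar> \<le> C"
  shows "\<bar>LINT u:{0..t}|lborel. g u\<bar> \<le> C * t"
  using set_integral_abs_bound[OF _ _ g, of C] t C by (simp add: emeasure_lborel_Icc_eq)

lemma set_integral_Ioc_bound:
  fixes g :: "real \<Rightarrow> real"
  assumes ab: "a \<le> b" and g: "set_integrable lborel {a<..b} g"
    and C: "\<And>u. a < u \<Longrightarrow> u \<le> b \<Longrightarrow> \<bar>g u\<bar> \<le> C"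
  shows "\<bar>LINT u:{a<..b}|lborel. g u\<bar> \<le> C * (b - a)"
  using set_integral_abs_bound[OF _ _ g, of C] ab C by simp

text \<open>
  The drift \<open>D = R - B\<close> is nondecreasing but comes with no moment bound, so it is truncated at
  \<open>K\<close>; the truncated path \<open>Rk\<close> agrees with \<open>R\<close> as long as \<open>D < K\<close>.  In \<open>X\<close> the purely Brownian
  part of each increment of \<open>f (Rk)\<close> has been subtracted, up to its mean.  What is left are the
  drift increments: their total mass is at most \<open>K\<close>, and they form Riemann-Stieltjes sums of
  \<open>f1\<close> against the density \<open>coth (R u) / 2\<close>.  The product of the two is \<open>q (R u) / 2\<close>, which is
  bounded also where \<open>R\<close> comes close to \<open>0\<close>.  Hence the limit is bounded independently of \<open>K\<close>, and
  it vanishes when the truncation is not active up to time \<open>t\<close>.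
\<close>

lemma pathwise_ito_limit:
  fixes f f1 f2 q R B :: "real \<Rightarrow> real"
  assumes f: "\<And>x. (f has_real_derivative f1 x) (at x)" "\<And>x. (f1 has_real_derivative f2 x) (at x)"
    and cont: "continuous_on UNIV f2" "continuous_on UNIV q"
    and C: "\<And>x. \<bar>f1 x\<bar> \<le> C" "\<And>x. \<bar>f2 x\<bar> \<le> C" "\<And>x. \<bar>q x\<bar> \<le> C"
    and q: "\<And>x. 0 < x \<Longrightarrow> f1 x * coth x = q x"
    and B: "continuous_on {0..} B" "B 0 = 0"
    and R: "continuous_on {0..} R" "\<And>u. 0 \<le> u \<Longrightarrow> 0 \<le> R u"
      "AE u in lborel. 0 \<le> u \<longrightarrow> 0 < R u"
    and eq: "\<And>u. 0 \<le> u \<Longrightarrow> set_integrable lborel {0..u} (\<lambda>u. coth (R u))"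
      "\<And>u. 0 \<le> u \<Longrightarrow> R u = B u + 1 / 2 * (LINT v:{0..u}|lborel. coth (R v))"
    and t: "0 < t" and K: "0 < K"
  defines "Rk \<equiv> \<lambda>u. B u + min (R u - B u) K"
  defines "X \<equiv> \<lambda>n. f (Rk t) - f 0
      - (\<Sum>i<n. f (Rk (grid t n i) + (B (grid t n (Suc i)) - B (grid t n i)))
          - f (Rk (grid t n i)) - t / real n / 2 * f2 (Rk (grid t n i)))
      - (\<Sum>i<n. t / real n * (1 / 2 * f2 (R (grid t n i)) + 1 / 2 * q (R (grid t n i))))"
  shows "\<And>n. 0 < n \<Longrightarrow> \<bar>X n\<bar> \<le> C * K + 2 * C * t"
    and "\<exists>x. X \<longlonglongrightarrow> x \<and> \<bar>x\<bar> \<le> 2 * C * t * indicator {K..} (R t - B t)"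
proof -
  define D where "D u = R u - B u" for u
  define d where "d u = 1 / 2 * coth (R u)" for u
  have C0: "0 \<le> C" using C(1)[of 0] by linarith
  have D_int: "D v = (LINT u:{0..v}|lborel. d u)" if "0 \<le> v" for v
    unfolding D_def d_def by (subst eq(2)[OF that]) simp
  have d: "set_integrable lborel {0..v} d" if "0 \<le> v" for v
    unfolding d_def using eq(1)[OF that] by simp
  have d_nonneg: "0 \<le> d u" if "0 \<le> u" for u
    using R(2)[OF that] by (simp add: d_def coth_nonneg)
  have D_cont: "continuous_on {0..} D"
    unfolding D_def by (intro continuous_intros R B)
  have Dk: "min (D b) K - min (D a) K = (LINT u:{a<..b}|lborel. d u * indicator {u. D u < K} u)"
    if "0 \<le> a" "a \<le> b" for a b
    using D_int d d_nonneg D_cont that by (rule truncated_integral)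
  have D_mono: "D a \<le> D b" if "0 \<le> a" "a \<le> b" for a b
  proof -
    have "D b - D a = (LINT w:{a<..b}|lborel. d w)"
      using that D_int d set_integral_Icc_diff[of a b d] by simp
    also have "0 \<le> \<dots>"
      unfolding set_lebesgue_integral_def
      using d_nonneg that by (intro integral_nonneg_AE AE_I2) (auto simp: indicator_def)
    finally show ?thesis by simp
  qed
  have D0: "D 0 = 0"
    using D_int[of 0] by (simp add: set_integral_singleton)
  have Rk: "Rk u = B u + min (D u) K" for u
    by (simp add: Rk_def D_def)
  have Rk0: "Rk 0 = 0"
    using D0 B K by (simp add: Rk)
  have Rk_cont: "continuous_on {0..} Rk"
    unfolding Rk by (intro continuous_intros B D_cont)
  have Rk_R: "Rk u = R u" if "D u < K" for u
    using that by (simp add: Rk D_def)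
  define Y where "Y n = (\<Sum>i<n. f (Rk (grid t n (Suc i)))
      - f (Rk (grid t n i) + (B (grid t n (Suc i)) - B (grid t n i))))" for n
  define \<delta> where "\<delta> n i = min (D (grid t n (Suc i))) K - min (D (grid t n i)) K" for n i
  have grid: "0 \<le> grid t n i" "grid t n i \<le> grid t n (Suc i)" for i n
    using t by (auto intro: grid_nonneg grid_mono)
  have \<delta>0: "0 \<le> \<delta> n i" for n i
    unfolding \<delta>_def using D_mono[OF grid[of n i]] by linarith
  have \<delta>_sum: "(\<Sum>i<n. \<delta> n i) \<le> K" if "0 < n" for n
  proof -
    have "(\<Sum>i<n. \<delta> n i) = min (D (grid t n n)) K - min (D (grid t n 0)) K"
      unfolding \<delta>_def by (rule sum_lessThan_telescope)
    then show ?thesis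
      using D0 K that by simp
  qed
  have step: "Rk (grid t n (Suc i))
      = Rk (grid t n i) + (B (grid t n (Suc i)) - B (grid t n i)) + \<delta> n i" for n i
    by (simp add: Rk \<delta>_def)
  have f_lip: "\<bar>f x - f y\<bar> \<le> C * \<bar>x - y\<bar>" for x y
    using field_differentiable_bound[of UNIV f f1 C x y] C f
    by (auto intro: has_field_derivative_at_within)
  have f1_lip: "\<bar>f1 x - f1 y\<bar> \<le> C * \<bar>x - y\<bar>" for x y
    using field_differentiable_bound[of UNIV f1 f2 C x y] C f
    by (auto intro: has_field_derivative_at_within)
  have X_Y: "X n = Y n + (\<Sum>i<n. t / real n * (1 / 2 * f2 (Rk (grid t n i))))
      - (\<Sum>i<n. t / real n * (1 / 2 * f2 (R (grid t n i)) + 1 / 2 * q (R (grid t n i))))"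
    if "0 < n" for n
  proof -
    have "f (Rk t) - f 0 = (\<Sum>i<n. f (Rk (grid t n (Suc i))) - f (Rk (grid t n i)))"
      using sum_lessThan_telescope[of "\<lambda>i. f (Rk (grid t n i))" n] that Rk0 by simp
    then show ?thesis
      unfolding X_def Y_def by (simp add: sum_subtractf sum.distrib)
  qed
  show "\<bar>X n\<bar> \<le> C * K + 2 * C * t" if n: "0 < n" for n
  proof -
    have "\<bar>Y n\<bar> \<le> (\<Sum>i<n. C * \<delta> n i)"
      unfolding Y_def
    proof (intro order_trans[OF sum_abs] sum_mono)
      fix i
      show "\<bar>f (Rk (grid t n (Suc i)))
        - f (Rk (grid t n i) + (B (grid t n (Suc i)) - B (grid t n i)))\<bar> \<le> C * \<delta> n i"
        using f_lip[of "Rk (grid t n (Suc i))"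
            "Rk (grid t n i) + (B (grid t n (Suc i)) - B (grid t n i))"] \<delta>0[of n i]
        by (simp add: step)
    qed
    also have "\<dots> \<le> C * K"
      unfolding sum_distrib_left[symmetric] using \<delta>_sum[OF n] C0 by (rule mult_left_mono)
    finally have 1: "\<bar>Y n\<bar> \<le> C * K" .
    have 2: "\<bar>\<Sum>i<n. t / real n * g i\<bar> \<le> C * t" if "\<And>i. \<bar>g i\<bar> \<le> C" for g
    proof -
      have "\<bar>\<Sum>i<n. t / real n * g i\<bar> \<le> (\<Sum>i<n. t / real n * C)"
        using that t by (intro order_trans[OF sum_abs] sum_mono) (auto simp: abs_mult intro!: divide_right_mono mult_left_mono)
      then show ?thesis using n by (simp add: mult.commute)
    qed
    have 3: "\<bar>1 / 2 * f2 x\<bar> \<le> C" "\<bar>1 / 2 * f2 x + 1 / 2 * q y\<bar> \<le> C" for x y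
      using C(2)[of x] C(3)[of y] C0 by (auto simp: abs_le_iff)
    have "\<bar>X n\<bar> \<le> C * K + C * t + C * t"
      unfolding X_Y[OF n]
      by (intro order_trans[OF abs_triangle_ineq4] order_trans[OF abs_triangle_ineq] add_mono 1 2 3)
    then show ?thesis by simp
  qed
  define x where "x = (LINT u:{0..t}|lborel. f1 (Rk u) * (d u * indicator {u. D u < K} u))
    + (LINT u:{0..t}|lborel. 1 / 2 * f2 (Rk u)) - (LINT u:{0..t}|lborel. 1 / 2 * f2 (R u) + 1 / 2 * q (R u))"
  have cont_comp: "continuous_on {0..t} (\<lambda>u. g (\<phi> u))"
    if "continuous_on UNIV g" "continuous_on {0..} \<phi>" for g \<phi> :: "real \<Rightarrow> real"
    by (rule continuous_on_compose2[OF that(1)]) (auto intro: continuous_on_subset[OF that(2)])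
  have f1_cont: "continuous_on UNIV f1"
    using f(2) by (auto intro!: DERIV_continuous_on)
  have c_f2k: "continuous_on {0..t} (\<lambda>u. 1 / 2 * f2 (Rk u))"
    by (rule continuous_on_mult[OF continuous_on_const cont_comp[OF cont(1) Rk_cont]])
  have c_f2: "continuous_on {0..t} (\<lambda>u. 1 / 2 * f2 (R u))"
    by (rule continuous_on_mult[OF continuous_on_const cont_comp[OF cont(1) R(1)]])
  have c_q: "continuous_on {0..t} (\<lambda>u. 1 / 2 * q (R u))"
    by (rule continuous_on_mult[OF continuous_on_const cont_comp[OF cont(2) R(1)]])
  have meas_D: "{u. D u < K} \<inter> {0..t} \<in> sets borel"
  proof -
    have "(\<lambda>u. indicator {0..t} u *\<^sub>R D u) \<in> borel_measurable borel"
      by (rule borel_measurable_continuous_on_indicator) (auto intro: continuous_on_subset[OF D_cont])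
    then have "{u \<in> space borel. indicator {0..t} u *\<^sub>R D u < K} \<inter> {0..t} \<in> sets borel"
      by (intro sets.Int) auto
    also have "{u \<in> space borel. indicator {0..t} u *\<^sub>R D u < K} \<inter> {0..t} = {u. D u < K} \<inter> {0..t}"
      by auto
    finally show ?thesis .
  qed
  have dk: "set_integrable lborel {0..t} (\<lambda>u. d u * indicator {u. D u < K} u)"
    using d t meas_D by (intro indicator_mult_set_integrable) auto
  have lim1: "(\<lambda>n. \<Sum>i<n. f1 (Rk (grid t n i)) * \<delta> n i)
      \<longlonglongrightarrow> (LINT u:{0..t}|lborel. f1 (Rk u) * (d u * indicator {u. D u < K} u))"
    using weighted_riemann_sums_tendsto[OF t cont_comp[OF f1_cont Rk_cont] dk]
    unfolding \<delta>_def Dk[OF grid] .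
  have "(\<lambda>n. Y n - (\<Sum>i<n. f1 (Rk (grid t n i)) * \<delta> n i)) \<longlonglongrightarrow> 0"
  proof (rule tendstoI)
    fix e :: real assume e: "0 < e"
    define e' where "e' = e / (3 * C * K + 1)"
    have CK: "0 \<le> C * K" using C0 K by simp
    have e': "0 < e'" "3 * C * e' * K < e"
      using e CK by (auto simp: e'_def field_simps)
    have "\<forall>\<^sub>F n in sequentially. \<forall>i<n. \<bar>B (grid t n (Suc i)) - B (grid t n i)\<bar> < e'"
      "\<forall>\<^sub>F n in sequentially. \<forall>i<n. \<bar>Rk (grid t n (Suc i)) - Rk (grid t n i)\<bar> < e'"
      by (intro grid_modulus_tendsto_0 t e' continuous_on_subset[OF B(1)] continuous_on_subset[OF Rk_cont]; auto)+
    then show "\<forall>\<^sub>F n in sequentially. dist (Y n - (\<Sum>i<n. f1 (Rk (grid t n i)) * \<delta> n i)) 0 < e"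
      using eventually_gt_at_top[of 0]
    proof eventually_elim
      case (elim n)
      have "\<bar>Y n - (\<Sum>i<n. f1 (Rk (grid t n i)) * \<delta> n i)\<bar> \<le> (\<Sum>i<n. (C * (3 * e')) * \<delta> n i)"
        unfolding Y_def sum_subtractf[symmetric]
      proof (intro order_trans[OF sum_abs] sum_mono)
        fix i assume "i \<in> {..<n}"
        then have i: "i < n" by simp
        define r where "r = Rk (grid t n i)"
        define b where "b = B (grid t n (Suc i)) - B (grid t n i)"
        have st: "Rk (grid t n (Suc i)) = r + b + \<delta> n i"
          by (simp add: step r_def b_def)
        have b: "\<bar>b\<bar> < e'" and "\<bar>b + \<delta> n i\<bar> < e'"
          using elim i st by (auto simp: b_def r_def)
        then have \<delta>: "\<bar>b\<bar> + \<delta> n i \<le> 3 * e'"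
          by linarith
        \<comment> \<open>The mean value theorem for \<open>f x - x * f1 r\<close>, whose derivative is small near \<open>r\<close>.\<close>
        have "norm ((f (r + b + \<delta> n i) - (r + b + \<delta> n i) * f1 r) - (f (r + b) - (r + b) * f1 r))
            \<le> (C * (3 * e')) * norm ((r + b + \<delta> n i) - (r + b))"
        proof (rule field_differentiable_bound[where S="{r + b..r + b + \<delta> n i}" and f'="\<lambda>x. f1 x - f1 r"])
          show "((\<lambda>x. f x - x * f1 r) has_field_derivative f1 x - f1 r) (at x within {r + b..r + b + \<delta> n i})" for x
            by (auto intro!: derivative_eq_intros has_field_derivative_at_within[OF f(1)])
          show "norm (f1 x - f1 r) \<le> C * (3 * e')" if "x \<in> {r + b..r + b + \<delta> n i}" for x
          proof -
            have "\<bar>x - r\<bar> \<le> 3 * e'" using that \<delta> by auto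
            then show ?thesis
              using f1_lip[of x r] mult_left_mono[of "\<bar>x - r\<bar>" "3 * e'" C] C0 by simp
          qed
        qed (use \<delta>0[of n i] in auto)
        then show "\<bar>f (Rk (grid t n (Suc i)))
            - f (Rk (grid t n i) + (B (grid t n (Suc i)) - B (grid t n i)))
            - f1 (Rk (grid t n i)) * \<delta> n i\<bar> \<le> C * (3 * e') * \<delta> n i"
          unfolding st r_def[symmetric] b_def[symmetric] using \<delta>0[of n i] by (simp add: algebra_simps)
      qed
      also have "\<dots> \<le> (C * (3 * e')) * K"
        unfolding sum_distrib_left[symmetric] using \<delta>_sum[OF \<open>0 < n\<close>] C0 e'(1) by (intro mult_left_mono) auto
      also have "\<dots> < e" using e'(2) by (simp add: ac_simps)
      finally show ?case by simp
    qed
  qed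
  from tendsto_add[OF this lim1]
  have limY: "Y \<longlonglongrightarrow> (LINT u:{0..t}|lborel. f1 (Rk u) * (d u * indicator {u. D u < K} u))"
    by simp
  have "(\<lambda>n. Y n + (\<Sum>i<n. t / real n * (1 / 2 * f2 (Rk (grid t n i))))
      - (\<Sum>i<n. t / real n * (1 / 2 * f2 (R (grid t n i)) + 1 / 2 * q (R (grid t n i))))) \<longlonglongrightarrow> x"
    unfolding x_def
    by (rule tendsto_diff[OF tendsto_add[OF limY riemann_sums_tendsto[OF t c_f2k]]
        riemann_sums_tendsto[OF t continuous_on_add[OF c_f2 c_q]]])
  then have lim: "X \<longlonglongrightarrow> x"
    by (rule Lim_transform_eventually)
      (use X_Y in \<open>auto intro: eventually_mono[OF eventually_gt_at_top[of 0]]\<close>)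
  have q_int: "set_integrable lborel {0..t} (\<lambda>u. 1 / 2 * q (R u) * indicator {u. D u < K} u)"
  proof (rule set_integrable_continuous_mult)
    show "set_integrable lborel {0..t} (indicator {u. D u < K} :: real \<Rightarrow> real)"
      using indicator_mult_set_integrable[OF borel_integrable_atLeastAtMost'[OF continuous_on_const[of _ 1]] meas_D]
      by simp
    show "continuous_on {0..t} (\<lambda>u. 1 / 2 * q (R u))"
      by (rule c_q)
  qed
  have drift: "(LINT u:{0..t}|lborel. f1 (Rk u) * (d u * indicator {u. D u < K} u))
      = (LINT u:{0..t}|lborel. 1 / 2 * q (R u) * indicator {u. D u < K} u)"
    unfolding set_lebesgue_integral_def
  proof (rule integral_cong_AE)
    have "set_integrable lborel {0..t} (\<lambda>u. f1 (Rk u) * (d u * indicator {u. D u < K} u))"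
      by (rule set_integrable_continuous_mult[OF cont_comp[OF f1_cont Rk_cont] dk])
    then show "(\<lambda>u. indicator {0..t} u *\<^sub>R (f1 (Rk u) * (d u * indicator {u. D u < K} u))) \<in> borel_measurable lborel"
      unfolding set_integrable_def by (rule borel_measurable_integrable)
    show "(\<lambda>u. indicator {0..t} u *\<^sub>R (1 / 2 * q (R u) * indicator {u. D u < K} u)) \<in> borel_measurable lborel"
      using q_int unfolding set_integrable_def by (rule borel_measurable_integrable)
    show "AE u in lborel. indicator {0..t} u *\<^sub>R (f1 (Rk u) * (d u * indicator {u. D u < K} u))
        = indicator {0..t} u *\<^sub>R (1 / 2 * q (R u) * indicator {u. D u < K} u)"
      using R(3)
    proof eventually_elim
      case (elim u)
      then show ?case
        using q[of "R u"] Rk_R[of u] by (auto simp: indicator_def d_def)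
    qed
  qed
  have x_eq: "x = (LINT u:{0..t}|lborel. 1 / 2 * q (R u) * indicator {u. D u < K} u)
    + (LINT u:{0..t}|lborel. 1 / 2 * f2 (Rk u)) - (LINT u:{0..t}|lborel. 1 / 2 * f2 (R u) + 1 / 2 * q (R u))"
    unfolding x_def drift ..
  have "\<bar>x\<bar> \<le> 2 * C * t * indicator {K..} (R t - B t)"
  proof (cases "D t < K")
    case True
    have lt: "D u < K" if "0 \<le> u" "u \<le> t" for u
      using D_mono[OF that] True by simp
    have "(LINT u:{0..t}|lborel. 1 / 2 * q (R u) * indicator {u. D u < K} u) = (LINT u:{0..t}|lborel. 1 / 2 * q (R u))"
      using lt by (intro set_lebesgue_integral_cong) auto
    moreover have "(LINT u:{0..t}|lborel. 1 / 2 * f2 (Rk u)) = (LINT u:{0..t}|lborel. 1 / 2 * f2 (R u))"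
      using lt Rk_R by (intro set_lebesgue_integral_cong) auto
    moreover have "(LINT u:{0..t}|lborel. 1 / 2 * f2 (R u) + 1 / 2 * q (R u))
        = (LINT u:{0..t}|lborel. 1 / 2 * f2 (R u)) + (LINT u:{0..t}|lborel. 1 / 2 * q (R u))"
      by (rule set_integral_add(2)[OF borel_integrable_atLeastAtMost'[OF c_f2] borel_integrable_atLeastAtMost'[OF c_q]])
    ultimately have "x = 0"
      unfolding x_eq by simp
    then show ?thesis
      using C0 t by simp
  next
    case False
    have b: "\<bar>1 / 2 * q u * indicator A v\<bar> \<le> C / 2" "\<bar>1 / 2 * f2 u\<bar> \<le> C / 2"
      "\<bar>1 / 2 * f2 u + 1 / 2 * q w\<bar> \<le> C" for u v w and A :: "real set"
      using C(2)[of u] C(3)[of u] C(3)[of w] C0 by (auto simp: abs_le_iff indicator_def)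
    have "\<bar>x\<bar> \<le> C / 2 * t + C / 2 * t + C * t"
      unfolding x_eq
      by (intro order_trans[OF abs_triangle_ineq4] order_trans[OF abs_triangle_ineq] add_mono
          set_integral_Icc_bound b q_int less_imp_le[OF t]
          borel_integrable_atLeastAtMost'[OF c_f2k]
          borel_integrable_atLeastAtMost'[OF continuous_on_add[OF c_f2 c_q]])
    then show ?thesis
      using False by (simp add: D_def)
  qed
  with lim show "\<exists>x. X \<longlonglongrightarrow> x \<and> \<bar>x\<bar> \<le> 2 * C * t * indicator {K..} (R t - B t)"
    by blast
qed

section \<open>Dynkin's formula for the hyperbolic Bessel process\<close>

lemma abs_integral_le:
  fixes f g :: "'a \<Rightarrow> real"
  assumes "integrable M f" "integrable M g" "\<And>x. x \<in> space M \<Longrightarrow> \<bar>f x\<bar> \<le> g x"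
  shows "\<bar>\<integral>x. f x \<partial>M\<bar> \<le> (\<integral>x. g x \<partial>M)"
  using assms by (intro order_trans[OF integral_abs_bound] integral_mono integrable_abs) auto

text \<open>
  Fubini's theorem for the product law of \<open>X\<close> and \<open>Z\<close>.  The real variable enters as \<open>\<pi> (Z \<omega>)\<close>
  since \<open>indep_var\<close> relates variables with the same type of values, while \<open>X\<close> will also stand for
  a whole vector of past increments.
\<close>

lemma (in prob_space) indep_expectation_bound:
  fixes X Z :: "'a \<Rightarrow> 'b" and \<phi> :: "'b \<Rightarrow> real \<Rightarrow> real"
  assumes indep: "indep_var S X T Z" and \<pi>[measurable]: "\<pi> \<in> borel_measurable T"
    and Y: "distributed M lborel (\<lambda>\<omega>. \<pi> (Z \<omega>)) (\<lambda>y. ennreal (\<rho> y))"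
    and \<rho>: "\<rho> \<in> borel_measurable borel" "\<And>y. 0 \<le> \<rho> y"
    and \<phi>: "(\<lambda>(x, y). \<phi> x y) \<in> borel_measurable (S \<Otimes>\<^sub>M borel)"
    and int: "integrable M (\<lambda>\<omega>. \<phi> (X \<omega>) (\<pi> (Z \<omega>)))"
    and bound: "\<And>x. x \<in> space S \<Longrightarrow> \<bar>\<integral>y. \<rho> y * \<phi> x y \<partial>lborel\<bar> \<le> g x"
    and g: "g \<in> borel_measurable S" "integrable M (\<lambda>\<omega>. g (X \<omega>))"
  shows "\<bar>expectation (\<lambda>\<omega>. \<phi> (X \<omega>) (\<pi> (Z \<omega>)))\<bar> \<le> expectation (\<lambda>\<omega>. g (X \<omega>))"
proof -
  have X[measurable]: "random_variable S X" and Z[measurable]: "random_variable T Z"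
    using indep_var_rv1[OF indep] indep_var_rv2[OF indep] .
  interpret DX: prob_space "distr M S X" by (rule prob_space_distr) (rule X)
  interpret DZ: prob_space "distr M T Z" by (rule prob_space_distr) (rule Z)
  interpret P: pair_sigma_finite "distr M S X" "distr M T Z" ..
  have pair: "distr M S X \<Otimes>\<^sub>M distr M T Z = distr M (S \<Otimes>\<^sub>M T) (\<lambda>\<omega>. (X \<omega>, Z \<omega>))"
    using indep unfolding indep_var_distribution_eq by simp
  have \<phi>': "(\<lambda>(x, z). \<phi> x (\<pi> z)) \<in> borel_measurable (S \<Otimes>\<^sub>M T)"
  proof -
    have "(\<lambda>(x, z). (x, \<pi> z)) \<in> S \<Otimes>\<^sub>M T \<rightarrow>\<^sub>M S \<Otimes>\<^sub>M borel"
      by measurable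
    from measurable_compose[OF this \<phi>] show ?thesis
      by (simp add: case_prod_beta')
  qed
  have XZ: "(\<lambda>\<omega>. (X \<omega>, Z \<omega>)) \<in> M \<rightarrow>\<^sub>M S \<Otimes>\<^sub>M T"
    by measurable
  have int': "integrable (distr M S X \<Otimes>\<^sub>M distr M T Z) (\<lambda>(x, z). \<phi> x (\<pi> z))"
    unfolding pair integrable_distr_eq[OF XZ \<phi>'] using int by simp
  have \<phi>x: "\<phi> x \<in> borel_measurable borel" if "x \<in> space S" for x
    using measurable_compose[OF measurable_Pair1'[OF that] \<phi>] by simp
  have inner: "(\<integral>z. \<phi> x (\<pi> z) \<partial>distr M T Z) = (\<integral>y. \<rho> y * \<phi> x y \<partial>lborel)" if "x \<in> space S" for x
  proof -
    have "(\<integral>z. \<phi> x (\<pi> z) \<partial>distr M T Z) = expectation (\<lambda>\<omega>. \<phi> x (\<pi> (Z \<omega>)))"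
      by (intro integral_distr Z measurable_compose[OF \<pi> \<phi>x[OF that]])
    also have "\<dots> = (\<integral>y. \<rho> y * \<phi> x y \<partial>lborel)"
      using distributed_integral[OF Y, of "\<phi> x"] \<phi>x[OF that] \<rho> by simp
    finally show ?thesis .
  qed
  have eq: "expectation (\<lambda>\<omega>. \<phi> (X \<omega>) (\<pi> (Z \<omega>))) = (\<integral>x. (\<integral>z. \<phi> x (\<pi> z) \<partial>distr M T Z) \<partial>distr M S X)"
    using P.integral_fst[OF int'] unfolding pair integral_distr[OF XZ \<phi>'] by simp
  have "\<bar>\<integral>x. (\<integral>z. \<phi> x (\<pi> z) \<partial>distr M T Z) \<partial>distr M S X\<bar> \<le> (\<integral>x. g x \<partial>distr M S X)"
  proof (rule abs_integral_le)
    show "integrable (distr M S X) (\<lambda>x. \<integral>z. \<phi> x (\<pi> z) \<partial>distr M T Z)"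
      using P.integrable_fst[OF int'] by simp
    show "integrable (distr M S X) g"
      using g by (simp add: integrable_distr_eq)
    show "\<bar>\<integral>z. \<phi> x (\<pi> z) \<partial>distr M T Z\<bar> \<le> g x" if "x \<in> space (distr M S X)" for x
      using that bound inner by simp
  qed
  also have "(\<integral>x. g x \<partial>distr M S X) = expectation (\<lambda>\<omega>. g (X \<omega>))"
    using g by (simp add: integral_distr)
  finally show ?thesis
    unfolding eq .
qed

lemma (in brownian_motion_wrt) indep_var_past_increment:
  assumes s: "0 \<le> s" "s < u" and X: "X \<in> borel_measurable (F s)"
  shows "indep_var borel X borel (\<lambda>\<omega>. B u \<omega> - B s \<omega>)"
proof -
  let ?Y = "\<lambda>\<omega>. B u \<omega> - B s \<omega>"
  have Xm: "random_variable borel X"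
    using subalgebra_F[OF s(1)] X by (rule measurable_from_subalg)
  have Ym: "random_variable borel ?Y"
    using measurable_B[of u] measurable_B[of s] s by auto
  have past: "sigma_sets (space M) {X -` A \<inter> space M |A. A \<in> sets borel} \<subseteq> sets (F s)"
  proof -
    have sp: "space (F s) = space M" by (rule space_F)
    have "{X -` A \<inter> space (F s) |A. A \<in> sets borel} \<subseteq> sets (F s)"
      using X by (auto intro: measurable_sets)
    from sets.sigma_sets_subset[OF this] show ?thesis
      unfolding sp .
  qed
  have incr: "sigma_sets (space M) {?Y -` A \<inter> space M |A. A \<in> sets borel}
      = sets (vimage_algebra (space M) ?Y borel)"
    by (simp add: sets_vimage_algebra)
  have ind: "indep_set (sets (F s)) (sets (vimage_algebra (space M) ?Y borel))"
    by (rule increment_indep_past[OF s])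
  have "indep_set (sigma_sets (space M) {X -` A \<inter> space M |A. A \<in> sets borel})
      (sigma_sets (space M) {?Y -` A \<inter> space M |A. A \<in> sets borel})"
    unfolding incr
  proof (rule indep_setI)
    show "sigma_sets (space M) {X -` A \<inter> space M |A. A \<in> sets borel} \<subseteq> events"
      using past subalgebra_F[OF s(1)] by (auto simp: subalgebra_def)
    show "sets (vimage_algebra (space M) ?Y borel) \<subseteq> events"
      using Ym unfolding incr[symmetric] by (intro sets.sigma_sets_subset) (auto intro: measurable_sets)
    show "prob (a \<inter> b) = prob a * prob b"
      if "a \<in> sigma_sets (space M) {X -` A \<inter> space M |A. A \<in> sets borel}"
        "b \<in> sets (vimage_algebra (space M) ?Y borel)" for a b
      using indep_setD[OF ind] past that by auto
  qed
  with Xm Ym show ?thesis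
    unfolding indep_var_eq by simp
qed

lemma bessel_measurable:
  assumes "hyperbolic_bessel_0 M R" "0 \<le> t"
  shows "R t \<in> borel_measurable M"
proof -
  obtain F B where "brownian_motion_wrt M F B" "R t \<in> borel_measurable (F t)"
    using assms by (auto simp: hyperbolic_bessel_0_def)
  then show ?thesis
    using brownian_motion_wrt.subalgebra_F[OF _ assms(2)] by (auto intro: measurable_from_subalg)
qed

lemma bessel_prob_space: "hyperbolic_bessel_0 M R \<Longrightarrow> prob_space M"
  by (auto simp: hyperbolic_bessel_0_def brownian_motion_wrt_def brownian_motion_def)

lemma bessel_expectation_continuous:
  fixes g :: "real \<Rightarrow> real"
  assumes R: "hyperbolic_bessel_0 M R" and g: "continuous_on UNIV g" "\<And>x. \<bar>g x\<bar> \<le> C"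
  shows "continuous_on {0..} (\<lambda>u. \<integral>\<omega>. g (R u \<omega>) \<partial>M)"
  unfolding continuous_on_sequentially
proof (intro ballI allI impI, elim conjE)
  interpret prob_space M using R by (rule bessel_prob_space)
  fix x :: "nat \<Rightarrow> real" and a :: real
  assume a: "a \<in> {0..}" and x: "\<forall>n. x n \<in> {0..}" "x \<longlonglongrightarrow> a"
  have gm: "g \<in> borel_measurable borel"
    using g(1) by (rule borel_measurable_continuous_onI)
  have m: "(\<lambda>\<omega>. g (R u \<omega>)) \<in> borel_measurable M" if "0 \<le> u" for u
    using measurable_compose[OF bessel_measurable[OF R that] gm] .
  have path: "AE \<omega> in M. continuous_on {0..} (\<lambda>t. R t \<omega>)"
    using R unfolding hyperbolic_bessel_0_def by (auto elim: eventually_mono)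
  have "(\<lambda>n. \<integral>\<omega>. g (R (x n) \<omega>) \<partial>M) \<longlonglongrightarrow> (\<integral>\<omega>. g (R a \<omega>) \<partial>M)"
  proof (rule integral_dominated_convergence[where w="\<lambda>_. C"])
    show "AE \<omega> in M. (\<lambda>n. g (R (x n) \<omega>)) \<longlonglongrightarrow> g (R a \<omega>)"
      using path
    proof eventually_elim
      case (elim \<omega>)
      then have "(\<lambda>n. R (x n) \<omega>) \<longlonglongrightarrow> R a \<omega>"
        using a x by (auto simp: continuous_on_sequentially comp_def)
      then show ?case
        using g(1) by (auto simp: continuous_on_sequentially comp_def)
    qed
  qed (use a x g(2) m in auto)
  then show "((\<lambda>u. \<integral>\<omega>. g (R u \<omega>) \<partial>M) \<circ> x) \<longlonglongrightarrow> (\<integral>\<omega>. g (R a \<omega>) \<partial>M)"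
    by (simp only: comp_def)
qed

text \<open>
  Expectations of the pathwise limit.  The Brownian parts are of order \<open>h^(3/2)\<close> because the
  increments of \<open>B\<close> are independent of the past.  Refining the partition first, for a fixed
  truncation level \<open>K\<close>, leaves an error of the order of the probability that the drift exceeds \<open>K\<close>;
  then \<open>K\<close> tends to infinity.  This order of the limits takes the place of moment bounds on \<open>R\<close>.
\<close>

lemma bessel_dynkin_abstract:
  fixes f f1 f2 f3 q :: "real \<Rightarrow> real"
  assumes R: "hyperbolic_bessel_0 M R"
    and f: "\<And>x. (f has_real_derivative f1 x) (at x)" "\<And>x. (f1 has_real_derivative f2 x) (at x)"
      "\<And>x. (f2 has_real_derivative f3 x) (at x)"
    and cont: "continuous_on UNIV q"
    and C: "\<And>x. \<bar>f x\<bar> \<le> C" "\<And>x. \<bar>f1 x\<bar> \<le> C" "\<And>x. \<bar>f2 x\<bar> \<le> C" "\<And>x. \<bar>f3 x\<bar> \<le> C" "\<And>x. \<bar>q x\<bar> \<le> C"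
    and q: "\<And>x. 0 < x \<Longrightarrow> f1 x * coth x = q x"
    and t: "0 < t"
  shows "(\<integral>\<omega>. f (R t \<omega>) \<partial>M)
    = f 0 + (LINT u:{0..t}|lborel. (\<integral>\<omega>. 1 / 2 * f2 (R u \<omega>) + 1 / 2 * q (R u \<omega>) \<partial>M))"
proof -
  obtain F B where FB: "brownian_motion_wrt M F B" and adapted: "\<And>t. 0 \<le> t \<Longrightarrow> R t \<in> borel_measurable (F t)"
    and paths: "AE \<omega> in M.
        continuous_on {0..} (\<lambda>t. R t \<omega>) \<and>
        (\<forall>t\<ge>0. R t \<omega> \<ge> 0) \<and>
        (AE u in lborel. u \<ge> 0 \<longrightarrow> R u \<omega> > 0) \<and>
        (\<forall>t\<ge>0. set_integrable lborel {0..t} (\<lambda>u. coth (R u \<omega>)) \<and>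
          R t \<omega> = B t \<omega> + 1 / 2 * (LINT u:{0..t}|lborel. coth (R u \<omega>)))"
    using R unfolding hyperbolic_bessel_0_def by blast
  interpret brownian_motion_wrt M F B by (rule FB)
  define g where "g x = 1 / 2 * f2 x + 1 / 2 * q x" for x
  have C0: "0 \<le> C" using C(1)[of 0] by linarith
  have f_cont: "continuous_on UNIV f" "continuous_on UNIV f2"
    using f by (auto intro!: DERIV_continuous_on)
  have g_cont: "continuous_on UNIV g"
    unfolding g_def by (rule continuous_on_add[OF continuous_on_mult[OF continuous_on_const f_cont(2)]
      continuous_on_mult[OF continuous_on_const cont]])
  have g_C: "\<bar>g x\<bar> \<le> C" for x
    using C(3)[of x] C(5)[of x] by (auto simp: g_def abs_le_iff)
  have fm[measurable]: "f \<in> borel_measurable borel" "f2 \<in> borel_measurable borel" "g \<in> borel_measurable borel"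
    using f_cont g_cont by (auto intro: borel_measurable_continuous_onI)
  have Rm: "random_variable borel (R u)" and Bm: "random_variable borel (B u)" if "0 \<le> u" for u
    using bessel_measurable[OF R that] measurable_B[OF that] .
  have gr: "0 \<le> grid t n i" for n i
    using t by (simp add: grid_nonneg)
  define m where "m u = (\<integral>\<omega>. g (R u \<omega>) \<partial>M)" for u
  have m_cont: "continuous_on {0..t} m"
    unfolding m_def using bessel_expectation_continuous[OF R g_cont g_C] by (rule continuous_on_subset) auto
  define I where "I = (LINT u:{0..t}|lborel. m u)"
  have riemann: "(\<lambda>n. \<Sum>i<n. t / real n * m (grid t n i)) \<longlonglongrightarrow> I"
    unfolding I_def using t m_cont by (rule riemann_sums_tendsto)
  define tail where "tail K = prob {\<omega> \<in> space M. K \<le> R t \<omega> - B t \<omega>}" for K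
  have tail_set: "{\<omega> \<in> space M. K \<le> R t \<omega> - B t \<omega>} \<in> events" for K
  proof -
    have [measurable]: "random_variable borel (R t)" "random_variable borel (B t)"
      using Rm Bm t by auto
    show ?thesis by measurable
  qed
  have trunc: "\<bar>(\<integral>\<omega>. f (R t \<omega>) \<partial>M) - f 0 - I\<bar> \<le> (2 * C + 2 * C * t) * tail K" if K: "0 < K" for K
  proof -
    define Rk where "Rk u \<omega> = B u \<omega> + min (R u \<omega> - B u \<omega>) K" for u \<omega>
    define \<beta> where "\<beta> n i \<omega> = B (grid t n (Suc i)) \<omega> - B (grid t n i) \<omega>" for n i \<omega>
    define E where "E n i \<omega> = f (Rk (grid t n i) \<omega> + \<beta> n i \<omega>) - f (Rk (grid t n i) \<omega>)
        - t / real n / 2 * f2 (Rk (grid t n i) \<omega>)" for n i \<omega>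
    define X where "X n \<omega> = f (Rk t \<omega>) - f 0 - (\<Sum>i<n. E n i \<omega>)
        - (\<Sum>i<n. t / real n * g (R (grid t n i) \<omega>))" for n \<omega>
    define A where "A = {\<omega> \<in> space M. K \<le> R t \<omega> - B t \<omega>}"
    have A: "A \<in> events" unfolding A_def by (rule tail_set)
    have Rk_F: "Rk u \<in> borel_measurable (F u)" if "0 \<le> u" for u
      unfolding Rk_def[abs_def] using adapted[OF that] adapted_B[OF that] by measurable
    have Rkm: "random_variable borel (Rk u)" if "0 \<le> u" for u
      using subalgebra_F[OF that] Rk_F[OF that] by (rule measurable_from_subalg)
    have \<beta>m: "random_variable borel (\<beta> n i)" for n i
      unfolding \<beta>_def[abs_def] using Bm[OF gr] by (intro borel_measurable_diff) auto
    have iRk: "integrable M (\<lambda>\<omega>. h (Rk u \<omega>))"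
      if "h \<in> borel_measurable borel" "\<And>x. \<bar>h x\<bar> \<le> C" "0 \<le> u" for h :: "real \<Rightarrow> real" and u
      by (rule integrable_const_bound[where B=C])
        (use that measurable_compose[OF Rkm that(1)] in auto)
    have iR: "integrable M (\<lambda>\<omega>. h (R u \<omega>))"
      if "h \<in> borel_measurable borel" "\<And>x. \<bar>h x\<bar> \<le> C" "0 \<le> u" for h :: "real \<Rightarrow> real" and u
      by (rule integrable_const_bound[where B=C])
        (use that measurable_compose[OF Rm that(1)] in auto)
    have iE1: "integrable M (\<lambda>\<omega>. f (Rk (grid t n i) \<omega> + \<beta> n i \<omega>))" for n i
      by (rule integrable_const_bound[where B=C])
        (use C(1) measurable_compose[OF borel_measurable_add[OF Rkm[OF gr] \<beta>m] fm(1)] in auto)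
    have iE: "integrable M (E n i)" for n i
      unfolding E_def[abs_def]
      by (intro Bochner_Integration.integrable_diff integrable_mult_right iE1 iRk fm C gr)
    have iX: "integrable M (X n)" for n
      unfolding X_def[abs_def]
      by (intro Bochner_Integration.integrable_diff Bochner_Integration.integrable_sum integrable_mult_right
          iE iRk iR fm C g_C gr integrable_const less_imp_le[OF t])
    \<comment> \<open>\<open>Rk\<close> at a grid point belongs to the past, hence is independent of the next increment.\<close>
    have E_bound: "\<bar>\<integral>\<omega>. E n i \<omega> \<partial>M\<bar> \<le> C * (t / real n * sqrt (t / real n))" if n: "0 < n" for n i
    proof -
      let ?h = "t / real n"
      have h: "0 < ?h" using t n by simp
      have lt: "grid t n i < grid t n (Suc i)" using h by (simp add: grid_Suc)
      have ind: "indep_var borel (Rk (grid t n i)) borel (\<beta> n i)"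
        unfolding \<beta>_def[abs_def] using gr lt Rk_F[OF gr] by (rule indep_var_past_increment)
      have dist: "distributed M lborel (\<beta> n i) (\<lambda>x. ennreal (normal_density 0 (sqrt ?h) x))"
        using gaussian_increments[OF gr lt] by (simp add: \<beta>_def[abs_def] grid_Suc)
      have "\<bar>expectation (\<lambda>\<omega>. (\<lambda>x y. f (x + y) - f x - ?h / 2 * f2 x) (Rk (grid t n i) \<omega>) (\<beta> n i \<omega>))\<bar>
          \<le> expectation (\<lambda>\<omega>. (\<lambda>x. C * (?h * sqrt ?h)) (Rk (grid t n i) \<omega>))"
      proof (rule indep_expectation_bound[where \<pi>="\<lambda>x. x", OF ind measurable_ident_sets[OF refl] dist])
        show "integrable M (\<lambda>\<omega>. f (Rk (grid t n i) \<omega> + \<beta> n i \<omega>) - f (Rk (grid t n i) \<omega>) - ?h / 2 * f2 (Rk (grid t n i) \<omega>))"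
          using iE[of n i] by (simp add: E_def[abs_def])
        fix x
        let ?N = "normal_density 0 (sqrt ?h)"
        have iF: "integrable lborel (\<lambda>y. ?N y * f (x + y))"
        proof (rule Bochner_Integration.integrable_bound)
          show "integrable lborel (\<lambda>y. C * ?N y)"
            using h by simp
          show "AE y in lborel. norm (?N y * f (x + y)) \<le> norm (C * ?N y)"
          proof (intro AE_I2)
            fix y
            have "?N y * \<bar>f (x + y)\<bar> \<le> ?N y * C"
              using C(1) by (intro mult_left_mono) auto
            then show "norm (?N y * f (x + y)) \<le> norm (C * ?N y)"
              using C0 by (simp add: abs_mult mult.commute)
          qed
        qed measurable
        have "(\<integral>y. ?N y * (f (x + y) - f x - ?h / 2 * f2 x) \<partial>lborel)
            = (\<integral>y. ?N y * f (x + y) - ?N y * (f x + ?h / 2 * f2 x) \<partial>lborel)"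
          by (intro Bochner_Integration.integral_cong refl) (simp add: algebra_simps)
        also have "\<dots> = (\<integral>y. ?N y * f (x + y) \<partial>lborel) - (f x + ?h / 2 * f2 x)"
          using iF h by (subst Bochner_Integration.integral_diff) auto
        finally have e: "(\<integral>y. ?N y * (f (x + y) - f x - ?h / 2 * f2 x) \<partial>lborel)
            = (\<integral>y. ?N y * f (x + y) \<partial>lborel) - f x - ?h / 2 * f2 x"
          by simp
        show "\<bar>\<integral>y. ?N y * (f (x + y) - f x - ?h / 2 * f2 x) \<partial>lborel\<bar> \<le> C * (?h * sqrt ?h)"
          unfolding e by (rule gaussian_second_order_expansion[OF f C(4) C(1) h])
      qed (auto intro!: normal_density_nonneg)
      then show ?thesis
        by (simp add: E_def[abs_def] prob_space)
    qed
    have X_path: "AE \<omega> in M. (\<forall>n>0. \<bar>X n \<omega>\<bar> \<le> C * K + 2 * C * t) \<and>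
        (\<exists>x. (\<lambda>n. X n \<omega>) \<longlonglongrightarrow> x \<and> \<bar>x\<bar> \<le> 2 * C * t * indicator A \<omega>)"
      using paths AE_space
    proof eventually_elim
      case (elim \<omega>)
      note path = pathwise_ito_limit[where f=f and ?f1.0=f1 and ?f2.0=f2 and q=q and C=C and t=t and K=K
          and B="\<lambda>u. B u \<omega>" and R="\<lambda>u. R u \<omega>", OF f(1) f(2) f_cont(2) cont C(2) C(3) C(5)]
      note prems = q continuous_paths[OF elim(2)] start_zero[OF elim(2)] elim(1) t K
      have ind: "indicator {K..} (R t \<omega> - B t \<omega>) = (indicator A \<omega> :: real)"
        using elim(2) by (auto simp: A_def indicator_def)
      show ?case
      proof (intro conjI allI impI)
        show "\<bar>X n \<omega>\<bar> \<le> C * K + 2 * C * t" if "0 < n" for n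
          unfolding X_def E_def \<beta>_def Rk_def g_def by (rule path(1)) (use prems that in blast)+
        show "\<exists>x. (\<lambda>n. X n \<omega>) \<longlonglongrightarrow> x \<and> \<bar>x\<bar> \<le> 2 * C * t * indicator A \<omega>"
          unfolding X_def E_def \<beta>_def Rk_def g_def ind[symmetric] by (rule path(2)) (use prems in blast)+
      qed
    qed
    \<comment> \<open>The excess of \<open>X n\<close> over the bound for its limit tends to \<open>0\<close>, boundedly.\<close>
    define W where "W n \<omega> = max 0 (\<bar>X n \<omega>\<bar> - 2 * C * t * indicator A \<omega>)" for n \<omega>
    have c0: "0 \<le> 2 * C * t" using C0 t by simp
    have Wm: "random_variable borel (W n)" for n
      unfolding W_def[abs_def] using borel_measurable_integrable[OF iX[of n]] A by measurable
    have "(\<lambda>n. \<integral>\<omega>. W (Suc n) \<omega> \<partial>M) \<longlonglongrightarrow> (\<integral>\<omega>. 0 \<partial>M)"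
    proof (rule integral_dominated_convergence[where w="\<lambda>_. C * K + 2 * C * t"])
      show "AE \<omega> in M. (\<lambda>n. W (Suc n) \<omega>) \<longlonglongrightarrow> 0"
        using X_path
      proof eventually_elim
        case (elim \<omega>)
        then obtain x where x: "(\<lambda>n. X n \<omega>) \<longlonglongrightarrow> x" "\<bar>x\<bar> \<le> 2 * C * t * indicator A \<omega>"
          by blast
        have "(\<lambda>n. W n \<omega>) \<longlonglongrightarrow> max 0 (\<bar>x\<bar> - 2 * C * t * indicator A \<omega>)"
          unfolding W_def by (intro tendsto_intros x)
        also have "max 0 (\<bar>x\<bar> - 2 * C * t * indicator A \<omega>) = 0"
          using x(2) by simp
        finally show ?case
          by (rule LIMSEQ_Suc)
      qed
      show "AE \<omega> in M. norm (W (Suc n) \<omega>) \<le> C * K + 2 * C * t" for n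
        using X_path
      proof eventually_elim
        case (elim \<omega>)
        then have "\<bar>X (Suc n) \<omega>\<bar> \<le> C * K + 2 * C * t" by simp
        moreover have "0 \<le> 2 * C * t * indicator A \<omega>" using c0 by simp
        ultimately show ?case
          by (simp add: W_def)
      qed
    qed (use Wm in auto)
    then have W_lim: "(\<lambda>n. \<integral>\<omega>. W (Suc n) \<omega> \<partial>M) \<longlonglongrightarrow> 0"
      by simp
    have iW: "integrable M (W (Suc n))" for n
      unfolding W_def[abs_def]
      using iX[of "Suc n"] A
      by (intro integrable_max Bochner_Integration.integrable_diff integrable_abs integrable_mult_right integrable_real_indicator)
        (auto simp: emeasure_eq_measure)
    have bound: "\<bar>(\<integral>\<omega>. f (Rk t \<omega>) \<partial>M) - f 0 - (\<Sum>i<Suc n. t / real (Suc n) * m (grid t (Suc n) i))\<bar>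
        \<le> (\<integral>\<omega>. W (Suc n) \<omega> \<partial>M) + 2 * C * t * tail K + C * t * sqrt (t / real (Suc n))" for n
    proof -
      let ?n = "Suc n"
      have EX: "(\<integral>\<omega>. X ?n \<omega> \<partial>M) = (\<integral>\<omega>. f (Rk t \<omega>) \<partial>M) - f 0 - (\<Sum>i<?n. \<integral>\<omega>. E ?n i \<omega> \<partial>M)
          - (\<Sum>i<?n. t / real ?n * m (grid t ?n i))"
      proof -
        have 1: "integrable M (\<lambda>\<omega>. f (Rk t \<omega>))"
          using t by (intro iRk fm C) auto
        have 2: "integrable M (\<lambda>\<omega>. \<Sum>i<?n. E ?n i \<omega>)"
          by (intro Bochner_Integration.integrable_sum iE)
        have 3: "integrable M (\<lambda>\<omega>. t / real ?n * g (R (grid t ?n i) \<omega>))" for i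
          by (intro integrable_mult_right iR fm g_C gr)
        have "(\<integral>\<omega>. X ?n \<omega> \<partial>M) = (\<integral>\<omega>. f (Rk t \<omega>) - f 0 - (\<Sum>i<?n. E ?n i \<omega>) \<partial>M)
            - (\<integral>\<omega>. (\<Sum>i<?n. t / real ?n * g (R (grid t ?n i) \<omega>)) \<partial>M)"
          unfolding X_def
          by (rule Bochner_Integration.integral_diff)
            (intro Bochner_Integration.integrable_diff 1 2 3 integrable_const Bochner_Integration.integrable_sum)+
        also have "(\<integral>\<omega>. f (Rk t \<omega>) - f 0 - (\<Sum>i<?n. E ?n i \<omega>) \<partial>M)
            = (\<integral>\<omega>. f (Rk t \<omega>) - f 0 \<partial>M) - (\<integral>\<omega>. (\<Sum>i<?n. E ?n i \<omega>) \<partial>M)"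
          by (rule Bochner_Integration.integral_diff)
            (intro Bochner_Integration.integrable_diff 1 2 integrable_const)+
        also have "(\<integral>\<omega>. f (Rk t \<omega>) - f 0 \<partial>M) = (\<integral>\<omega>. f (Rk t \<omega>) \<partial>M) - f 0"
          using 1 by (simp add: prob_space)
        also have "(\<integral>\<omega>. (\<Sum>i<?n. E ?n i \<omega>) \<partial>M) = (\<Sum>i<?n. \<integral>\<omega>. E ?n i \<omega> \<partial>M)"
          by (intro Bochner_Integration.integral_sum iE)
        also have "(\<integral>\<omega>. (\<Sum>i<?n. t / real ?n * g (R (grid t ?n i) \<omega>)) \<partial>M)
            = (\<Sum>i<?n. \<integral>\<omega>. t / real ?n * g (R (grid t ?n i) \<omega>) \<partial>M)"
          by (intro Bochner_Integration.integral_sum 3)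
        also have "\<dots> = (\<Sum>i<?n. t / real ?n * m (grid t ?n i))"
          unfolding m_def by (intro sum.cong refl integral_mult_right_zero)
        finally show ?thesis .
      qed
      have "\<bar>\<integral>\<omega>. X ?n \<omega> \<partial>M\<bar> \<le> (\<integral>\<omega>. W ?n \<omega> + 2 * C * t * indicator A \<omega> \<partial>M)"
      proof (rule abs_integral_le)
        show "integrable M (\<lambda>\<omega>. W ?n \<omega> + 2 * C * t * indicator A \<omega>)"
          using iW[of n] A by (intro Bochner_Integration.integrable_add integrable_mult_right integrable_real_indicator)
            (auto simp: emeasure_eq_measure)
      qed (auto simp: W_def iX)
      also have "\<dots> = (\<integral>\<omega>. W ?n \<omega> \<partial>M) + 2 * C * t * tail K"
        using iW[of n] A by (subst Bochner_Integration.integral_add) (auto simp: tail_def A_def[symmetric] emeasure_eq_measure)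
      finally have 1: "\<bar>\<integral>\<omega>. X ?n \<omega> \<partial>M\<bar> \<le> (\<integral>\<omega>. W ?n \<omega> \<partial>M) + 2 * C * t * tail K" .
      have "\<bar>\<Sum>i<?n. \<integral>\<omega>. E ?n i \<omega> \<partial>M\<bar> \<le> (\<Sum>i<?n. C * (t / real ?n * sqrt (t / real ?n)))"
        by (intro order_trans[OF sum_abs] sum_mono E_bound) simp
      also have "\<dots> = C * t * sqrt (t / real ?n)"
        by (simp only: sum_constant card_lessThan) (simp add: field_simps)
      finally have 2: "\<bar>\<Sum>i<?n. \<integral>\<omega>. E ?n i \<omega> \<partial>M\<bar> \<le> C * t * sqrt (t / real ?n)" .
      show ?thesis
        using 1 2 unfolding EX by linarith
    qed
    have "\<bar>(\<integral>\<omega>. f (Rk t \<omega>) \<partial>M) - f 0 - I\<bar> \<le> 0 + 2 * C * t * tail K + C * t * sqrt 0"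
    proof (rule LIMSEQ_le)
      show "(\<lambda>n. \<bar>(\<integral>\<omega>. f (Rk t \<omega>) \<partial>M) - f 0 - (\<Sum>i<Suc n. t / real (Suc n) * m (grid t (Suc n) i))\<bar>)
          \<longlonglongrightarrow> \<bar>(\<integral>\<omega>. f (Rk t \<omega>) \<partial>M) - f 0 - I\<bar>"
        by (intro tendsto_intros LIMSEQ_Suc[OF riemann])
      have "(\<lambda>n. t / real (Suc n)) \<longlonglongrightarrow> 0"
        by (rule LIMSEQ_Suc[OF lim_const_over_n])
      then show "(\<lambda>n. (\<integral>\<omega>. W (Suc n) \<omega> \<partial>M) + 2 * C * t * tail K + C * t * sqrt (t / real (Suc n)))
          \<longlonglongrightarrow> 0 + 2 * C * t * tail K + C * t * sqrt 0"
        by (intro tendsto_intros W_lim)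
    qed (use bound in blast)
    then have 1: "\<bar>(\<integral>\<omega>. f (Rk t \<omega>) \<partial>M) - f 0 - I\<bar> \<le> 2 * C * t * tail K"
      by simp
    have i: "integrable M (\<lambda>\<omega>. f (R t \<omega>))" "integrable M (\<lambda>\<omega>. f (Rk t \<omega>))"
      using t by (auto intro!: iR iRk fm C)
    have "\<bar>\<integral>\<omega>. f (R t \<omega>) - f (Rk t \<omega>) \<partial>M\<bar> \<le> (\<integral>\<omega>. 2 * C * indicator A \<omega> \<partial>M)"
    proof (rule abs_integral_le)
      show "integrable M (\<lambda>\<omega>. 2 * C * indicator A \<omega>)"
        using A by (intro integrable_mult_right integrable_real_indicator) (auto simp: emeasure_eq_measure)
      fix \<omega> assume \<omega>: "\<omega> \<in> space M"
      show "\<bar>f (R t \<omega>) - f (Rk t \<omega>)\<bar> \<le> 2 * C * indicator A \<omega>"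
      proof (cases "\<omega> \<in> A")
        case True
        then show ?thesis
          using C(1)[of "R t \<omega>"] C(1)[of "Rk t \<omega>"] by (simp add: abs_le_iff)
      next
        case False
        then have "Rk t \<omega> = R t \<omega>"
          using \<omega> by (simp add: A_def Rk_def)
        then show ?thesis
          using C0 by simp
      qed
    qed (use i in auto)
    also have "\<dots> = 2 * C * tail K"
      using A by (simp add: tail_def A_def[symmetric])
    finally have 2: "\<bar>(\<integral>\<omega>. f (R t \<omega>) \<partial>M) - (\<integral>\<omega>. f (Rk t \<omega>) \<partial>M)\<bar> \<le> 2 * C * tail K"
      using i by simp
    have "\<bar>(\<integral>\<omega>. f (R t \<omega>) \<partial>M) - f 0 - I\<bar> \<le> 2 * C * tail K + 2 * C * t * tail K"
      using 1 2 by linarith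
    then show ?thesis
      by (simp add: distrib_right)
  qed
  have "(\<lambda>n. tail (real (Suc n))) \<longlonglongrightarrow> prob (\<Inter>n. {\<omega> \<in> space M. real (Suc n) \<le> R t \<omega> - B t \<omega>})"
    unfolding tail_def
    by (rule finite_Lim_measure_decseq) (use tail_set in \<open>auto simp: decseq_def\<close>)
  also have "(\<Inter>n. {\<omega> \<in> space M. real (Suc n) \<le> R t \<omega> - B t \<omega>}) = {}"
  proof safe
    fix \<omega> assume "\<omega> \<in> (\<Inter>n. {\<omega> \<in> space M. real (Suc n) \<le> R t \<omega> - B t \<omega>})"
    then have le: "real (Suc n) \<le> R t \<omega> - B t \<omega>" for n by auto
    obtain n where "R t \<omega> - B t \<omega> < real n"
      using reals_Archimedean2 by blast
    with le[of n] have False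
      by simp
    then show "\<omega> \<in> {}" ..
  qed
  finally have "(\<lambda>n. tail (real (Suc n))) \<longlonglongrightarrow> 0"
    by simp
  then have "(\<lambda>n. (2 * C + 2 * C * t) * tail (real (Suc n))) \<longlonglongrightarrow> (2 * C + 2 * C * t) * 0"
    by (intro tendsto_intros)
  then have "\<bar>(\<integral>\<omega>. f (R t \<omega>) \<partial>M) - f 0 - I\<bar> \<le> (2 * C + 2 * C * t) * 0"
    by (rule LIMSEQ_le_const) (use trunc[OF of_nat_0_less_iff[THEN iffD2]] in blast)
  then show ?thesis
    by (simp add: I_def m_def g_def)
qed

section \<open>The Laplace transform of the hyperbolic Bessel process\<close>

lemma bessel_start_zero:
  assumes R: "hyperbolic_bessel_0 M R"
  shows "AE \<omega> in M. R 0 \<omega> = 0"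
proof -
  obtain F B where FB: "brownian_motion_wrt M F B"
    and all: "AE \<omega> in M.
        continuous_on {0..} (\<lambda>t. R t \<omega>) \<and>
        (\<forall>t\<ge>0. R t \<omega> \<ge> 0) \<and>
        (AE u in lborel. u \<ge> 0 \<longrightarrow> R u \<omega> > 0) \<and>
        (\<forall>t\<ge>0. set_integrable lborel {0..t} (\<lambda>u. coth (R u \<omega>)) \<and>
          R t \<omega> = B t \<omega> + 1 / 2 * (LINT u:{0..t}|lborel. coth (R u \<omega>)))"
    using R unfolding hyperbolic_bessel_0_def by blast
  have paths: "AE \<omega> in M. \<forall>t\<ge>0. R t \<omega> = B t \<omega> + 1 / 2 * (LINT u:{0..t}|lborel. coth (R u \<omega>))"
    by (rule eventually_mono[OF all]) blast
  interpret brownian_motion_wrt M F B by (rule FB)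
  show ?thesis
    using paths AE_space
  proof eventually_elim
    case (elim \<omega>)
    then have "R 0 \<omega> = B 0 \<omega> + 1 / 2 * (LINT u:{0..0}|lborel. coth (R u \<omega>))"
      by blast
    then show ?case
      using start_zero[OF elim(2)] by (simp add: set_integral_singleton)
  qed
qed

text \<open>
  For \<open>p = 1\<close> this is the Laplace transform of \<open>cosh (R s) - 1\<close> at \<open>l\<close>.
\<close>

definition bessel_mean :: "'a measure \<Rightarrow> (real \<Rightarrow> 'a \<Rightarrow> real) \<Rightarrow> real \<Rightarrow> real poly \<Rightarrow> real \<Rightarrow> real" where
  "bessel_mean M R l p s = (\<integral>\<omega>. poly_exp l p (cosh (R s \<omega>) - 1) \<partial>M)"

lemma continuous_poly_exp_cosh: "continuous_on UNIV (\<lambda>r. poly_exp l p (cosh r - 1))"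
  by (rule DERIV_continuous_on) (rule has_field_derivative_at_within[OF has_real_derivative_poly_exp_cosh])

lemma bessel_mean_zero:
  assumes R: "hyperbolic_bessel_0 M R"
  shows "bessel_mean M R l p 0 = poly p 0"
proof -
  interpret prob_space M using R by (rule bessel_prob_space)
  have m: "(\<lambda>\<omega>. poly_exp l p (cosh (R 0 \<omega>) - 1)) \<in> borel_measurable M"
    using measurable_compose[OF bessel_measurable[OF R order_refl]
        borel_measurable_continuous_onI[OF continuous_poly_exp_cosh]] .
  have "bessel_mean M R l p 0 = (\<integral>\<omega>. poly p 0 \<partial>M)"
    unfolding bessel_mean_def
    by (rule integral_cong_AE) (use m bessel_start_zero[OF R] in \<open>auto elim!: eventually_mono\<close>)
  then show ?thesis
    by (simp add: prob_space)
qed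

lemma bessel_mean_continuous:
  assumes R: "hyperbolic_bessel_0 M R" and l: "0 < l"
  shows "continuous_on {0..} (bessel_mean M R l p)"
proof -
  obtain C where "\<And>r. \<bar>poly_exp l p (cosh r - 1)\<bar> \<le> C"
    using poly_exp_cosh_bounded[OF l] by blast
  then show ?thesis
    unfolding bessel_mean_def[abs_def]
    by (rule bessel_expectation_continuous[OF R continuous_poly_exp_cosh])
qed

text \<open>
  The derivative in \<open>r\<close> of a smooth function of \<open>cosh r\<close> carries the factor \<open>sinh r\<close>, which cancels
  the singularity of \<open>coth r\<close> at \<open>0\<close>.
\<close>

lemma bessel_dynkin:
  assumes R: "hyperbolic_bessel_0 M R" and l: "0 < l" and t: "0 \<le> t"
  shows "bessel_mean M R l p t = poly p 0 + (LINT u:{0..t}|lborel. bessel_mean M R l (pe_gen l p) u)"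
proof (cases "t = 0")
  case True
  then show ?thesis
    using bessel_mean_zero[OF R] by (simp add: set_integral_singleton)
next
  case False
  define p1 where "p1 = pe_deriv l p"
  define p2 where "p2 = [:0, 2, 1:] * pe_deriv l p1 + [:1, 1:] * p1"
  obtain C0 where C0: "\<And>r. \<bar>poly_exp l p (cosh r - 1)\<bar> \<le> C0"
    using poly_exp_cosh_bounded[OF l] by blast
  obtain C1 where C1: "\<And>r. \<bar>poly_exp l p1 (cosh r - 1) * sinh r\<bar> \<le> C1"
    using poly_exp_cosh_sinh_bounded[OF l] by blast
  obtain C2 where C2: "\<And>r. \<bar>poly_exp l p2 (cosh r - 1)\<bar> \<le> C2"
    using poly_exp_cosh_bounded[OF l] by blast
  obtain C3 where C3: "\<And>r. \<bar>poly_exp l (pe_deriv l p2) (cosh r - 1) * sinh r\<bar> \<le> C3"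
    using poly_exp_cosh_sinh_bounded[OF l] by blast
  obtain C4 where C4: "\<And>r. \<bar>poly_exp l ([:1, 1:] * p1) (cosh r - 1)\<bar> \<le> C4"
    using poly_exp_cosh_bounded[OF l] by blast
  define C where "C = Max {C0, C1, C2, C3, C4}"
  have C: "C0 \<le> C" "C1 \<le> C" "C2 \<le> C" "C3 \<le> C" "C4 \<le> C"
    by (simp_all add: C_def)
  have gen: "1 / 2 * poly_exp l p2 y + 1 / 2 * poly_exp l ([:1, 1:] * p1) y = poly_exp l (pe_gen l p) y" for y
    by (simp add: poly_exp_def pe_gen_def p2_def p1_def algebra_simps add_divide_distrib)
  have "(\<integral>\<omega>. poly_exp l p (cosh (R t \<omega>) - 1) \<partial>M)
    = poly_exp l p (cosh 0 - 1) + (LINT u:{0..t}|lborel.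
      (\<integral>\<omega>. 1 / 2 * poly_exp l p2 (cosh (R u \<omega>) - 1)
          + 1 / 2 * poly_exp l ([:1, 1:] * p1) (cosh (R u \<omega>) - 1) \<partial>M))"
  proof (rule bessel_dynkin_abstract[OF R, where C=C])
    show "((\<lambda>r. poly_exp l p (cosh r - 1)) has_real_derivative poly_exp l p1 (cosh x - 1) * sinh x) (at x)" for x
      unfolding p1_def by (rule has_real_derivative_poly_exp_cosh)
    show "((\<lambda>r. poly_exp l p1 (cosh r - 1) * sinh r) has_real_derivative poly_exp l p2 (cosh x - 1)) (at x)" for x
      unfolding p2_def by (rule has_real_derivative_poly_exp_cosh_sinh)
    show "((\<lambda>r. poly_exp l p2 (cosh r - 1)) has_real_derivative poly_exp l (pe_deriv l p2) (cosh x - 1) * sinh x) (at x)" for x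
      by (rule has_real_derivative_poly_exp_cosh)
    show "continuous_on UNIV (\<lambda>r. poly_exp l ([:1, 1:] * p1) (cosh r - 1))"
      by (rule continuous_poly_exp_cosh)
    show "poly_exp l p1 (cosh x - 1) * sinh x * coth x = poly_exp l ([:1, 1:] * p1) (cosh x - 1)" if "0 < x" for x
      using that by (simp add: coth_def poly_exp_def algebra_simps)
    show "0 < t" using t False by simp
  qed (use C order_trans[OF C0] order_trans[OF C1] order_trans[OF C2] order_trans[OF C3] order_trans[OF C4] in auto)
  then show ?thesis
    unfolding gen bessel_mean_def by simp
qed

lemma bessel_mean_increment:
  assumes R: "hyperbolic_bessel_0 M R" and l: "0 < l" and s: "0 \<le> s" "s \<le> u"
  shows "set_integrable lborel {s<..u} (bessel_mean M R l (pe_gen l p))"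
    and "bessel_mean M R l p u - bessel_mean M R l p s = (LINT v:{s<..u}|lborel. bessel_mean M R l (pe_gen l p) v)"
proof -
  have i: "set_integrable lborel {0..u} (bessel_mean M R l (pe_gen l p))"
    by (rule borel_integrable_atLeastAtMost') (auto intro: continuous_on_subset[OF bessel_mean_continuous[OF R l]])
  show "set_integrable lborel {s<..u} (bessel_mean M R l (pe_gen l p))"
    by (rule set_integrable_subset[OF i]) (use s in auto)
  show "bessel_mean M R l p u - bessel_mean M R l p s = (LINT v:{s<..u}|lborel. bessel_mean M R l (pe_gen l p) v)"
    using set_integral_Icc_diff[OF s i] bessel_dynkin[OF R l, of u p] bessel_dynkin[OF R l, of s p] s by simp
qed

text \<open>
  Dynkin's formula, applied to the exponential and once more to its image under the generator.
\<close>

lemma bessel_laplace_increment: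
  assumes R: "hyperbolic_bessel_0 M R" and l: "0 < l" and s: "0 \<le> s" and h: "0 \<le> h"
  shows "\<bar>bessel_mean M R l 1 (s + h) - bessel_mean M R l 1 s - h * bessel_mean M R l (pe_gen l 1) s\<bar>
    \<le> 272 * (1 + l)\<^sup>2 * (h * h)"
proof -
  interpret prob_space M using R by (rule bessel_prob_space)
  let ?m = "bessel_mean M R l (pe_gen l 1)"
  let ?K = "272 * (1 + l)\<^sup>2"
  have m2: "\<bar>bessel_mean M R l (pe_gen l (pe_gen l 1)) u\<bar> \<le> ?K" if "0 \<le> u" for u
  proof -
    have "\<bar>\<integral>\<omega>. poly_exp l (pe_gen l (pe_gen l 1)) (cosh (R u \<omega>) - 1) \<partial>M\<bar> \<le> (\<integral>\<omega>. ?K \<partial>M)"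
    proof (rule abs_integral_le)
      have b: "\<bar>poly_exp l (pe_gen l (pe_gen l 1)) (cosh r - 1)\<bar> \<le> ?K" for r
        using l by (intro poly_exp_gen_gen_1_bound cosh_minus_one_nonneg) simp
      then show "\<bar>poly_exp l (pe_gen l (pe_gen l 1)) (cosh (R u \<omega>) - 1)\<bar> \<le> ?K" for \<omega> .
      show "integrable M (\<lambda>\<omega>. poly_exp l (pe_gen l (pe_gen l 1)) (cosh (R u \<omega>) - 1))"
        by (rule integrable_const_bound[where B="?K"])
          (use b measurable_compose[OF bessel_measurable[OF R that]
            borel_measurable_continuous_onI[OF continuous_poly_exp_cosh]] in auto)
    qed simp
    then show ?thesis
      by (simp add: bessel_mean_def prob_space)
  qed
  have m1: "\<bar>?m u - ?m s\<bar> \<le> ?K * h" if u: "s \<le> u" "u \<le> s + h" for u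
  proof -
    have "\<bar>?m u - ?m s\<bar> \<le> ?K * (u - s)"
      unfolding bessel_mean_increment(2)[OF R l s u(1)]
      by (rule set_integral_Ioc_bound[OF u(1) bessel_mean_increment(1)[OF R l s u(1)] m2]) (use s in auto)
    also have "\<dots> \<le> ?K * h"
      using u by (intro mult_left_mono) auto
    finally show ?thesis .
  qed
  have sh: "s \<le> s + h" using h by simp
  have c: "set_integrable lborel {s<..s + h} (\<lambda>u. ?m s)"
    using integrable_real_indicator[of "{s<..s + h}" lborel] h by (simp add: set_integrable_def)
  have i: "set_integrable lborel {s<..s + h} ?m"
    by (rule bessel_mean_increment(1)[OF R l s sh])
  have "(LINT u:{s<..s + h}|lborel. ?m s) = h * ?m s"
    using h by (simp add: set_lebesgue_integral_def)
  then have e: "bessel_mean M R l 1 (s + h) - bessel_mean M R l 1 s - h * ?m s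
      = (LINT u:{s<..s + h}|lborel. ?m u - ?m s)"
    unfolding bessel_mean_increment(2)[OF R l s sh] set_integral_diff(2)[OF i c] by simp
  have "\<bar>LINT u:{s<..s + h}|lborel. ?m u - ?m s\<bar> \<le> ?K * h * (s + h - s)"
    by (rule set_integral_Ioc_bound[OF sh set_integral_diff(1)[OF i c]]) (use m1 in auto)
  then show ?thesis
    unfolding e by simp
qed

lemma bessel_laplace_bounds:
  assumes R: "hyperbolic_bessel_0 M R" and l: "0 \<le> l" and s: "0 \<le> s"
  shows "0 \<le> bessel_mean M R l 1 s" "bessel_mean M R l 1 s \<le> 1"
proof -
  interpret prob_space M using R by (rule bessel_prob_space)
  have b: "exp (- (l * (cosh r - 1))) \<le> 1" for r
    using l cosh_minus_one_nonneg[of r] by simp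
  have "(\<lambda>\<omega>. poly_exp l 1 (cosh (R s \<omega>) - 1)) \<in> borel_measurable M"
    by (rule measurable_compose[OF bessel_measurable[OF R s]
        borel_measurable_continuous_onI[OF continuous_poly_exp_cosh]])
  then have "integrable M (\<lambda>\<omega>. poly_exp l 1 (cosh (R s \<omega>) - 1))"
    by (intro integrable_const_bound[where B=1]) (use b in auto)
  then have "(\<integral>\<omega>. poly_exp l 1 (cosh (R s \<omega>) - 1) \<partial>M) \<le> (\<integral>\<omega>. 1 \<partial>M)"
    by (intro integral_mono) (use b in auto)
  then show "bessel_mean M R l 1 s \<le> 1"
    by (simp add: bessel_mean_def prob_space)
  show "0 \<le> bessel_mean M R l 1 s"
    unfolding bessel_mean_def by (intro integral_nonneg_AE) auto
qed

lemma bessel_laplace_measurable: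
  assumes R: "hyperbolic_bessel_0 M R" and s: "0 \<le> s"
  shows "(\<lambda>l. bessel_mean M R l 1 s) \<in> borel_measurable borel"
proof -
  interpret prob_space M using R by (rule bessel_prob_space)
  have [measurable]: "(\<lambda>\<omega>. cosh (R s \<omega>)) \<in> borel_measurable M"
    by (rule measurable_compose[OF bessel_measurable[OF R s]])
      (auto intro!: borel_measurable_continuous_onI continuous_intros)
  show ?thesis
    unfolding bessel_mean_def poly_exp_1 by measurable
qed

text \<open>
  Both terms are \<open>1 + h L\<close>, applied to the exponential and averaged over the law of \<open>R s\<close>, up to
  order \<open>h^(3/2)\<close>: the first by Dynkin's formula, the second by the expansion of a chain step.
\<close>

lemma bessel_laplace_one_step:
  assumes R: "hyperbolic_bessel_0 M R" and l: "0 < l" and s: "0 \<le> s" and h: "0 < h" "h \<le> 1"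
  shows "\<bar>bessel_mean M R l 1 (s + h)
      - 1 / (1 + l * h) * (\<integral>x. normal_density 0 (sqrt h) x * bessel_mean M R (logistic_step h l x) 1 s \<partial>lborel)\<bar>
    \<le> 302 * (1 + l)\<^sup>2 * (h * sqrt h)"
proof -
  interpret prob_space M using R by (rule bessel_prob_space)
  interpret pair_sigma_finite lborel M ..
  let ?N = "normal_density 0 (sqrt h)"
  define Y where "Y \<omega> = cosh (R s \<omega>) - 1" for \<omega>
  have [measurable]: "Y \<in> borel_measurable M"
    unfolding Y_def[abs_def]
    by (rule measurable_compose[OF bessel_measurable[OF R s]])
      (auto intro!: borel_measurable_continuous_onI continuous_intros)
  have Y0: "0 \<le> Y \<omega>" for \<omega>
    unfolding Y_def by (rule cosh_minus_one_nonneg)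
  have step0: "0 \<le> logistic_step h l x" for x
    using l h by (simp add: logistic_step_def)
  have [measurable]: "logistic_step h l \<in> borel_measurable borel"
    unfolding logistic_step_def[abs_def] by measurable
  define \<phi> where "\<phi> x \<omega> = ?N x * exp (- (logistic_step h l x * Y \<omega>))" for x \<omega>
  have \<phi>m[measurable]: "(\<lambda>(x, \<omega>). \<phi> x \<omega>) \<in> borel_measurable (lborel \<Otimes>\<^sub>M M)"
    unfolding \<phi>_def by measurable
  have \<phi>b: "0 \<le> \<phi> x \<omega>" "\<phi> x \<omega> \<le> ?N x" for x \<omega>
    using step0[of x] Y0[of \<omega>] by (auto simp: \<phi>_def intro!: mult_right_le_one_le)
  have s': "0 < sqrt h" using h by simp
  have i2: "integrable M (\<phi> x)" for x
    by (rule integrable_const_bound[where B="?N x"]) (use \<phi>b in \<open>auto simp: \<phi>_def\<close>)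
  have int: "integrable (lborel \<Otimes>\<^sub>M M) (\<lambda>(x, \<omega>). \<phi> x \<omega>)"
  proof (rule Fubini_integrable)
    show "(\<lambda>(x, \<omega>). \<phi> x \<omega>) \<in> borel_measurable (lborel \<Otimes>\<^sub>M M)" by (rule \<phi>m)
    show "AE x in lborel. integrable M (\<lambda>\<omega>. case (x, \<omega>) of (x, \<omega>) \<Rightarrow> \<phi> x \<omega>)"
      using i2 by simp
    show "integrable lborel (\<lambda>x. \<integral>\<omega>. norm (case (x, \<omega>) of (x, \<omega>) \<Rightarrow> \<phi> x \<omega>) \<partial>M)"
    proof (rule Bochner_Integration.integrable_bound)
      show "integrable lborel ?N" using s' by simp
      show "AE x in lborel. norm (\<integral>\<omega>. norm (case (x, \<omega>) of (x, \<omega>) \<Rightarrow> \<phi> x \<omega>) \<partial>M) \<le> norm (?N x)"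
      proof (intro AE_I2)
        fix x
        have "(\<integral>\<omega>. \<phi> x \<omega> \<partial>M) \<le> (\<integral>\<omega>. ?N x \<partial>M)"
          by (intro integral_mono i2) (use \<phi>b in auto)
        moreover have "0 \<le> (\<integral>\<omega>. \<phi> x \<omega> \<partial>M)"
          by (intro integral_nonneg_AE) (use \<phi>b in auto)
        ultimately show "norm (\<integral>\<omega>. norm (case (x, \<omega>) of (x, \<omega>) \<Rightarrow> \<phi> x \<omega>) \<partial>M) \<le> norm (?N x)"
          using \<phi>b by (simp add: prob_space)
      qed
    qed measurable
  qed
  have fub: "(\<integral>x. ?N x * bessel_mean M R (logistic_step h l x) 1 s \<partial>lborel)
      = (\<integral>\<omega>. (\<integral>x. \<phi> x \<omega> \<partial>lborel) \<partial>M)"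
  proof -
    have "(\<integral>\<omega>. (\<integral>x. \<phi> x \<omega> \<partial>lborel) \<partial>M) = (\<integral>x. (\<integral>\<omega>. \<phi> x \<omega> \<partial>M) \<partial>lborel)"
      by (rule Fubini_integral[OF int])
    then show ?thesis
      by (simp add: \<phi>_def bessel_mean_def Y_def)
  qed
  have i\<phi>: "integrable M (\<lambda>\<omega>. \<integral>x. \<phi> x \<omega> \<partial>lborel)"
    using integrable_snd[OF int] .
  have iY: "integrable M (\<lambda>\<omega>. poly_exp l p (Y \<omega>))" for p
  proof -
    obtain C where "\<And>r. \<bar>poly_exp l p (cosh r - 1)\<bar> \<le> C"
      using poly_exp_cosh_bounded[OF l] by blast
    moreover have "(\<lambda>\<omega>. poly_exp l p (Y \<omega>)) \<in> borel_measurable M"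
      unfolding Y_def by (rule measurable_compose[OF bessel_measurable[OF R s]
        borel_measurable_continuous_onI[OF continuous_poly_exp_cosh]])
    ultimately show ?thesis
      by (intro integrable_const_bound[where B=C]) (auto simp: Y_def)
  qed
  define P where "P \<omega> = 1 / (1 + l * h) * (\<integral>x. \<phi> x \<omega> \<partial>lborel)" for \<omega>
  have iP: "integrable M P"
    unfolding P_def[abs_def] using i\<phi> by (rule integrable_mult_right)
  have "\<bar>\<integral>\<omega>. P \<omega> - poly_exp l 1 (Y \<omega>) - h * poly_exp l (pe_gen l 1) (Y \<omega>) \<partial>M\<bar>
      \<le> (\<integral>\<omega>. 30 * (1 + l)\<^sup>2 * (h * sqrt h) \<partial>M)"
  proof (rule abs_integral_le)
    show "integrable M (\<lambda>\<omega>. P \<omega> - poly_exp l 1 (Y \<omega>) - h * poly_exp l (pe_gen l 1) (Y \<omega>))"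
      by (intro Bochner_Integration.integrable_diff integrable_mult_right iP iY)
    show "\<bar>P \<omega> - poly_exp l 1 (Y \<omega>) - h * poly_exp l (pe_gen l 1) (Y \<omega>)\<bar> \<le> 30 * (1 + l)\<^sup>2 * (h * sqrt h)" for \<omega>
      using logistic_step_expansion[OF h less_imp_le[OF l] Y0, of \<omega>] unfolding P_def \<phi>_def poly_exp_1 .
  qed simp
  moreover have "(\<integral>\<omega>. P \<omega> - poly_exp l 1 (Y \<omega>) - h * poly_exp l (pe_gen l 1) (Y \<omega>) \<partial>M)
      = (\<integral>\<omega>. P \<omega> \<partial>M) - bessel_mean M R l 1 s - h * bessel_mean M R l (pe_gen l 1) s"
    using iP iY[of 1] iY[of "pe_gen l 1"] by (simp add: bessel_mean_def Y_def)
  moreover have "(\<integral>\<omega>. P \<omega> \<partial>M) = 1 / (1 + l * h) * (\<integral>x. ?N x * bessel_mean M R (logistic_step h l x) 1 s \<partial>lborel)"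
    unfolding P_def fub by (rule integral_mult_right_zero)
  ultimately have 1: "\<bar>1 / (1 + l * h) * (\<integral>x. ?N x * bessel_mean M R (logistic_step h l x) 1 s \<partial>lborel)
      - bessel_mean M R l 1 s - h * bessel_mean M R l (pe_gen l 1) s\<bar> \<le> 30 * (1 + l)\<^sup>2 * (h * sqrt h)"
    by (simp add: prob_space)
  have "h * h \<le> h * sqrt h"
    using h by (intro mult_left_mono) (auto intro!: real_le_rsqrt simp: power2_eq_square mult_le_one)
  then have "272 * (1 + l)\<^sup>2 * (h * h) \<le> 272 * (1 + l)\<^sup>2 * (h * sqrt h)"
    by (rule mult_left_mono) simp
  with bessel_laplace_increment[OF R l s less_imp_le[OF h(1)]]
  have 2: "\<bar>bessel_mean M R l 1 (s + h) - bessel_mean M R l 1 s - h * bessel_mean M R l (pe_gen l 1) s\<bar>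
      \<le> 272 * (1 + l)\<^sup>2 * (h * sqrt h)"
    by (rule order_trans)
  have triangle: "\<bar>a - b\<bar> \<le> x + y" if "\<bar>b - c - d\<bar> \<le> x" "\<bar>a - c - d\<bar> \<le> y" for a b c d x y :: real
    using that by linarith
  from triangle[OF 1 2] show ?thesis
    by (simp add: algebra_simps)
qed

section \<open>The logistic chain driven by a Brownian motion\<close>

text \<open>
  The driving walk \<open>b_u + u / 2\<close> at the times \<open>k * h\<close>, where the increments of the standard
  Brownian motion \<open>b\<close> are written as \<open>2 * x j\<close> in view of \<open>b_u = 2 B_{u/4}\<close>.
\<close>

definition log_walk :: "real \<Rightarrow> (nat \<Rightarrow> real) \<Rightarrow> nat \<Rightarrow> real" where
  "log_walk h x k = (\<Sum>j<k. 2 * x j + h / 2)"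

text \<open>
  The probability of surviving the first \<open>k\<close> steps, given the walk.  The explicit solution of the
  logistic equation carries over to the chain, with the integral replaced by a Riemann sum.
\<close>

definition chain_killing :: "real \<Rightarrow> real \<Rightarrow> (nat \<Rightarrow> real) \<Rightarrow> nat \<Rightarrow> real" where
  "chain_killing h l x k = 1 / (1 + l * h * (\<Sum>j<k. exp (log_walk h x j)))"

definition chain_state :: "real \<Rightarrow> real \<Rightarrow> (nat \<Rightarrow> real) \<Rightarrow> nat \<Rightarrow> real" where
  "chain_state h l x k = l * exp (log_walk h x k) * chain_killing h l x k"

lemma chain_denominator_pos:
  assumes "0 < l" "0 < h"
  shows "0 < 1 + l * h * (\<Sum>j<k. exp (log_walk h x j))"
  using assms by (intro add_pos_nonneg mult_nonneg_nonneg sum_nonneg) auto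

lemma chain_killing_bounds:
  assumes "0 < l" "0 < h"
  shows "0 < chain_killing h l x k" "chain_killing h l x k \<le> 1"
proof -
  have "0 \<le> l * h * (\<Sum>j<k. exp (log_walk h x j))"
    using assms by (intro mult_nonneg_nonneg sum_nonneg) auto
  then show "0 < chain_killing h l x k" "chain_killing h l x k \<le> 1"
    by (auto simp: chain_killing_def)
qed

lemma chain_state_bounds:
  assumes "0 < l" "0 < h"
  shows "0 < chain_state h l x k" "chain_state h l x k \<le> l * exp (log_walk h x k)"
  using chain_killing_bounds[OF assms, of x k] assms(1)
  by (auto simp: chain_state_def intro!: mult_left_le)

lemma chain_killing_Suc:
  assumes "0 < l" "0 < h"
  shows "chain_killing h l x (Suc k) = chain_killing h l x k * (1 / (1 + chain_state h l x k * h))"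
proof -
  define d where "d = 1 + l * h * (\<Sum>j<k. exp (log_walk h x j))"
  have d: "0 < d" unfolding d_def by (rule chain_denominator_pos[OF assms])
  have "0 \<le> l * exp (log_walk h x k) * h" using assms by simp
  then have "0 < d + l * exp (log_walk h x k) * h" using d by linarith
  then show ?thesis
    using d unfolding chain_state_def chain_killing_def sum.lessThan_Suc distrib_left add.assoc[symmetric] d_def[symmetric]
    by (simp add: field_simps)
qed

lemma chain_state_Suc:
  assumes "0 < l" "0 < h"
  shows "chain_state h l x (Suc k) = logistic_step h (chain_state h l x k) (2 * x k)"
proof -
  have "exp (log_walk h x (Suc k)) = exp (log_walk h x k) * exp (2 * x k + h / 2)"
    by (simp add: log_walk_def exp_add)
  then show ?thesis
    unfolding chain_state_def[of h l x "Suc k"] chain_killing_Suc[OF assms] logistic_step_def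
    by (simp add: chain_state_def)
qed

lemma log_walk_cong: "(\<And>j. j < k \<Longrightarrow> x j = y j) \<Longrightarrow> log_walk h x k = log_walk h y k"
  by (simp add: log_walk_def)

lemma chain_killing_cong:
  assumes "\<And>j. j < k \<Longrightarrow> x j = y j"
  shows "chain_killing h l x k = chain_killing h l y k"
proof -
  have "log_walk h x j = log_walk h y j" if "j < k" for j
    using that assms by (intro log_walk_cong) auto
  then show ?thesis
    by (simp add: chain_killing_def)
qed

lemma chain_state_cong:
  assumes "\<And>j. j < k \<Longrightarrow> x j = y j"
  shows "chain_state h l x k = chain_state h l y k"
  unfolding chain_state_def using chain_killing_cong[OF assms] log_walk_cong[OF assms] by simp

lemma chain_measurable:
  fixes X :: "nat \<Rightarrow> 'a \<Rightarrow> real"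
  assumes X: "\<And>j. j < k \<Longrightarrow> X j \<in> borel_measurable S"
  shows "(\<lambda>\<omega>. log_walk h (\<lambda>j. X j \<omega>) k) \<in> borel_measurable S"
    and "(\<lambda>\<omega>. chain_killing h l (\<lambda>j. X j \<omega>) k) \<in> borel_measurable S"
    and "(\<lambda>\<omega>. chain_state h l (\<lambda>j. X j \<omega>) k) \<in> borel_measurable S"
proof -
  have w: "(\<lambda>\<omega>. log_walk h (\<lambda>j. X j \<omega>) i) \<in> borel_measurable S" if "i \<le> k" for i
    unfolding log_walk_def using that X
    by (intro borel_measurable_sum borel_measurable_add borel_measurable_times borel_measurable_const) auto
  show w': "(\<lambda>\<omega>. log_walk h (\<lambda>j. X j \<omega>) k) \<in> borel_measurable S"
    by (rule w) simp
  show k: "(\<lambda>\<omega>. chain_killing h l (\<lambda>j. X j \<omega>) k) \<in> borel_measurable S"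
    unfolding chain_killing_def using w
    by (intro borel_measurable_divide borel_measurable_add borel_measurable_times borel_measurable_const
        borel_measurable_sum borel_measurable_exp) auto
  show "(\<lambda>\<omega>. chain_state h l (\<lambda>j. X j \<omega>) k) \<in> borel_measurable S"
    unfolding chain_state_def
    by (intro borel_measurable_times borel_measurable_const measurable_compose[OF w' borel_measurable_exp] k)
qed

text \<open>
  Completing the square.
\<close>

lemma normal_exponential_moment:
  assumes s: "0 < \<sigma>"
  shows "has_bochner_integral lborel (\<lambda>x. normal_density 0 \<sigma> x * exp (c * x)) (exp (c\<^sup>2 * \<sigma>\<^sup>2 / 2))"
proof -
  have "normal_density 0 \<sigma> x * exp (c * x) = exp (c\<^sup>2 * \<sigma>\<^sup>2 / 2) * normal_density (c * \<sigma>\<^sup>2) \<sigma> x" for x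
  proof -
    have "- (x - 0)\<^sup>2 / (2 * \<sigma>\<^sup>2) + c * x = c\<^sup>2 * \<sigma>\<^sup>2 / 2 + - (x - c * \<sigma>\<^sup>2)\<^sup>2 / (2 * \<sigma>\<^sup>2)"
      using s by (simp add: field_simps power2_eq_square)
    then have "exp (- (x - 0)\<^sup>2 / (2 * \<sigma>\<^sup>2)) * exp (c * x)
        = exp (c\<^sup>2 * \<sigma>\<^sup>2 / 2) * exp (- (x - c * \<sigma>\<^sup>2)\<^sup>2 / (2 * \<sigma>\<^sup>2))"
      by (simp only: exp_add[symmetric])
    then show ?thesis
      by (simp add: normal_density_def)
  qed
  moreover have "has_bochner_integral lborel (\<lambda>x. exp (c\<^sup>2 * \<sigma>\<^sup>2 / 2) * normal_density (c * \<sigma>\<^sup>2) \<sigma> x)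
      (exp (c\<^sup>2 * \<sigma>\<^sup>2 / 2) * 1)"
    using s by (intro has_bochner_integral_mult_right) (simp add: has_bochner_integral_iff)
  ultimately show ?thesis
    by simp
qed

context brownian_motion
begin

lemma exponential_moment:
  assumes u: "0 \<le> u"
  shows "integrable M (\<lambda>\<omega>. exp (c * B u \<omega>))" "expectation (\<lambda>\<omega>. exp (c * B u \<omega>)) = exp (c\<^sup>2 * u / 2)"
proof -
  have "integrable M (\<lambda>\<omega>. exp (c * B u \<omega>)) \<and> expectation (\<lambda>\<omega>. exp (c * B u \<omega>)) = exp (c\<^sup>2 * u / 2)"
  proof (cases "u = 0")
    case True
    have "integrable M (\<lambda>\<omega>. exp (c * B u \<omega>)) \<longleftrightarrow> integrable M (\<lambda>\<omega>. 1::real)"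
      by (rule Bochner_Integration.integrable_cong) (auto simp: True start_zero)
    moreover have "expectation (\<lambda>\<omega>. exp (c * B u \<omega>)) = expectation (\<lambda>\<omega>. 1)"
      by (rule Bochner_Integration.integral_cong) (auto simp: True start_zero)
    ultimately show ?thesis
      using True by (simp add: prob_space)
  next
    case False
    then have u: "0 < u" using u by simp
    have D: "distributed M lborel (\<lambda>\<omega>. B u \<omega> - B 0 \<omega>) (\<lambda>x. ennreal (normal_density 0 (sqrt u) x))"
      using gaussian_increments[of 0 u] u by simp
    have hb: "has_bochner_integral lborel (\<lambda>x. normal_density 0 (sqrt u) x * exp (c * x)) (exp (c\<^sup>2 * u / 2))"
      using normal_exponential_moment[of "sqrt u" c] u by simp
    have 1: "integrable M (\<lambda>\<omega>. exp (c * (B u \<omega> - B 0 \<omega>)))"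
      using distributed_integrable[OF D, of "\<lambda>x. exp (c * x)"] hb by (simp add: has_bochner_integral_iff)
    have 2: "expectation (\<lambda>\<omega>. exp (c * (B u \<omega> - B 0 \<omega>))) = exp (c\<^sup>2 * u / 2)"
      using distributed_integral[OF D, of "\<lambda>x. exp (c * x)"] hb by (simp add: has_bochner_integral_iff)
    have "integrable M (\<lambda>\<omega>. exp (c * B u \<omega>)) \<longleftrightarrow> integrable M (\<lambda>\<omega>. exp (c * (B u \<omega> - B 0 \<omega>)))"
      by (rule Bochner_Integration.integrable_cong) (auto simp: start_zero)
    moreover have "expectation (\<lambda>\<omega>. exp (c * B u \<omega>)) = expectation (\<lambda>\<omega>. exp (c * (B u \<omega> - B 0 \<omega>)))"
      by (rule Bochner_Integration.integral_cong) (auto simp: start_zero)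
    ultimately show ?thesis
      using 1 2 by simp
  qed
  then show "integrable M (\<lambda>\<omega>. exp (c * B u \<omega>))" "expectation (\<lambda>\<omega>. exp (c * B u \<omega>)) = exp (c\<^sup>2 * u / 2)"
    by auto
qed

definition increments :: "real \<Rightarrow> nat \<Rightarrow> 'a \<Rightarrow> nat \<Rightarrow> real" where
  "increments t n \<omega> j = B (grid t n (Suc j)) \<omega> - B (grid t n j) \<omega>"

lemma increments_measurable: "0 \<le> t \<Longrightarrow> (\<lambda>\<omega>. increments t n \<omega> j) \<in> borel_measurable M"
  unfolding increments_def by (intro borel_measurable_diff measurable_B grid_nonneg)

lemma log_walk_increments:
  assumes \<omega>: "\<omega> \<in> space M"
  shows "log_walk (4 * t / real n) (increments t n \<omega>) k = 2 * (B (grid t n k) \<omega> + grid t n k)"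
proof -
  have "(\<Sum>j<k. increments t n \<omega> j) = B (grid t n k) \<omega> - B (grid t n 0) \<omega>"
    unfolding increments_def by (rule sum_lessThan_telescope)
  moreover have "log_walk (4 * t / real n) (increments t n \<omega>) k
      = 2 * (\<Sum>j<k. increments t n \<omega> j) + real k * (2 * t / real n)"
    by (simp add: log_walk_def sum.distrib sum_distrib_left)
  ultimately show ?thesis
    using start_zero[OF \<omega>] by (simp add: grid_def)
qed

lemma indep_increments:
  assumes t: "0 \<le> t" and k: "k < n"
  shows "indep_var (PiM {..<k} (\<lambda>_. borel)) (\<lambda>\<omega>. restrict (increments t n \<omega>) {..<k})
    (PiM {k} (\<lambda>_. borel)) (\<lambda>\<omega>. restrict (increments t n \<omega>) {k})"
proof -
  have "indep_vars (\<lambda>_. borel) (\<lambda>i \<omega>. B (grid t n (Suc i)) \<omega> - B (grid t n i) \<omega>) {..<n}"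
    using t by (intro independent_increments) (auto intro: grid_mono)
  from indep_var_restrict[OF this, of "{..<k}" "{k}"] k show ?thesis
    by (simp add: increments_def[abs_def])
qed

lemma increments_distributed:
  assumes t: "0 < t" and n: "0 < n"
  shows "distributed M lborel (\<lambda>\<omega>. 2 * increments t n \<omega> k) (\<lambda>x. ennreal (normal_density 0 (sqrt (4 * t / real n)) x))"
proof -
  have lt: "grid t n k < grid t n (Suc k)" using t n by (simp add: grid_Suc)
  have "distributed M lborel (\<lambda>\<omega>. increments t n \<omega> k) (normal_density 0 (sqrt (t / real n)))"
    using gaussian_increments[OF grid_nonneg[OF less_imp_le[OF t]] lt] by (simp add: increments_def grid_Suc)
  from normal_density_affine[OF this, of 2 0]
  have "distributed M lborel (\<lambda>\<omega>. 2 * increments t n \<omega> k) (normal_density 0 (2 * sqrt (t / real n)))"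
    using t n by simp
  moreover have "2 * sqrt (t / real n) = sqrt (4 * t / real n)"
    using real_sqrt_mult[of 4 "t / real n"] by simp
  ultimately show ?thesis
    by simp
qed

text \<open>
  One term of the interpolation between the two sides of the duality: a step of the chain is
  traded for a time step of \<open>R\<close>.  Given the past, only the last increment is averaged, and the
  one-step estimate applies with the current state in place of \<open>l\<close>.  Its growth in the state is
  harmless since the state is at most \<open>l * exp (log_walk h x k)\<close>, which has bounded second moment.
\<close>

lemma chain_expectation_step:
  fixes R :: "real \<Rightarrow> 'b \<Rightarrow> real" and M' :: "'b measure"
  assumes R: "hyperbolic_bessel_0 M' R" and l: "0 < l" and t: "0 < t" and k: "k < n"
    and s: "0 \<le> s" and h: "h = 4 * t / real n" "h \<le> 1"
  shows "\<bar>expectation (\<lambda>\<omega>. chain_killing h l (increments t n \<omega>) k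
        * bessel_mean M' R (chain_state h l (increments t n \<omega>) k) 1 (s + h))
      - expectation (\<lambda>\<omega>. chain_killing h l (increments t n \<omega>) (Suc k)
        * bessel_mean M' R (chain_state h l (increments t n \<omega>) (Suc k)) 1 s)\<bar>
    \<le> 604 * (1 + l\<^sup>2 * exp (12 * t)) * (h * sqrt h)"
proof -
  define \<xi> where "\<xi> = increments t n"
  have n: "0 < n" using k by simp
  have h0: "0 < h" using h t n by simp
  let ?\<psi> = "\<lambda>u l. bessel_mean M' R l 1 u"
  have \<psi>m[measurable]: "?\<psi> u \<in> borel_measurable borel" if "0 \<le> u" for u
    using bessel_laplace_measurable[OF R that] .
  have \<psi>b: "\<bar>?\<psi> u m\<bar> \<le> 1" if "0 \<le> u" "0 < m" for u m
    using bessel_laplace_bounds[OF R _ that(1), of m] that by simp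
  let ?S = "PiM {..<k} (\<lambda>_. borel :: real measure)"
  define X where "X \<omega> = restrict (\<xi> \<omega>) {..<k}" for \<omega>
  define Z where "Z \<omega> = restrict (\<xi> \<omega>) {k}" for \<omega>
  define \<pi> where "\<pi> z = 2 * z k" for z :: "nat \<Rightarrow> real"
  have \<pi>Z: "\<pi> (Z \<omega>) = 2 * \<xi> \<omega> k" for \<omega> by (simp add: \<pi>_def Z_def)
  define D where "D x = chain_killing h l x k" for x
  define L where "L x = chain_state h l x k" for x
  have DX: "D (X \<omega>) = D (\<xi> \<omega>)" and LX: "L (X \<omega>) = L (\<xi> \<omega>)"
    and WX: "log_walk h (X \<omega>) k = log_walk h (\<xi> \<omega>) k" for \<omega>
    unfolding D_def L_def X_def
    by (auto intro!: chain_killing_cong chain_state_cong log_walk_cong)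
  have D: "0 < D x" "D x \<le> 1" and L: "0 < L x" "L x \<le> l * exp (log_walk h x k)" for x
    unfolding D_def L_def using chain_killing_bounds[OF l h0] chain_state_bounds[OF l h0] by auto
  have comp: "(\<lambda>x. x j) \<in> borel_measurable ?S" if "j < k" for j
    using that by (intro measurable_component_singleton) auto
  have Sm[measurable]: "D \<in> borel_measurable ?S" "L \<in> borel_measurable ?S" "(\<lambda>x. log_walk h x k) \<in> borel_measurable ?S"
    unfolding D_def L_def using chain_measurable[of k "\<lambda>j x. x j" ?S, OF comp] by auto
  define \<phi> where "\<phi> x y = D x * ?\<psi> (s + h) (L x)
      - D x * (1 / (1 + L x * h)) * ?\<psi> s (logistic_step h (L x) y)" for x y
  have step_pos: "0 < logistic_step h (L x) y" for x y
    using L[of x] h0 by (simp add: logistic_step_def add_pos_pos)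
  have fr: "\<bar>1 / (1 + L x * h)\<bar> \<le> 1" for x
    using L(1)[of x] h0 by (simp add: abs_of_pos add_pos_pos)
  have t1: "\<bar>D x * ?\<psi> (s + h) (L x)\<bar> \<le> 1" for x
    unfolding abs_mult using D[of x] \<psi>b[of "s + h" "L x"] L(1) s h0 by (intro mult_le_one) auto
  have t2: "\<bar>D x * (1 / (1 + L x * h)) * ?\<psi> s (logistic_step h (L x) y)\<bar> \<le> 1" for x y
    unfolding abs_mult
    using D[of x] fr[of x] \<psi>b[OF s step_pos[of x y]] by (intro mult_le_one) (auto simp: mult_nonneg_nonneg)
  have \<phi>m: "(\<lambda>(x, y). \<phi> x y) \<in> borel_measurable (?S \<Otimes>\<^sub>M borel)"
  proof -
    have fL: "(\<lambda>z. L (fst z)) \<in> borel_measurable (?S \<Otimes>\<^sub>M borel)"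
      by (rule measurable_compose[OF measurable_fst Sm(2)])
    have fD: "(\<lambda>z. D (fst z)) \<in> borel_measurable (?S \<Otimes>\<^sub>M borel)"
      by (rule measurable_compose[OF measurable_fst Sm(1)])
    have y: "(\<lambda>z. snd z :: real) \<in> borel_measurable (?S \<Otimes>\<^sub>M borel)"
      by (rule measurable_snd)
    have st: "(\<lambda>z. logistic_step h (L (fst z)) (snd z)) \<in> borel_measurable (?S \<Otimes>\<^sub>M borel)"
      unfolding logistic_step_def
      by (intro borel_measurable_divide borel_measurable_times borel_measurable_add borel_measurable_const fL y
          measurable_compose[OF borel_measurable_add[OF y borel_measurable_const] borel_measurable_exp])
    have sh: "0 \<le> s + h" using s h0 by simp
    show ?thesis
      unfolding \<phi>_def case_prod_beta'
      by (intro borel_measurable_diff borel_measurable_times borel_measurable_divide borel_measurable_add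
          borel_measurable_const fL fD measurable_compose[OF fL \<psi>m[OF sh]] measurable_compose[OF st \<psi>m[OF s]])
  qed
  have Xm: "X \<in> M \<rightarrow>\<^sub>M ?S"
    using indep_var_rv1[OF indep_increments[OF less_imp_le[OF t] k]] by (simp add: X_def[abs_def] \<xi>_def)
  have \<xi>m: "(\<lambda>\<omega>. \<xi> \<omega> j) \<in> borel_measurable M" for j
    unfolding \<xi>_def using t by (intro increments_measurable) simp
  have m1: "(\<lambda>\<omega>. D (\<xi> \<omega>) * ?\<psi> (s + h) (L (\<xi> \<omega>))) \<in> borel_measurable M"
  proof -
    have "(\<lambda>\<omega>. D (X \<omega>) * ?\<psi> (s + h) (L (X \<omega>))) \<in> borel_measurable M"
      using s h0 by (intro borel_measurable_times measurable_compose[OF Xm Sm(1)]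
          measurable_compose[OF measurable_compose[OF Xm Sm(2)] \<psi>m]) simp
    then show ?thesis by (simp add: DX LX)
  qed
  have \<phi>M: "(\<lambda>\<omega>. \<phi> (X \<omega>) (\<pi> (Z \<omega>))) \<in> borel_measurable M"
  proof -
    have "(\<lambda>\<omega>. (X \<omega>, \<pi> (Z \<omega>))) \<in> M \<rightarrow>\<^sub>M ?S \<Otimes>\<^sub>M borel"
      unfolding \<pi>Z using Xm \<xi>m by measurable
    from measurable_compose[OF this \<phi>m] show ?thesis by simp
  qed
  have next_eq: "D (\<xi> \<omega>) * (1 / (1 + L (\<xi> \<omega>) * h)) * ?\<psi> s (logistic_step h (L (\<xi> \<omega>)) (2 * \<xi> \<omega> k))
      = chain_killing h l (\<xi> \<omega>) (Suc k) * ?\<psi> s (chain_state h l (\<xi> \<omega>) (Suc k))" for \<omega>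
    unfolding D_def L_def chain_killing_Suc[OF l h0] chain_state_Suc[OF l h0] ..
  have i1: "integrable M (\<lambda>\<omega>. D (\<xi> \<omega>) * ?\<psi> (s + h) (L (\<xi> \<omega>)))"
    by (rule integrable_const_bound[where B=1]) (use t1 m1 in auto)
  have \<phi>int: "integrable M (\<lambda>\<omega>. \<phi> (X \<omega>) (\<pi> (Z \<omega>)))"
  proof (rule integrable_const_bound[where B=2])
    have "\<bar>\<phi> x y\<bar> \<le> 2" for x y
      using t1[of x] t2[of x y] unfolding \<phi>_def by linarith
    then show "AE \<omega> in M. norm (\<phi> (X \<omega>) (\<pi> (Z \<omega>))) \<le> 2" by simp
  qed (rule \<phi>M)
  have \<phi>X: "\<phi> (X \<omega>) (\<pi> (Z \<omega>)) = D (\<xi> \<omega>) * ?\<psi> (s + h) (L (\<xi> \<omega>))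
      - chain_killing h l (\<xi> \<omega>) (Suc k) * ?\<psi> s (chain_state h l (\<xi> \<omega>) (Suc k))" for \<omega>
    unfolding next_eq[symmetric] \<phi>_def \<pi>Z DX LX ..
  have i2: "integrable M (\<lambda>\<omega>. chain_killing h l (\<xi> \<omega>) (Suc k) * ?\<psi> s (chain_state h l (\<xi> \<omega>) (Suc k)))"
    using Bochner_Integration.integrable_diff[OF i1 \<phi>int] unfolding \<phi>X by simp
  define g where "g x = 302 * (h * sqrt h) * (1 + l * exp (log_walk h x k))\<^sup>2" for x
  have gb: "g x \<le> 604 * (h * sqrt h) * (1 + l\<^sup>2 * exp (2 * log_walk h x k))" for x
  proof -
    have "(1 + a)\<^sup>2 \<le> 2 * (1 + a\<^sup>2)" for a :: real
      using zero_le_power2[of "1 - a"] by (simp add: power2_eq_square algebra_simps)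
    from this[of "l * exp (log_walk h x k)"]
    have "(1 + l * exp (log_walk h x k))\<^sup>2 \<le> 2 * (1 + l\<^sup>2 * exp (2 * log_walk h x k))"
      by (simp add: power_mult_distrib exp_double)
    then have "302 * (h * sqrt h) * (1 + l * exp (log_walk h x k))\<^sup>2
        \<le> 302 * (h * sqrt h) * (2 * (1 + l\<^sup>2 * exp (2 * log_walk h x k)))"
      by (rule mult_left_mono) (use h0 in simp)
    then show ?thesis
      unfolding g_def by (simp add: algebra_simps)
  qed
  have gm: "g \<in> borel_measurable ?S"
    unfolding g_def[abs_def] by measurable
  have u: "0 \<le> grid t n k" using t by (simp add: grid_nonneg)
  define c where "c = 604 * (h * sqrt h)"
  have c0: "0 \<le> c" unfolding c_def using h0 by simp
  have walk: "exp (2 * log_walk h (X \<omega>) k) = exp (4 * grid t n k) * exp (4 * B (grid t n k) \<omega>)"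
    if "\<omega> \<in> space M" for \<omega>
    unfolding WX unfolding \<xi>_def h(1) log_walk_increments[OF that] by (simp add: exp_add[symmetric] algebra_simps)
  have iB: "integrable M (\<lambda>\<omega>. c * (1 + l\<^sup>2 * (exp (4 * grid t n k) * exp (4 * B (grid t n k) \<omega>))))"
    by (intro integrable_mult_right Bochner_Integration.integrable_add integrable_const exponential_moment u)
  have gX: "g (X \<omega>) \<le> c * (1 + l\<^sup>2 * (exp (4 * grid t n k) * exp (4 * B (grid t n k) \<omega>)))"
    if "\<omega> \<in> space M" for \<omega>
    using gb[of "X \<omega>"] unfolding walk[OF that] c_def .
  have g0: "0 \<le> g x" for x unfolding g_def using h0 by simp
  have gint: "integrable M (\<lambda>\<omega>. g (X \<omega>))"
  proof (rule Bochner_Integration.integrable_bound[OF iB])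
    show "(\<lambda>\<omega>. g (X \<omega>)) \<in> borel_measurable M"
      using measurable_compose[OF Xm gm] .
    show "AE \<omega> in M. norm (g (X \<omega>)) \<le> norm (c * (1 + l\<^sup>2 * (exp (4 * grid t n k) * exp (4 * B (grid t n k) \<omega>))))"
    proof (rule AE_I2)
      fix \<omega> assume "\<omega> \<in> space M"
      from gX[OF this] g0[of "X \<omega>"]
      show "norm (g (X \<omega>)) \<le> norm (c * (1 + l\<^sup>2 * (exp (4 * grid t n k) * exp (4 * B (grid t n k) \<omega>))))"
        by simp
    qed
  qed
  have dist: "distributed M lborel (\<lambda>\<omega>. \<pi> (Z \<omega>)) (\<lambda>x. ennreal (normal_density 0 (sqrt h) x))"
    unfolding \<pi>Z \<xi>_def h(1) using t n by (rule increments_distributed)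
  have "\<bar>expectation (\<lambda>\<omega>. \<phi> (X \<omega>) (\<pi> (Z \<omega>)))\<bar> \<le> expectation (\<lambda>\<omega>. g (X \<omega>))"
  proof (rule indep_expectation_bound[where T="PiM {k} (\<lambda>_. borel)" and \<pi>=\<pi> and \<rho>="normal_density 0 (sqrt h)"])
    show "indep_var ?S X (PiM {k} (\<lambda>_. borel)) Z"
      using indep_increments[OF less_imp_le[OF t] k] by (simp add: X_def[abs_def] Z_def[abs_def] \<xi>_def)
    show "\<pi> \<in> borel_measurable (PiM {k} (\<lambda>_. borel))"
      unfolding \<pi>_def[abs_def]
      by (intro borel_measurable_times borel_measurable_const measurable_component_singleton) auto
    fix x
    let ?N = "normal_density 0 (sqrt h)"
    have sq: "0 < sqrt h" using h0 by simp
    have im: "(\<lambda>y. ?\<psi> s (logistic_step h (L x) y)) \<in> borel_measurable lborel"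
      unfolding logistic_step_def using \<psi>m[OF s] by measurable
    have iN: "integrable lborel (\<lambda>y. ?N y * ?\<psi> s (logistic_step h (L x) y))"
    proof (rule Bochner_Integration.integrable_bound)
      show "integrable lborel ?N" using sq by simp
      show "AE y in lborel. norm (?N y * ?\<psi> s (logistic_step h (L x) y)) \<le> norm (?N y)"
        using \<psi>b[OF s step_pos] by (auto simp: abs_mult intro!: mult_right_le_one_le)
    qed (use im in measurable)
    have "(\<integral>y. ?N y * \<phi> x y \<partial>lborel)
        = (\<integral>y. (D x * ?\<psi> (s + h) (L x)) * ?N y - D x * (1 / (1 + L x * h)) * (?N y * ?\<psi> s (logistic_step h (L x) y)) \<partial>lborel)"
      by (intro Bochner_Integration.integral_cong refl) (simp add: \<phi>_def algebra_simps)
    also have "\<dots> = (\<integral>y. (D x * ?\<psi> (s + h) (L x)) * ?N y \<partial>lborel)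
        - (\<integral>y. D x * (1 / (1 + L x * h)) * (?N y * ?\<psi> s (logistic_step h (L x) y)) \<partial>lborel)"
      by (intro Bochner_Integration.integral_diff integrable_mult_right iN) (use sq in simp)
    also have "\<dots> = D x * ?\<psi> (s + h) (L x) - D x * (1 / (1 + L x * h)) * (\<integral>y. ?N y * ?\<psi> s (logistic_step h (L x) y) \<partial>lborel)"
      using sq by (simp only: integral_mult_right_zero integral_normal_density mult_1_right)
    also have "\<dots> = D x * (?\<psi> (s + h) (L x) - 1 / (1 + L x * h) * (\<integral>y. ?N y * ?\<psi> s (logistic_step h (L x) y) \<partial>lborel))"
      by (simp add: right_diff_distrib)
    finally have e: "(\<integral>y. ?N y * \<phi> x y \<partial>lborel)
      = D x * (?\<psi> (s + h) (L x) - 1 / (1 + L x * h) * (\<integral>y. ?N y * ?\<psi> s (logistic_step h (L x) y) \<partial>lborel))" .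
    have "\<bar>\<integral>y. ?N y * \<phi> x y \<partial>lborel\<bar> \<le> 1 * (302 * (1 + L x)\<^sup>2 * (h * sqrt h))"
      unfolding e abs_mult using D[of x]
      by (intro mult_mono bessel_laplace_one_step[OF R L(1) s h0 h(2)]) auto
    also have "\<dots> \<le> g x"
    proof -
      have "(1 + L x)\<^sup>2 \<le> (1 + l * exp (log_walk h x k))\<^sup>2"
        using L[of x] by (intro power_mono) auto
      then have "302 * (h * sqrt h) * (1 + L x)\<^sup>2 \<le> 302 * (h * sqrt h) * (1 + l * exp (log_walk h x k))\<^sup>2"
        by (rule mult_left_mono) (use h0 in simp)
      then show ?thesis
        by (simp add: g_def mult.commute mult.left_commute)
    qed
    finally show "\<bar>\<integral>y. ?N y * \<phi> x y \<partial>lborel\<bar> \<le> g x" .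
  qed (use dist \<phi>m \<phi>int gm gint in auto)
  also have "\<dots> \<le> expectation (\<lambda>\<omega>. c * (1 + l\<^sup>2 * (exp (4 * grid t n k) * exp (4 * B (grid t n k) \<omega>))))"
    by (rule integral_mono[OF gint iB gX])
  also have "\<dots> = c * (1 + l\<^sup>2 * exp (12 * grid t n k))"
  proof -
    have "exp (4 * grid t n k) * exp (8 * grid t n k) = exp (12 * grid t n k)"
      by (simp add: exp_add[symmetric])
    then show ?thesis
      using exponential_moment[OF u, of 4] by (simp add: prob_space)
  qed
  also have "\<dots> \<le> c * (1 + l\<^sup>2 * exp (12 * t))"
    using grid_le[OF less_imp_le[OF t] n less_imp_le[OF k]] c0
    by (intro mult_left_mono add_left_mono) auto
  finally have "\<bar>expectation (\<lambda>\<omega>. \<phi> (X \<omega>) (\<pi> (Z \<omega>)))\<bar> \<le> 604 * (1 + l\<^sup>2 * exp (12 * t)) * (h * sqrt h)"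
    by (simp add: c_def mult.commute mult.left_commute)
  then show ?thesis
    unfolding \<phi>X Bochner_Integration.integral_diff[OF i1 i2] unfolding D_def L_def \<xi>_def .
qed

lemma exp_functional_riemann:
  assumes t: "0 < t" and \<omega>: "\<omega> \<in> space M"
  shows "(\<lambda>n. \<Sum>j<n. t / real n * exp (2 * (B (grid t n j) \<omega> + grid t n j))) \<longlonglongrightarrow> exp_functional 1 B t \<omega>"
proof -
  have "continuous_on {0..t} (\<lambda>u. B u \<omega>)"
    using continuous_paths[OF \<omega>] by (rule continuous_on_subset) auto
  then have "continuous_on {0..t} (\<lambda>u. exp (2 * (B u \<omega> + u)))"
    by (intro continuous_intros)
  from riemann_sums_tendsto[OF t this] show ?thesis
    by (simp add: exp_functional_def)
qed

lemma exp_functional_measurable: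
  assumes t: "0 < t"
  shows "exp_functional 1 B t \<in> borel_measurable M"
proof (rule borel_measurable_LIMSEQ_real)
  show "(\<lambda>n. \<Sum>j<n. t / real n * exp (2 * (B (grid t n j) \<omega> + grid t n j))) \<longlonglongrightarrow> exp_functional 1 B t \<omega>"
    if "\<omega> \<in> space M" for \<omega>
    using t that by (rule exp_functional_riemann)
  have [measurable]: "B (grid t n j) \<in> borel_measurable M" for n j
    using t by (intro measurable_B grid_nonneg) simp
  show "(\<lambda>\<omega>. \<Sum>j<n. t / real n * exp (2 * (B (grid t n j) \<omega> + grid t n j))) \<in> borel_measurable M" for n
    by measurable
qed

lemma exp_functional_pos:
  assumes t: "0 < t" and \<omega>: "\<omega> \<in> space M"
  shows "0 < exp_functional 1 B t \<omega>"
proof -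
  have "continuous_on {0..t} (\<lambda>u. B u \<omega>)"
    using continuous_paths[OF \<omega>] by (rule continuous_on_subset) auto
  then have cont: "continuous_on {0..t} (\<lambda>u. exp (2 * (B u \<omega> + 1 * u)))"
    by (intro continuous_intros)
  obtain v where "v \<in> {0..t}" and v: "\<And>u. u \<in> {0..t} \<Longrightarrow> exp (2 * (B v \<omega> + 1 * v)) \<le> exp (2 * (B u \<omega> + 1 * u))"
    using continuous_attains_inf[OF compact_Icc _ cont] t by force
  have "0 < exp (2 * (B v \<omega> + 1 * v)) * t"
    using t by simp
  also have "\<dots> = (LINT u:{0..t}|lborel. exp (2 * (B v \<omega> + 1 * v)))"
    using t by (simp add: set_lebesgue_integral_def)
  also have "\<dots> \<le> exp_functional 1 B t \<omega>"
    unfolding exp_functional_def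
    using v by (intro set_integral_mono borel_integrable_atLeastAtMost' cont continuous_on_const)
  finally show ?thesis .
qed

lemma chain_killing_tendsto:
  assumes l: "0 < l" and t: "0 < t" and \<omega>: "\<omega> \<in> space M"
  shows "(\<lambda>n. chain_killing (4 * t / real n) l (increments t n \<omega>) n)
    \<longlonglongrightarrow> 1 / (1 + l * (4 * exp_functional 1 B t \<omega>))"
proof -
  have "4 * t / real n * (\<Sum>j<n. exp (log_walk (4 * t / real n) (increments t n \<omega>) j))
      = 4 * (\<Sum>j<n. t / real n * exp (2 * (B (grid t n j) \<omega> + grid t n j)))" for n
    unfolding log_walk_increments[OF \<omega>] by (simp add: sum_distrib_left mult.assoc)
  then have "chain_killing (4 * t / real n) l (increments t n \<omega>) n
      = 1 / (1 + l * (4 * (\<Sum>j<n. t / real n * exp (2 * (B (grid t n j) \<omega> + grid t n j)))))" for n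
    unfolding chain_killing_def mult.assoc by (simp only:)
  moreover have "(\<lambda>n. 1 / (1 + l * (4 * (\<Sum>j<n. t / real n * exp (2 * (B (grid t n j) \<omega> + grid t n j))))))
      \<longlonglongrightarrow> 1 / (1 + l * (4 * exp_functional 1 B t \<omega>))"
  proof (intro tendsto_divide tendsto_add tendsto_mult tendsto_const exp_functional_riemann[OF t \<omega>])
    have "0 \<le> l * (4 * exp_functional 1 B t \<omega>)"
      using l exp_functional_pos[OF t \<omega>] by simp
    then show "1 + l * (4 * exp_functional 1 B t \<omega>) \<noteq> 0" by linarith
  qed
  ultimately show ?thesis
    by simp
qed

text \<open>
  The duality.  The expectations \<open>a k\<close> let the chain run for \<open>k\<close> steps and \<open>R\<close> for the remaining
  time.  At \<open>k = 0\<close> this is the Laplace transform of \<open>cosh R - 1\<close>; at \<open>k = n\<close> only the survival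
  probability of the chain is left, because \<open>R\<close> starts from \<open>0\<close>.  The time of the Brownian motion
  is a quarter of the time of \<open>R\<close>.
\<close>

theorem bessel_laplace_eq:
  fixes R :: "real \<Rightarrow> 'b \<Rightarrow> real" and M' :: "'b measure"
  assumes R: "hyperbolic_bessel_0 M' R" and l: "0 < l" and t: "0 < t"
  shows "bessel_mean M' R l 1 (4 * t) = expectation (\<lambda>\<omega>. 1 / (1 + l * (4 * exp_functional 1 B t \<omega>)))"
proof -
  define K where "K = 604 * (1 + l\<^sup>2 * exp (12 * t))"
  have K0: "0 \<le> K" by (simp add: K_def)
  define e where "e n = expectation (\<lambda>\<omega>. chain_killing (4 * t / real n) l (increments t n \<omega>) n)" for n
  have bound: "\<bar>bessel_mean M' R l 1 (4 * t) - e n\<bar> \<le> K * (4 * t) * sqrt (4 * t / real n)"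
    if n: "0 < n" "4 * t \<le> real n" for n
  proof -
    define h where "h = 4 * t / real n"
    have h: "0 < h" "h \<le> 1" "real n * h = 4 * t" using n t by (auto simp: h_def)
    define a where "a k = expectation (\<lambda>\<omega>. chain_killing h l (increments t n \<omega>) k
        * bessel_mean M' R (chain_state h l (increments t n \<omega>) k) 1 (real (n - k) * h))" for k
    have "\<bar>a k - a (Suc k)\<bar> \<le> K * (h * sqrt h)" if "k < n" for k
    proof -
      have split: "real (n - k) * h = real (n - Suc k) * h + h"
        using that by (simp add: of_nat_diff algebra_simps)
      show ?thesis
        unfolding a_def split K_def
        by (rule chain_expectation_step[OF R l t that _ h_def h(2)]) (use h(1) in simp)
    qed
    then have "\<bar>\<Sum>k<n. a k - a (Suc k)\<bar> \<le> (\<Sum>k<n. K * (h * sqrt h))"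
      by (intro order_trans[OF sum_abs] sum_mono) auto
    also have "\<dots> = K * (real n * h) * sqrt h"
      by simp
    finally have "\<bar>a 0 - a n\<bar> \<le> K * (4 * t) * sqrt h"
      unfolding sum_lessThan_telescope' h(3) .
    moreover have "a 0 = bessel_mean M' R l 1 (4 * t)"
      by (simp add: a_def chain_killing_def chain_state_def log_walk_def h(3) prob_space)
    moreover have "a n = e n"
      by (simp add: a_def e_def bessel_mean_zero[OF R] h_def)
    ultimately show ?thesis
      by (simp add: h_def)
  qed
  have "(\<lambda>n. K * (4 * t) * sqrt (4 * t / real n)) \<longlonglongrightarrow> K * (4 * t) * sqrt 0"
    by (intro tendsto_intros lim_const_over_n)
  then have error: "(\<lambda>n. K * (4 * t) * sqrt (4 * t / real n)) \<longlonglongrightarrow> 0"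
    by simp
  have ev: "\<forall>\<^sub>F n in sequentially. \<bar>bessel_mean M' R l 1 (4 * t) - e n\<bar> \<le> K * (4 * t) * sqrt (4 * t / real n)"
  proof -
    obtain m :: nat where m: "4 * t \<le> real m"
      using real_arch_simple by blast
    show ?thesis
      using eventually_ge_at_top[of "max 1 m"]
    proof eventually_elim
      case (elim n)
      then have "0 < n" "real m \<le> real n" by auto
      with m show ?case by (intro bound) auto
    qed
  qed
  have "(\<lambda>n. bessel_mean M' R l 1 (4 * t) - e n) \<longlonglongrightarrow> 0"
    by (rule Lim_null_comparison[OF _ error]) (use ev in \<open>simp only: real_norm_def\<close>)
  from tendsto_diff[OF tendsto_const[of "bessel_mean M' R l 1 (4 * t)"] this]
  have lim1: "e \<longlonglongrightarrow> bessel_mean M' R l 1 (4 * t)"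
    by simp
  have "(\<lambda>n. e (Suc n)) \<longlonglongrightarrow> expectation (\<lambda>\<omega>. 1 / (1 + l * (4 * exp_functional 1 B t \<omega>)))"
    unfolding e_def
  proof (rule integral_dominated_convergence[where w="\<lambda>_. 1"])
    have [measurable]: "exp_functional 1 B t \<in> borel_measurable M"
      using t by (rule exp_functional_measurable)
    show "(\<lambda>\<omega>. 1 / (1 + l * (4 * exp_functional 1 B t \<omega>))) \<in> borel_measurable M"
      by measurable
    show "(\<lambda>\<omega>. chain_killing (4 * t / real (Suc n)) l (increments t (Suc n) \<omega>) (Suc n)) \<in> borel_measurable M" for n
      using chain_measurable(2)[of "Suc n" "\<lambda>j \<omega>. increments t (Suc n) \<omega> j" M]
        increments_measurable[OF less_imp_le[OF t]] by simp
    show "AE \<omega> in M. (\<lambda>n. chain_killing (4 * t / real (Suc n)) l (increments t (Suc n) \<omega>) (Suc n))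
        \<longlonglongrightarrow> 1 / (1 + l * (4 * exp_functional 1 B t \<omega>))"
      by (rule AE_I2) (rule LIMSEQ_Suc[OF chain_killing_tendsto[OF l t]])
    show "AE \<omega> in M. norm (chain_killing (4 * t / real (Suc n)) l (increments t (Suc n) \<omega>) (Suc n)) \<le> 1" for n
    proof (rule AE_I2)
      fix \<omega>
      have "0 < 4 * t / real (Suc n)" using t by simp
      from chain_killing_bounds[OF l this, of "increments t (Suc n) \<omega>" "Suc n"]
      show "norm (chain_killing (4 * t / real (Suc n)) l (increments t (Suc n) \<omega>) (Suc n)) \<le> 1"
        by simp
    qed
  qed simp
  then show ?thesis
    using LIMSEQ_Suc[OF lim1] by (intro LIMSEQ_unique)
qed

end

section \<open>The law of the hyperbolic cosine\<close>

theorem theorem2p11: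
  fixes M :: "'a measure" and R :: "real \<Rightarrow> 'a \<Rightarrow> real"
    and N :: "'b measure" and B :: "real \<Rightarrow> 'b \<Rightarrow> real" and t :: real
  assumes "hyperbolic_bessel_0 M R"
    and "brownian_motion N B"
    and "t > 0"
  shows "distributed M lborel (\<lambda>\<omega>. cosh (R t \<omega>))
    (\<lambda>z. indicator {1..} z *
      (\<integral>\<^sup>+ \<omega>. ennreal (1 / (4 * exp_functional 1 B (t / 4) \<omega>) *
                     exp (- ((z - 1) / (4 * exp_functional 1 B (t / 4) \<omega>)))) \<partial>N))"
proof -
  interpret M: prob_space M using assms(1) by (rule bessel_prob_space)
  interpret N: brownian_motion N B by (rule assms(2))
  interpret pair_sigma_finite N "lborel :: real measure" ..
  have t4: "0 < t / 4" using assms(3) by simp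
  define c where "c \<omega> = 4 * exp_functional 1 B (t / 4) \<omega>" for \<omega>
  have [measurable]: "exp_functional 1 B (t / 4) \<in> borel_measurable N"
    using t4 by (rule N.exp_functional_measurable)
  have c_meas[measurable]: "c \<in> borel_measurable N"
    unfolding c_def[abs_def] by measurable
  have c_pos: "0 < c \<omega>" if "\<omega> \<in> space N" for \<omega>
    using N.exp_functional_pos[OF t4 that] by (simp add: c_def)
  define k where "k z \<omega> = ennreal (1 / c \<omega> * exp (- ((z - 1) / c \<omega>)))" for z \<omega>
  define f where "f z = indicator {1..} z * (\<integral>\<^sup>+\<omega>. k z \<omega> \<partial>N)" for z :: real
  have k_meas[measurable]: "(\<lambda>(z, \<omega>). k z \<omega>) \<in> borel_measurable (lborel \<Otimes>\<^sub>M N)"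
    unfolding k_def by measurable
  have f_meas[measurable]: "f \<in> borel_measurable borel"
    unfolding f_def[abs_def] by measurable
  \<comment> \<open>The measure with the claimed density; its total mass is the case \<open>l = 0\<close> of the next formula.\<close>
  define \<nu> where "\<nu> = density lborel f"
  have laplace: "(\<integral>\<^sup>+z. ennreal (exp (- (l * z))) \<partial>\<nu>) = ennreal (exp (- l)) * (\<integral>\<^sup>+\<omega>. ennreal (1 / (1 + l * c \<omega>)) \<partial>N)"
    if l: "0 \<le> l" for l
  proof -
    have "(\<integral>\<^sup>+z. ennreal (exp (- (l * z))) \<partial>\<nu>) = (\<integral>\<^sup>+z. f z * ennreal (exp (- (l * z))) \<partial>lborel)"
      unfolding \<nu>_def by (rule nn_integral_density) simp_all
    also have "\<dots> = (\<integral>\<^sup>+z. (\<integral>\<^sup>+\<omega>. k z \<omega> * ennreal (exp (- (l * z))) * indicator {1..} z \<partial>N) \<partial>lborel)"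
      by (intro nn_integral_cong) (auto simp: f_def nn_integral_multc split: split_indicator)
    also have "\<dots> = (\<integral>\<^sup>+\<omega>. (\<integral>\<^sup>+z. k z \<omega> * ennreal (exp (- (l * z))) * indicator {1..} z \<partial>lborel) \<partial>N)"
      by (rule Fubini') measurable
    also have "\<dots> = (\<integral>\<^sup>+\<omega>. ennreal (exp (- l)) * ennreal (1 / (1 + l * c \<omega>)) \<partial>N)"
    proof (rule nn_integral_cong)
      fix \<omega> assume "\<omega> \<in> space N"
      then have c: "0 < c \<omega>" by (rule c_pos)
      have "k z \<omega> * ennreal (exp (- (l * z))) * indicator {1..} z
          = ennreal (exp (- l)) * (ennreal (1 / c \<omega> * exp (- ((z - 1) / c \<omega>)) * exp (- (l * (z - 1)))) * indicator {1..} z)" for z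
      proof -
        have "exp (- (l * z)) = exp (- l) * exp (- (l * (z - 1)))"
          by (simp add: exp_add[symmetric] algebra_simps)
        then show ?thesis
          using c by (simp add: k_def ennreal_mult[symmetric] mult.assoc[symmetric])
            (simp add: mult.commute mult.left_commute)
      qed
      then have "(\<integral>\<^sup>+z. k z \<omega> * ennreal (exp (- (l * z))) * indicator {1..} z \<partial>lborel)
          = ennreal (exp (- l)) * (\<integral>\<^sup>+z. ennreal (1 / c \<omega> * exp (- ((z - 1) / c \<omega>)) * exp (- (l * (z - 1)))) * indicator {1..} z \<partial>lborel)"
        by (simp only:) (rule nn_integral_cmult, measurable)
      also have "\<dots> = ennreal (exp (- l)) * ennreal (1 / (1 + l * c \<omega>))"
        unfolding nn_integral_shifted_exponential[OF c l] ..
      finally show "(\<integral>\<^sup>+z. k z \<omega> * ennreal (exp (- (l * z))) * indicator {1..} z \<partial>lborel)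
          = ennreal (exp (- l)) * ennreal (1 / (1 + l * c \<omega>))" .
    qed
    also have "\<dots> = ennreal (exp (- l)) * (\<integral>\<^sup>+\<omega>. ennreal (1 / (1 + l * c \<omega>)) \<partial>N)"
      by (rule nn_integral_cmult) measurable
    finally show ?thesis .
  qed
  have "emeasure \<nu> (space \<nu>) = 1"
    using laplace[of 0] by (simp add: N.emeasure_space_1)
  then interpret \<nu>: prob_space \<nu>
    by (rule prob_spaceI)
  have \<nu>_real: "real_distribution \<nu>"
    unfolding real_distribution_def real_distribution_axioms_def using \<nu>.prob_space_axioms by (simp add: \<nu>_def)
  have cosh_meas[measurable]: "(\<lambda>\<omega>. cosh (R t \<omega>)) \<in> borel_measurable M"
    by (rule measurable_compose[OF bessel_measurable[OF assms(1) less_imp_le[OF assms(3)]]])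
      (auto intro!: borel_measurable_continuous_onI continuous_intros)
  have \<mu>_real: "real_distribution (distr M borel (\<lambda>\<omega>. cosh (R t \<omega>)))"
    by (rule M.real_distribution_distr) simp
  have \<mu>_laplace: "(\<integral>z. exp (- (l * z)) \<partial>distr M borel (\<lambda>\<omega>. cosh (R t \<omega>))) = exp (- l) * bessel_mean M R l 1 t" for l
  proof -
    have "(\<integral>z. exp (- (l * z)) \<partial>distr M borel (\<lambda>\<omega>. cosh (R t \<omega>))) = (\<integral>\<omega>. exp (- (l * cosh (R t \<omega>))) \<partial>M)"
      by (rule integral_distr) simp_all
    also have "\<dots> = (\<integral>\<omega>. exp (- l) * poly_exp l 1 (cosh (R t \<omega>) - 1) \<partial>M)"
      by (intro Bochner_Integration.integral_cong refl) (simp add: exp_add[symmetric] algebra_simps)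
    finally show ?thesis
      by (simp add: bessel_mean_def)
  qed
  have \<nu>_laplace: "(\<integral>z. exp (- (l * z)) \<partial>\<nu>) = exp (- l) * (\<integral>\<omega>. 1 / (1 + l * c \<omega>) \<partial>N)" if l: "0 \<le> l" for l
  proof -
    have nonneg: "0 \<le> 1 / (1 + l * c \<omega>)" if "\<omega> \<in> space N" for \<omega>
      using c_pos[OF that] l by simp
    have int: "integrable N (\<lambda>\<omega>. 1 / (1 + l * c \<omega>))"
    proof (rule N.integrable_const_bound[where B=1])
      show "AE \<omega> in N. norm (1 / (1 + l * c \<omega>)) \<le> 1"
      proof (rule AE_I2)
        fix \<omega> assume "\<omega> \<in> space N"
        then have "0 \<le> l * c \<omega>" using c_pos[of \<omega>] l by simp
        then show "norm (1 / (1 + l * c \<omega>)) \<le> 1" by simp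
      qed
    qed measurable
    have "(\<integral>\<^sup>+\<omega>. ennreal (1 / (1 + l * c \<omega>)) \<partial>N) = ennreal (\<integral>\<omega>. 1 / (1 + l * c \<omega>) \<partial>N)"
      using nonneg by (intro nn_integral_eq_integral int AE_I2) auto
    then have "(\<integral>\<^sup>+z. ennreal (exp (- (l * z))) \<partial>\<nu>) = ennreal (exp (- l) * (\<integral>\<omega>. 1 / (1 + l * c \<omega>) \<partial>N))"
      unfolding laplace[OF l] by (simp add: ennreal_mult')
    moreover have "0 \<le> (\<integral>\<omega>. 1 / (1 + l * c \<omega>) \<partial>N)"
      using nonneg by (intro integral_nonneg_AE AE_I2) auto
    ultimately show ?thesis
      by (subst integral_eq_nn_integral) (auto simp: \<nu>_def)
  qed
  have "distr M borel (\<lambda>\<omega>. cosh (R t \<omega>)) = \<nu>"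
  proof (rule laplace_transform_determines[OF \<mu>_real \<nu>_real])
    show "AE x in distr M borel (\<lambda>\<omega>. cosh (R t \<omega>)). 0 \<le> x"
      by (subst AE_distr_iff) (auto intro: order_trans[OF zero_le_one cosh_real_ge_1])
    show "AE x in \<nu>. 0 \<le> x"
      unfolding \<nu>_def by (subst AE_density) (auto simp: f_def split: split_indicator)
    fix n :: nat
    show "(\<integral>x. exp (- (real n * x)) \<partial>distr M borel (\<lambda>\<omega>. cosh (R t \<omega>))) = (\<integral>x. exp (- (real n * x)) \<partial>\<nu>)"
    proof (cases "n = 0")
      case True
      then show ?thesis
        using prob_space.prob_space[OF real_distribution.axioms(1)[OF \<mu>_real]] \<nu>.prob_space by simp
    next
      case False
      have "bessel_mean M R (real n) 1 t = (\<integral>\<omega>. 1 / (1 + real n * c \<omega>) \<partial>N)"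
        using N.bessel_laplace_eq[OF assms(1) _ t4, of "real n"] False by (simp add: c_def)
      then show ?thesis
        unfolding \<mu>_laplace by (subst \<nu>_laplace) auto
    qed
  qed
  then have eq: "distr M lborel (\<lambda>\<omega>. cosh (R t \<omega>)) = density lborel f"
    by (simp add: \<nu>_def cong: distr_cong)
  have "distributed M lborel (\<lambda>\<omega>. cosh (R t \<omega>)) f"
    unfolding distributed_def using eq by simp
  then show ?thesis
    unfolding f_def[abs_def] k_def c_def .
qed

end
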